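(* Let $(A(n))_{n\in\mathbb{N}}$ be a sequence of i.i.d. random matrices with values in $\mathbb{R}_{\max}^{d\times d}$ and no line of $-\infty$, such that $\max_{A_{ij}(0)\neq-\infty}|A_{ij}(0)|$ (the maximum over the pairs $(i,j)$ with $A_{ij}(0)\ne-\infty$) is integrable. Then the sequence $\left(\frac1n x(n,0)\right)_{n}$ converges almost surely if and only if, for every component $c_m$ of $\mathcal{G}(A)$, $A^{\{m\}}(0)$ has no line of $-\infty$. That being the case, the limit is given by $$\forall m\in\{1,\dots,K\},\quad \lim_n\frac1n x^{c_m}(n,0)=\gamma^{[m]}\mathbf{1}\quad\text{a.s.}$$
   Context: Max-plus conventions. $\mathbb{R}_{\max}=\mathbb{R}\cup\{-\infty\}$ is the semi-ring with addition $\max$ and multiplication $+$. Products are max-plus: $(Ax)_i=\max_j(A_{ij}+x_j)$, $(AB)_{ij}=\max_k(A_{ik}+B_{kj})$. $0$ denotes the vector with all coordinates $0$ and $\mathbf{1}$ the vector with all coordinates $1$; $\gamma\mathbf 1$ is the vector with all coordinates equal to $\gamma\in\mathbb{R}_{\max}$. A random matrix has "no line of $-\infty$" if almost surely each of its rows contains an entry different from $-\infty$. Sequences. $x(n,0):=A(n-1)A(n-2)\cdots A(0)\,0$. For $I\subset\{1,\dots,d\}$ and a vector $x$, $x^I:=(x_i)_{i\in I}$. Maximal Lyapunov exponent. For a stationary ergodic sequence of (square) random matrices $(M(n))$ with entries in $\mathbb{R}_{\max}$ (rows of $-\infty$ allowed) with $\max_{ij}M^+_{ij}(0)$ integrable,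 $\frac1n\max_{i,j}(M(n-1)\cdots M(0))_{ij}$ converges a.s. to a constant $\gamma(M)\in\mathbb{R}_{\max}$, the maximal Lyapunov exponent. Graph. $\mathcal{G}(A)$ is the directed graph with nodes $1,\dots,d$ and arcs the pairs $(i,j)$ with $\mathbb{P}(A_{ij}(0)\neq-\infty)>0$. Its strongly connected components (called components) are $c_1,\dots,c_K$ (a component may be a single node without loop). Write $m\rightarrow l$ if $m=l$ or there is a path in $\mathcal{G}(A)$ from a node of $c_m$ to a node of $c_l$. For each $m$ define: $\gamma^{(m)}:=\gamma\big((A_{ij}(n))_{i,j\in c_m}\big)$; $E_m:=\{l: m\rightarrow l\}$; $\gamma^{[m]}:=\max_{l\in E_m}\gamma^{(l)}$; $G_m:=\{l\in E_m: \exists p,\ m\rightarrow l\rightarrow p,\ \gamma^{(p)}=\gamma^{[m]}\}$; $H_m:=\bigcup_{l\in G_m}c_l$; $A^{\{m\}}(n):=(A_{ij}(n))_{i,j\in H_m}$. *)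

theory Defs
  imports "HOL-Probability.Probability"
begin

text \<open>
  The max-plus semiring of reals extended by \<open>-\<infinity>\<close> is the set of all extended reals other
  than \<open>\<infinity>\<close>; there the addition of \<^typ>\<open>ereal\<close> satisfies \<open>-\<infinity> + x = -\<infinity>\<close>.
  Square matrices are functions on pairs of indices from a finite type. A submatrix is given
  by the full matrix together with the set \<open>I\<close> of its row and column indices.  Suprema over
  finite index sets are maxima, the empty maximum being the max-plus zero \<open>-\<infinity>\<close>.
\<close>

type_synonym 'n mp_vec = "'n \<Rightarrow> ereal"
type_synonym 'n mp_mat = "'n \<Rightarrow> 'n \<Rightarrow> ereal"

definition mp_mat_space :: "'n::finite mp_mat measure" where
  "mp_mat_space = (\<Pi>\<^sub>M i\<in>UNIV. \<Pi>\<^sub>M j\<in>UNIV. borel)"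

definition mp_id :: "'n::finite mp_mat" where
  "mp_id = (\<lambda>i j. if i = j then 0 else -\<infinity>)"

definition mp_mult :: "'n::finite set \<Rightarrow> 'n mp_mat \<Rightarrow> 'n mp_mat \<Rightarrow> 'n mp_mat" where
  "mp_mult I A B = (\<lambda>i j. SUP k\<in>I. A i k + B k j)"

definition mp_mult_vec :: "'n::finite set \<Rightarrow> 'n mp_mat \<Rightarrow> 'n mp_vec \<Rightarrow> 'n mp_vec" where
  "mp_mult_vec I A x = (\<lambda>i. SUP j\<in>I. A i j + x j)"

text \<open>\<open>mp_prod I A n\<close> is \<open>A(n-1) \<cdots> A(0)\<close>, all matrices being restricted to \<open>I \<times> I\<close>.\<close>

primrec mp_prod :: "'n::finite set \<Rightarrow> (nat \<Rightarrow> 'n mp_mat) \<Rightarrow> nat \<Rightarrow> 'n mp_mat" where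
  "mp_prod I A 0 = mp_id"
| "mp_prod I A (Suc n) = mp_mult I (A n) (mp_prod I A n)"

definition mp_orbit :: "(nat \<Rightarrow> 'n::finite mp_mat) \<Rightarrow> nat \<Rightarrow> 'n mp_vec" where
  "mp_orbit A n = mp_mult_vec UNIV (mp_prod UNIV A n) (\<lambda>_. 0)"

definition no_bot_line :: "'w measure \<Rightarrow> 'n::finite set \<Rightarrow> ('w \<Rightarrow> 'n mp_mat) \<Rightarrow> bool" where
  "no_bot_line M I B \<longleftrightarrow> (AE \<omega> in M. \<forall>i\<in>I. \<exists>j\<in>I. B \<omega> i j \<noteq> -\<infinity>)"

text \<open>
  The maximal Lyapunov exponent of the submatrices indexed by \<open>I\<close>: the almost sure limit is
  unique on a probability space, and it exists for stationary ergodic sequences whose entries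
  have integrable positive part.
\<close>

definition lyapunov ::
    "'w measure \<Rightarrow> (nat \<Rightarrow> 'w \<Rightarrow> 'n::finite mp_mat) \<Rightarrow> 'n set \<Rightarrow> ereal" where
  "lyapunov M A I = (THE \<gamma>. AE \<omega> in M.
     (\<lambda>n. (SUP i\<in>I. SUP j\<in>I. mp_prod I (\<lambda>k. A k \<omega>) n i j) / ereal (real n)) \<longlonglongrightarrow> \<gamma>)"

definition arcs_of :: "'w measure \<Rightarrow> (nat \<Rightarrow> 'w \<Rightarrow> 'n::finite mp_mat) \<Rightarrow> 'n rel" where
  "arcs_of M A = {(i, j). measure M {\<omega> \<in> space M. A 0 \<omega> i j \<noteq> -\<infinity>} > 0}"

definition scc_classes :: "'n rel \<Rightarrow> 'n set set" where
  "scc_classes R = UNIV // {(i, j). (i, j) \<in> R\<^sup>* \<and> (j, i) \<in> R\<^sup>*}"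

definition leads_to :: "'n rel \<Rightarrow> 'n set \<Rightarrow> 'n set \<Rightarrow> bool" where
  "leads_to R c c' \<longleftrightarrow> c = c' \<or> (\<exists>i\<in>c. \<exists>j\<in>c'. (i, j) \<in> R\<^sup>+)"

text \<open>
  Components are not numbered: the sets \<open>E\<^sub>m\<close>, \<open>G\<^sub>m\<close> of labels become sets of
  components, and \<open>\<gamma>\<^bsup>[m]\<^esup>\<close>, \<open>H\<^sub>m\<close> are \<open>gamma_max\<close> and \<open>H_nodes\<close> at \<open>c\<^sub>m\<close>.
\<close>

definition E_comps ::
    "'w measure \<Rightarrow> (nat \<Rightarrow> 'w \<Rightarrow> 'n::finite mp_mat) \<Rightarrow> 'n set \<Rightarrow> 'n set set" where
  "E_comps M A c = {l \<in> scc_classes (arcs_of M A). leads_to (arcs_of M A) c l}"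

definition gamma_max ::
    "'w measure \<Rightarrow> (nat \<Rightarrow> 'w \<Rightarrow> 'n::finite mp_mat) \<Rightarrow> 'n set \<Rightarrow> ereal" where
  "gamma_max M A c = Max (lyapunov M A ` E_comps M A c)"

definition G_comps ::
    "'w measure \<Rightarrow> (nat \<Rightarrow> 'w \<Rightarrow> 'n::finite mp_mat) \<Rightarrow> 'n set \<Rightarrow> 'n set set" where
  "G_comps M A c = {l \<in> E_comps M A c. \<exists>p \<in> scc_classes (arcs_of M A).
     leads_to (arcs_of M A) c l \<and> leads_to (arcs_of M A) l p \<and>
     lyapunov M A p = gamma_max M A c}"

definition H_nodes ::
    "'w measure \<Rightarrow> (nat \<Rightarrow> 'w \<Rightarrow> 'n::finite mp_mat) \<Rightarrow> 'n set \<Rightarrow> 'n set" where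
  "H_nodes M A c = \<Union> (G_comps M A c)"

end

theory Submission
  imports Defs
begin

text \<open>
  A real process over an i.i.d. sequence which is superadditive along a finite set of states
  (\<open>superadditive_states\<close>) and exceeds slope \<open>u\<close> infinitely often with positive probability from
  every state has expected minimum at least \<open>u n - o(n)\<close>, by a greedy concatenation of good stretches
  as in Steele's proof of Kingman's theorem. With a single state this yields the strong law of
  large numbers and the lower bound in Kingman's theorem, hence the Lyapunov exponents.

  The upper bound on the orbit follows by induction over the components: a path consists of a
  stretch inside its component, whose slope is controlled uniformly over all time windows, one
  arc, and a path from a smaller reachable set. For the lower bound, the reversed vector
  \<open>A(0) \<cdots> A(n-1) 0\<close> has the law of the orbit and is superadditive along the nodes of \<open>H\<^sub>m\<close> if
  \<open>A\<^bsup>{m}\<^esup>\<close> has no line of \<open>-\<infinity>\<close>. From every node of \<open>H\<^sub>m\<close> the slope \<open>\<gamma>\<^bsup>[m]\<^esup>\<close> is possible, so the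
  expected minimum over \<open>H\<^sub>m\<close> has this slope. The minimum of the orbit over \<open>H\<^sub>m\<close> is superadditive
  as well, and the strong law for its blocks concludes. Conversely, a line of \<open>-\<infinity>\<close> in
  \<open>A\<^bsup>{m}\<^esup>\<close> recurs infinitely often and makes the orbit oscillate.
\<close>

section \<open>Superadditive processes over an i.i.d. sequence\<close>

text \<open>The orbit resists concatenation from a fixed starting node: in
  \<open>A(n-1) ... A(0) 0\<close> a path from \<open>i\<close> reads the newest matrix first, so
  its beginning changes with \<open>n\<close>. In the reversed product the first \<open>m\<close>
  matrices fix where a chosen path, optimal for \<open>m\<close> steps, stands after them, and what
  follows is a fresh copy of the sequence; this is why superadditivity is formulated along a state
  \<open>J i m\<close>. Reversal preserves the law only for each fixed \<open>n\<close>, so almost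
  sure statements about the reversed vector do not carry over to the orbit. Probabilities and
  expectations at single times do, and the lower bound therefore passes through an expectation. That
  it is the expectation of a minimum over all of \<open>H\<close> is forced by the orbit: when a new
  block is glued onto an old one, the node at which they meet is not under control. Inside a
  component there may be rows of \<open>-\<infinity>\<close>, so an exponent may be
  \<open>-\<infinity>\<close>; upper bounds are thus stated through real slopes above the
  exponent.\<close>

definition shift_seq :: "nat \<Rightarrow> (nat \<Rightarrow> 'a) \<Rightarrow> nat \<Rightarrow> 'a" where
  "shift_seq k s = (\<lambda>n. s (k + n))"

lemma shift_seq_0 [simp]: "shift_seq 0 s = s"
  by (simp add: shift_seq_def)

lemma shift_seq_shift_seq [simp]: "shift_seq k (shift_seq l s) = shift_seq (l + k) s"
  by (simp add: shift_seq_def add.assoc)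

lemma shift_seq_comb_seq [simp]: "shift_seq m (comb_seq m s s') = s'"
  by (auto simp: shift_seq_def comb_seq_def)

section \<open>Measure-preserving reindexings of the product space\<close>

context sequence_space
begin

lemma measurable_shift_seq [measurable]: "shift_seq k \<in> measurable S S"
  unfolding shift_seq_def by (rule measurable_PiM_single') (auto simp: space_PiM)

text \<open>Equal factors make every injective choice of coordinates measure preserving; the shift
  and the reversal of a prefix are both of this kind.\<close>

lemma distr_reindex:
  assumes "inj f"
  shows "distr S S (\<lambda>s n. s (f n)) = S"
  using distr_PiM_reindex[of UNIV "\<lambda>_. M" f UNIV] assms prob_space by (simp add: restrict_def)

lemma distr_shift_seq: "distr S S (shift_seq k) = S"
  unfolding shift_seq_def by (rule distr_reindex) simp

lemma AE_shift_seq: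
  assumes "AE s in S. Q s"
  shows "AE s in S. \<forall>k. Q (shift_seq k s)"
proof -
  have "AE s in S. Q (shift_seq k s)" for k
    by (rule AE_distrD[OF measurable_shift_seq]) (simp only: distr_shift_seq assms)
  then show ?thesis by (simp add: AE_all_countable)
qed

lemma integrable_shift_seq:
  fixes f :: "_ \<Rightarrow> real"
  assumes "integrable S f"
  shows "integrable S (\<lambda>s. f (shift_seq k s))"
  by (rule integrable_distr[where M' = S]) (simp_all only: distr_shift_seq assms measurable_shift_seq)

lemma integral_shift_seq:
  fixes f :: "_ \<Rightarrow> real"
  assumes [measurable]: "f \<in> borel_measurable S"
  shows "(\<integral>s. f (shift_seq k s) \<partial>S) = (\<integral>s. f s \<partial>S)"
  using integral_distr[OF measurable_shift_seq[of k], of f] by (simp add: distr_shift_seq)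

text \<open>Reverse Fatou for events: the tail unions \<open>U m\<close> decrease to the limsup, and
  each contains an event of probability at least \<open>d\<close>. It turns information on single
  times into an event about whole sequences.\<close>

lemma prob_limsup_ge:
  fixes Q :: "nat \<Rightarrow> (nat \<Rightarrow> 'a) \<Rightarrow> bool"
  assumes [measurable]: "\<And>n. {s \<in> space S. Q n s} \<in> sets S"
    and freq: "\<exists>\<^sub>\<infinity>n. d \<le> measure S {s \<in> space S. Q n s}"
  shows "d \<le> measure S {s \<in> space S. \<exists>\<^sub>\<infinity>n. Q n s}"
proof -
  define U where "U m = {s \<in> space S. \<exists>n>m. Q n s}" for m :: nat
  have U [measurable]: "U m \<in> sets S" for m
    unfolding U_def by measurable
  have "decseq U"
    unfolding decseq_def U_def by (auto intro: le_less_trans)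
  then have "(\<lambda>m. measure S (U m)) \<longlonglongrightarrow> measure S (\<Inter>m. U m)"
    by (intro P.finite_Lim_measure_decseq) auto
  moreover have "d \<le> measure S (U m)" for m
  proof -
    obtain n where "n > m" "d \<le> measure S {s \<in> space S. Q n s}"
      using freq by (auto simp: INFM_nat)
    moreover have "measure S {s \<in> space S. Q n s} \<le> measure S (U m)"
      by (rule P.finite_measure_mono) (use \<open>n > m\<close> in \<open>auto simp: U_def\<close>)
    ultimately show ?thesis by simp
  qed
  ultimately have "d \<le> measure S (\<Inter>m. U m)"
    by (intro LIMSEQ_le_const) auto
  also have "(\<Inter>m. U m) = {s \<in> space S. \<exists>\<^sub>\<infinity>n. Q n s}"
    by (auto simp: U_def INFM_nat)
  finally show ?thesis .
qed

end

text \<open>The model: \<open>y i n\<close> is the weight of an optimal path of \<open>n\<close>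
  steps from state \<open>i\<close>, \<open>J i m\<close> the state reached after \<open>m\<close>
  steps, and each step consumes \<open>N\<close> coordinates. Dependence on the prefix alone is
  expressed by invariance under \<open>comb_seq\<close>, which replaces everything after it. As
  \<open>S\<close> is the image of its own square under \<open>comb_seq\<close>, this supplies
  independence of prefix and continuation.\<close>

locale superadditive_states = sequence_space M for M :: "'a measure" +
  fixes N :: nat and I :: "'i set" and y :: "'i \<Rightarrow> nat \<Rightarrow> (nat \<Rightarrow> 'a) \<Rightarrow> real"
    and J :: "'i \<Rightarrow> nat \<Rightarrow> (nat \<Rightarrow> 'a) \<Rightarrow> 'i" and h :: "(nat \<Rightarrow> 'a) \<Rightarrow> real"
  assumes finite_states: "finite I" and states_nonempty: "I \<noteq> {}"
    and integrable_y: "\<And>i n. i \<in> I \<Longrightarrow> integrable S (y i n)"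
    and integrable_h: "integrable S h"
    and h_nonneg: "\<And>s. 0 \<le> h s"
    and y_0: "\<And>i s. y i 0 s = 0"
    and J_in: "\<And>i m s. i \<in> I \<Longrightarrow> J i m s \<in> I"
    and y_prefix: "\<And>i m s s'. i \<in> I \<Longrightarrow> y i m (comb_seq (m * N) s s') = y i m s"
    and J_prefix: "\<And>i m s s'. i \<in> I \<Longrightarrow> J i m (comb_seq (m * N) s s') = J i m s"
    and y_1_ge: "AE s in S. \<forall>i\<in>I. - h s \<le> y i 1 s"
    and superadditive: "AE s in S. \<forall>i\<in>I. \<forall>m n.
      y i m s + y (J i m s) n (shift_seq (m * N) s) \<le> y i (m + n) s"
begin

lemma borel_measurable_y: "i \<in> I \<Longrightarrow> y i n \<in> borel_measurable S"
  using integrable_y by blast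

text \<open>
  Let \<open>W\<close> be the event that no length \<open>n \<ge> 1\<close> has slope \<open>u\<close>, and \<open>W\<^sub>n\<close> the part of it that
  concerns the lengths up to \<open>n\<close>. On \<open>W\<close> the shift by \<open>n\<close> cannot have slope \<open>u' > u\<close> infinitely often
  from the state reached at \<open>n\<close>, which is independent of \<open>W\<^sub>n\<close> given that state. Hence
  \<open>P(W) \<le> (1 - d) P(W\<^sub>n)\<close> for all \<open>n\<close>, and \<open>P(W\<^sub>n)\<close> decreases to \<open>P(W)\<close>.
\<close>

lemma AE_exists_ge:
  assumes "u < u'"
    and pos: "\<And>i. i \<in> I \<Longrightarrow> 0 < measure S {s \<in> space S. \<exists>\<^sub>\<infinity>n. u' * real n \<le> y i n s}"
  shows "AE s in S. \<forall>i\<in>I. \<exists>n\<ge>1. u * real n \<le> y i n s"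
proof -
  define E where "E i = {s \<in> space S. \<exists>\<^sub>\<infinity>n. u' * real n \<le> y i n s}" for i
  define d where "d = Min ((\<lambda>i. measure S (E i)) ` I)"
  have E [measurable]: "E i \<in> sets S" if "i \<in> I" for i
    unfolding E_def INFM_nat using borel_measurable_y[OF that] by measurable
  have "d > 0"
    using pos finite_states states_nonempty by (auto simp: d_def E_def)
  have d_le: "d \<le> measure S (E i)" if "i \<in> I" for i
    using that finite_states by (auto simp: d_def)
  have "d \<le> 1"
    using states_nonempty d_le order_trans P.prob_le_1 by blast
  have "AE s in S. \<exists>n\<ge>1. u * real n \<le> y i n s" if i: "i \<in> I" for i
  proof -
    have [measurable]: "y i k \<in> borel_measurable S" for k
      by (rule borel_measurable_y[OF i])
    define W where "W = {s \<in> space S. \<forall>k\<ge>1. y i k s < u * real k}"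
    define Wn where "Wn n = {s \<in> space S. \<forall>k\<in>{1..n}. y i k s < u * real k}" for n
    have W [measurable]: "W \<in> sets S" and Wn [measurable]: "Wn n \<in> sets S" for n
      unfolding W_def Wn_def by measurable
    have bound: "measure S W \<le> (1 - d) * measure S (Wn n)" for n
    proof -
      let ?c = "\<lambda>(s, s'). comb_seq (n * N) s s'"
      have c [measurable]: "?c \<in> measurable (S \<Otimes>\<^sub>M S) S"
        by (rule measurable_comb_seq)
      have fin: "pair_sigma_finite S S"
        by (simp add: pair_sigma_finite_def P.sigma_finite_measure_axioms)
      have conc: "AE p in S \<Otimes>\<^sub>M S. \<forall>i\<in>I. \<forall>m k. y i m (?c p) + y (J i m (?c p)) k (shift_seq (m * N) (?c p)) \<le> y i (m + k) (?c p)"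
        by (rule AE_distrD[OF c]) (simp only: PiM_comb_seq superadditive)
      have conc': "AE s in S. AE s' in S. \<forall>k. y i n s + y (J i n s) k s' \<le> y i (n + k) (comb_seq (n * N) s s')"
      proof (rule eventually_rev_mp[OF pair_sigma_finite.AE_pair[OF fin conc]], rule AE_I2, rule impI,
          erule eventually_mono, rule allI)
        fix s s' k
        assume "\<forall>i\<in>I. \<forall>m k. y i m (?c (s, s')) + y (J i m (?c (s, s'))) k (shift_seq (m * N) (?c (s, s')))
            \<le> y i (m + k) (?c (s, s'))"
        from this[rule_format, OF i, of n k]
        show "y i n s + y (J i n s) k s' \<le> y i (n + k) (comb_seq (n * N) s s')"
          by (simp add: y_prefix[OF i] J_prefix[OF i])
      qed
      have step: "AE s in S. AE s' in S.
          (indicator W (comb_seq (n * N) s s') :: ennreal) \<le> indicator (Wn n) s * indicator (space S - E (J i n s)) s'"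
      proof (rule AE_mp[OF conc'], rule AE_I2, rule impI)
        fix s assume s: "s \<in> space S" and
          *: "AE s' in S. \<forall>k. y i n s + y (J i n s) k s' \<le> y i (n + k) (comb_seq (n * N) s s')"
        show "AE s' in S. (indicator W (comb_seq (n * N) s s') :: ennreal)
            \<le> indicator (Wn n) s * indicator (space S - E (J i n s)) s'"
        proof (rule AE_mp[OF *], rule AE_I2, rule impI)
          fix s' assume s': "s' \<in> space S" and
            le: "\<forall>k. y i n s + y (J i n s) k s' \<le> y i (n + k) (comb_seq (n * N) s s')"
          let ?w = "comb_seq (n * N) s s'"
          have "s \<in> Wn n \<and> s' \<notin> E (J i n s)" if w: "?w \<in> W"
          proof
            have less: "y i k ?w < u * real k" if "k \<ge> 1" for k
              using w that by (auto simp: W_def)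
            show "s \<in> Wn n"
              unfolding Wn_def
            proof (safe intro!: s)
              fix k assume k: "k \<in> {1..n}"
              have "y i k ?w = y i k (comb_seq (k * N) ?w s)"
                by (rule y_prefix[OF i, symmetric])
              also have "comb_seq (k * N) ?w s = comb_seq (k * N) s s"
              proof
                fix j
                have "j < k * N \<Longrightarrow> j < n * N"
                  using k by (meson atLeastAtMost_iff less_le_trans mult_le_mono1)
                then show "comb_seq (k * N) ?w s j = comb_seq (k * N) s s j"
                  by (auto simp: comb_seq_def)
              qed
              also have "y i k \<dots> = y i k s"
                by (rule y_prefix[OF i])
              finally show "y i k s < u * real k"
                using less[of k] k by simp
            qed
            show "s' \<notin> E (J i n s)"
            proof
              assume "s' \<in> E (J i n s)"
              then have fr: "\<exists>\<^sub>\<infinity>k. u' * real k \<le> y (J i n s) k s'"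
                by (auto simp: E_def)
              \<comment> \<open>Beyond \<open>k0\<close> further steps the surplus
                \<open>(u' - u) k\<close> of the continuation outweighs the deficit
                \<open>u n - y i n s\<close> of the prefix.\<close>
              obtain k0 :: nat where k0: "real k0 > (u * real n - y i n s) / (u' - u)"
                using reals_Archimedean2 by blast
              obtain k where k: "k > k0" "u' * real k \<le> y (J i n s) k s'"
                using fr by (auto simp: INFM_nat)
              have "u * real n - y i n s < (u' - u) * real k0"
                using k0 \<open>u < u'\<close> by (simp add: pos_divide_less_eq mult.commute)
              also have "\<dots> \<le> (u' - u) * real k"
                using k \<open>u < u'\<close> by (intro mult_left_mono) auto
              finally have "u * real (n + k) < y i n s + u' * real k"
                by (simp add: algebra_simps)
              also have "\<dots> \<le> y i (n + k) ?w"
                using le k(2) by (metis add_left_mono order_trans)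
              finally show False
                using less[of "n + k"] k by auto
            qed
          qed
          then show "(indicator W ?w :: ennreal) \<le> indicator (Wn n) s * indicator (space S - E (J i n s)) s'"
            using s' by (auto simp: indicator_def)
        qed
      qed
      have "emeasure S W = emeasure (distr (S \<Otimes>\<^sub>M S) S ?c) W"
        by (simp only: PiM_comb_seq)
      also have "\<dots> = (\<integral>\<^sup>+p. indicator W (?c p) \<partial>(S \<Otimes>\<^sub>M S))"
        by (subst nn_integral_distr[symmetric, OF c]) (auto simp: PiM_comb_seq)
      also have "\<dots> = (\<integral>\<^sup>+s. \<integral>\<^sup>+s'. indicator W (?c (s, s')) \<partial>S \<partial>S)"
        by (rule P.nn_integral_fst[symmetric]) measurable
      \<comment> \<open>For fixed \<open>s\<close> the inner integral over \<open>s'\<close> is at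
        most \<open>1 - d\<close> whichever state \<open>J i n s\<close> was reached, so
        \<open>J\<close> enters only pointwise.\<close>
      also have "\<dots> \<le> (\<integral>\<^sup>+s. indicator (Wn n) s * ennreal (1 - d) \<partial>S)"
      proof (rule nn_integral_mono_AE, rule AE_mp[OF step], rule AE_I2, rule impI)
        fix s assume *: "AE s' in S. (indicator W (comb_seq (n * N) s s') :: ennreal)
            \<le> indicator (Wn n) s * indicator (space S - E (J i n s)) s'"
        have Ji: "J i n s \<in> I"
          by (rule J_in[OF i])
        have "(\<integral>\<^sup>+s'. indicator W (?c (s, s')) \<partial>S)
            \<le> (\<integral>\<^sup>+s'. indicator (Wn n) s * indicator (space S - E (J i n s)) s' \<partial>S)"
          by (rule nn_integral_mono_AE) (use * in simp)
        also have "\<dots> = indicator (Wn n) s * emeasure S (space S - E (J i n s))"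
          using Ji by (simp add: nn_integral_cmult)
        also have "emeasure S (space S - E (J i n s)) \<le> ennreal (1 - d)"
          using P.prob_compl[OF E[OF Ji]] d_le[OF Ji] by (simp add: P.emeasure_eq_measure ennreal_leI)
        finally show "(\<integral>\<^sup>+s'. indicator W (?c (s, s')) \<partial>S) \<le> indicator (Wn n) s * ennreal (1 - d)"
          by (simp add: mult_left_mono)
      qed
      also have "\<dots> = emeasure S (Wn n) * ennreal (1 - d)"
        by (simp add: nn_integral_multc)
      finally show ?thesis
        using \<open>d \<le> 1\<close> by (simp add: P.emeasure_eq_measure ennreal_mult[symmetric] mult.commute)
    qed
    have "decseq Wn"
      by (auto simp: decseq_def Wn_def)
    then have "(\<lambda>n. measure S (Wn n)) \<longlonglongrightarrow> measure S (\<Inter>n. Wn n)"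
      by (intro P.finite_Lim_measure_decseq) auto
    also have "(\<Inter>n. Wn n) = W"
      by (fastforce simp: Wn_def W_def)
    finally have "(\<lambda>n. (1 - d) * measure S (Wn n)) \<longlonglongrightarrow> (1 - d) * measure S W"
      by (rule tendsto_mult_left)
    then have "measure S W \<le> (1 - d) * measure S W"
      by (rule LIMSEQ_le_const) (use bound in auto)
    then have "d * measure S W \<le> 0"
      by (simp add: algebra_simps)
    then have "measure S W = 0"
      using \<open>d > 0\<close> by (simp add: mult_le_0_iff order_antisym)
    then have "W \<in> null_sets S"
      by (simp add: null_sets_def P.emeasure_eq_measure)
    then have "AE s in S. s \<notin> W"
      by (rule AE_not_in)
    with AE_space show ?thesis
      by eventually_elim (auto simp: W_def not_less)
  qed
  then show ?thesis
    using finite_states by (simp add: AE_finite_all)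
qed

text \<open>The fallback when no good stretch fits: proceed by single steps, each losing at most
  \<open>h\<close>. Everything concerns one sequence and its block shifts, as the pathwise greedy
  argument requires.\<close>

lemma y_ge_sum:
  assumes h: "\<forall>k. \<forall>i\<in>I. - h (shift_seq (k * N) s) \<le> y i 1 (shift_seq (k * N) s)"
    and super: "\<forall>k. \<forall>i\<in>I. \<forall>m n. y i m (shift_seq (k * N) s)
      + y (J i m (shift_seq (k * N) s)) n (shift_seq ((k + m) * N) s) \<le> y i (m + n) (shift_seq (k * N) s)"
    and "i \<in> I"
  shows "- (\<Sum>j=k..<k + q. h (shift_seq (j * N) s)) \<le> y i q (shift_seq (k * N) s)"
  using \<open>i \<in> I\<close>
proof (induction q arbitrary: i k)
  case 0
  then show ?case by (simp add: y_0)
next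
  case (Suc q)
  let ?t = "shift_seq (k * N) s"
  have "- (\<Sum>j=k..<k + Suc q. h (shift_seq (j * N) s))
      = - h ?t - (\<Sum>j=Suc k..<Suc k + q. h (shift_seq (j * N) s))"
    by (subst sum.atLeast_Suc_lessThan) auto
  also have "\<dots> \<le> y i 1 ?t + y (J i 1 ?t) q (shift_seq (Suc k * N) s)"
    using h[rule_format, OF Suc.prems, of k] Suc.IH[OF J_in[OF Suc.prems], of "Suc k" 1 ?t] by linarith
  also have "\<dots> \<le> y i (Suc q) ?t"
    using super[rule_format, OF Suc.prems, of 1 k q] by simp
  finally show ?case .
qed

text \<open>
  The times \<open>k\<close> at which some state needs more than \<open>L\<close> steps to reach slope \<open>u\<close> are rare. A greedy
  concatenation of stretches of slope \<open>u\<close>, with single steps at the rare times, thus loses little.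
\<close>

lemma greedy_concatenation:
  fixes u :: real
  defines "g \<equiv> \<lambda>s. h s + \<bar>u\<bar>"
  assumes h: "\<forall>k. \<forall>i\<in>I. - h (shift_seq (k * N) s) \<le> y i 1 (shift_seq (k * N) s)"
    and super: "\<forall>k. \<forall>i\<in>I. \<forall>m n. y i m (shift_seq (k * N) s)
      + y (J i m (shift_seq (k * N) s)) n (shift_seq ((k + m) * N) s) \<le> y i (m + n) (shift_seq (k * N) s)"
    and good: "\<And>k i. i \<in> I \<Longrightarrow> shift_seq (k * N) s \<notin> B
      \<Longrightarrow> \<exists>n\<in>{1..L}. u * real n \<le> y i n (shift_seq (k * N) s)"
    and "i \<in> I"
  shows "u * real q - (\<Sum>j=k..<k + q. indicator B (shift_seq (j * N) s) * g (shift_seq (j * N) s)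
      + (if k + q \<le> j + L then g (shift_seq (j * N) s) else 0)) \<le> y i q (shift_seq (k * N) s)"
  using \<open>i \<in> I\<close>
proof (induction q arbitrary: i k rule: less_induct)
  case (less q)
  let ?t = "\<lambda>j. shift_seq (j * N) s"
  \<comment> \<open>The charge for position \<open>j\<close> in a window ending at \<open>e\<close>.
    A single step from a bad position loses \<open>h\<close> and forgoes slope \<open>u\<close>,
    hence \<open>g\<close>. The last \<open>L\<close> positions are charged in any case, since a
    stretch begun there may overshoot \<open>e\<close>. The charge involves only the right end of
    the window, so the induction hypothesis for the remaining window uses the same one.\<close>
  define c where "c e j = indicator B (?t j) * g (?t j) + (if e \<le> j + L then g (?t j) else 0)" for e j
  have g_nonneg: "0 \<le> g t" for t
    using h_nonneg[of t] by (simp add: g_def)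
  have c_nonneg: "0 \<le> c e j" for e j
    using g_nonneg by (simp add: c_def)
  have split: "sum (c (k + q)) {k..<k + n} + sum (c (k + q)) {k + n..<k + q} = sum (c (k + q)) {k..<k + q}"
    if "n \<le> q" for n
    using that by (intro sum.atLeastLessThan_concat) auto
  have IH: "u * real (q - n) - sum (c (k + q)) {k + n..<k + q} \<le> y (J i n (?t k)) (q - n) (?t (k + n))"
    if "1 \<le> n" "n \<le> q" for n
    using less.IH[of "q - n" "J i n (?t k)" "k + n"] J_in[OF less.prems] that by (simp add: c_def)
  have super': "y i n (?t k) + y (J i n (?t k)) (q - n) (?t (k + n)) \<le> y i q (?t k)" if "n \<le> q" for n
    using super[rule_format, OF less.prems, of n k "q - n"] that by simp
  have "u * real q - sum (c (k + q)) {k..<k + q} \<le> y i q (?t k)"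
  proof (cases "q = 0")
    case True
    then show ?thesis by (simp add: y_0)
  next
    case False
    show ?thesis
    proof (cases "?t k \<in> B")
      case True
      have "h (?t k) + \<bar>u\<bar> \<le> c (k + q) k"
        using True g_nonneg[of "?t k"] by (simp add: c_def g_def)
      moreover have "- h (?t k) \<le> y i 1 (?t k)"
        using h less.prems by blast
      ultimately show ?thesis
        using IH[of 1] super'[of 1] split[of 1] False abs_ge_self[of u]
          by (simp add: of_nat_diff left_diff_distrib right_diff_distrib)
    next
      case False': False
      obtain n where n: "1 \<le> n" "n \<le> L" "u * real n \<le> y i n (?t k)"
        using good[OF less.prems False'] by auto
      show ?thesis
      proof (cases "n \<le> q")
        case True
        have "0 \<le> sum (c (k + q)) {k..<k + n}"
          by (intro sum_nonneg c_nonneg)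
        then show ?thesis
          using IH[of n] super'[of n] split[of n] n True by (simp add: of_nat_diff algebra_simps)
      next
        \<comment> \<open>The stretch overshoots, so the window is shorter than \<open>L\<close> and
          each of its positions carries the full charge.\<close>
        case False
        have "u * real q + (\<Sum>j=k..<k + q. h (?t j)) \<le> (\<Sum>j=k..<k + q. g (?t j))"
          using mult_right_mono[OF abs_ge_self[of u], of "real q"] by (simp add: g_def sum.distrib mult.commute)
        also have "\<dots> \<le> sum (c (k + q)) {k..<k + q}"
          using False n(2) g_nonneg by (intro sum_mono) (auto simp: c_def)
        finally show ?thesis
          using y_ge_sum[OF h super less.prems, of k q] by simp
      qed
    qed
  qed
  then show ?case by (simp add: c_def)
qed

lemma borel_measurable_h: "h \<in> borel_measurable S"
  using integrable_h by blast

text \<open>The events \<open>B L\<close> shrink to a null set, so by dominated convergence the bad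
  positions cost less than \<open>e\<close> each on average once \<open>L\<close> is large. The last
  \<open>L\<close> positions cost \<open>L\<close> times the mean of \<open>g\<close>, which is the
  constant \<open>C\<close>.\<close>

lemma expectation_Min_ge_of_exists:
  assumes ex: "AE s in S. \<forall>i\<in>I. \<exists>n\<ge>1. u * real n \<le> y i n s" and "e > 0"
  shows "\<exists>C. \<forall>q. (u - e) * real q - C \<le> (\<integral>s. (MIN i\<in>I. y i q s) \<partial>S)"
proof -
  define g where "g s = h s + \<bar>u\<bar>" for s
  define B where "B L = {s \<in> space S. \<exists>i\<in>I. \<forall>n\<in>{1..L}. y i n s < u * real n}" for L
  note finite_states [measurable] borel_measurable_h [measurable]
  have B [measurable]: "B L \<in> sets S" for L
  proof -
    have "B L = (\<Union>i\<in>I. {s \<in> space S. \<forall>n\<in>{1..L}. y i n s < u * real n})"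
      by (auto simp: B_def)
    also have "\<dots> \<in> sets S"
    proof (intro sets.finite_UN finite_states)
      fix i assume "i \<in> I"
      note borel_measurable_y[OF this, measurable]
      show "{s \<in> space S. \<forall>n\<in>{1..L}. y i n s < u * real n} \<in> sets S"
        by measurable
    qed
    finally show ?thesis .
  qed
  have g_nonneg: "0 \<le> g s" for s
    using h_nonneg[of s] by (simp add: g_def)
  have int_g: "integrable S g"
    unfolding g_def using integrable_h by simp
  then have [measurable]: "g \<in> borel_measurable S"
    by blast
  have int_Bg: "integrable S (\<lambda>s. indicator (B L) s * g s)" for L
    by (rule Bochner_Integration.integrable_bound[OF int_g]) (auto simp: indicator_def)
  have "(\<lambda>L. \<integral>s. indicator (B L) s * g s \<partial>S) \<longlonglongrightarrow> (\<integral>s. 0 \<partial>S)"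
  proof (rule integral_dominated_convergence[where w = g])
    show "AE s in S. (\<lambda>L. indicator (B L) s * g s) \<longlonglongrightarrow> 0"
      using ex
    proof eventually_elim
      case (elim s)
      then obtain n where n: "\<And>i. i \<in> I \<Longrightarrow> n i \<ge> 1 \<and> u * real (n i) \<le> y i (n i) s"
        by metis
      have "s \<notin> B L" if "L \<ge> Max (n ` I)" for L
      proof
        assume "s \<in> B L"
        then obtain i where i: "i \<in> I" "\<forall>n\<in>{1..L}. y i n s < u * real n"
          by (auto simp: B_def)
        have "n i \<le> L"
          using i(1) finite_states that by (meson Max_ge finite_imageI imageI order_trans)
        then show False
          using n[OF i(1)] i(2) by (metis atLeastAtMost_iff not_less)
      qed
      then have "indicator (B L) s * g s = 0" if "L \<ge> Max (n ` I)" for L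
        using that by simp
      then show ?case
        by (intro tendsto_eventually) (auto simp only: eventually_sequentially)
    qed
  qed (use int_g in \<open>auto simp: indicator_def g_nonneg\<close>)
  then have "\<forall>\<^sub>F L in sequentially. (\<integral>s. indicator (B L) s * g s \<partial>S) < e"
    using \<open>e > 0\<close> by (intro order_tendstoD(2)[where y = 0]) auto
  then obtain L where L: "(\<integral>s. indicator (B L) s * g s \<partial>S) < e"
    by (meson eventually_sequentially order_refl)
  let ?G = "\<integral>s. g s \<partial>S"
  have G_nonneg: "0 \<le> ?G"
    by (rule Bochner_Integration.integral_nonneg) (rule g_nonneg)
  have "(u - e) * real q - real L * ?G \<le> (\<integral>s. (MIN i\<in>I. y i q s) \<partial>S)" for q
  proof -
    let ?c = "\<lambda>j s. indicator (B L) (shift_seq (j * N) s) * g (shift_seq (j * N) s)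
      + (if q \<le> j + L then g (shift_seq (j * N) s) else 0)"
    have int_c1: "integrable S (\<lambda>s. indicator (B L) (shift_seq (j * N) s) * g (shift_seq (j * N) s))" for j
      by (rule integrable_shift_seq[OF int_Bg])
    have int_c2: "integrable S (\<lambda>s. if q \<le> j + L then g (shift_seq (j * N) s) else 0)" for j
      using integrable_shift_seq[OF int_g, of "j * N"] by (cases "q \<le> j + L") simp_all
    have int_c: "integrable S (?c j)" for j
      by (rule Bochner_Integration.integrable_add[OF int_c1 int_c2])
    have E_c: "(\<integral>s. ?c j s \<partial>S) \<le> e + (if q \<le> j + L then ?G else 0)" for j
    proof -
      have "(\<integral>s. ?c j s \<partial>S) = (\<integral>s. indicator (B L) s * g s \<partial>S) + (if q \<le> j + L then ?G else 0)"
        unfolding Bochner_Integration.integral_add[OF int_c1 int_c2]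
        using integral_shift_seq[of "\<lambda>s. indicator (B L) s * g s" "j * N"] integral_shift_seq[of g "j * N"]
        by (cases "q \<le> j + L") simp_all
      with L show ?thesis by simp
    qed
    have "(\<Sum>j<q. if q \<le> j + L then ?G else 0) = real (card {j\<in>{..<q}. q \<le> j + L}) * ?G"
      by (simp add: sum.If_cases Int_def)
    also have "\<dots> \<le> real L * ?G"
    proof -
      have "card {j\<in>{..<q}. q \<le> j + L} \<le> card {q - L..<q}"
        by (rule card_mono) auto
      then show ?thesis
        by (intro mult_right_mono G_nonneg) auto
    qed
    finally have "(\<Sum>j<q. e + (if q \<le> j + L then ?G else 0)) \<le> e * real q + real L * ?G"
      by (simp add: sum.distrib mult.commute)
    with sum_mono[of "{..<q}" "\<lambda>j. \<integral>s. ?c j s \<partial>S", OF E_c]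
    have "(u - e) * real q - real L * ?G \<le> u * real q - (\<Sum>j<q. \<integral>s. ?c j s \<partial>S)"
      by (simp add: algebra_simps)
    also have "\<dots> = (\<integral>s. u * real q - (\<Sum>j<q. ?c j s) \<partial>S)"
      using int_c P.prob_space
      by (subst Bochner_Integration.integral_diff, (intro Bochner_Integration.integrable_sum int_c | simp)+)
    also have "\<dots> \<le> (\<integral>s. (MIN i\<in>I. y i q s) \<partial>S)"
    proof (rule integral_mono_AE)
      show "integrable S (\<lambda>s. u * real q - (\<Sum>j<q. ?c j s))"
        using int_c by (intro Bochner_Integration.integrable_diff Bochner_Integration.integrable_sum) auto
      show "integrable S (\<lambda>s. MIN i\<in>I. y i q s)"
        using finite_states states_nonempty integrable_y by (intro integrable_MIN) auto
      show "AE s in S. u * real q - (\<Sum>j<q. ?c j s) \<le> (MIN i\<in>I. y i q s)"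
        using AE_shift_seq[OF y_1_ge] AE_shift_seq[OF superadditive] AE_space
      proof eventually_elim
        case (elim s)
        have "u * real q - (\<Sum>j<q. ?c j s) \<le> y i q s" if "i \<in> I" for i
        proof -
          have *: "\<exists>n\<in>{1..L}. u * real n \<le> y i n (shift_seq (k * N) s)"
            if "i \<in> I" "shift_seq (k * N) s \<notin> B L" for i k
          proof -
            have "shift_seq (k * N) s \<in> space S"
              using elim(3) by (rule measurable_space[OF measurable_shift_seq])
            then show ?thesis
              using that by (auto simp: B_def not_less)
          qed
          have h: "\<forall>k. \<forall>i\<in>I. - h (shift_seq (k * N) s) \<le> y i 1 (shift_seq (k * N) s)"
            using elim(1) by blast
          have super: "\<forall>k. \<forall>i\<in>I. \<forall>m n. y i m (shift_seq (k * N) s)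
            + y (J i m (shift_seq (k * N) s)) n (shift_seq ((k + m) * N) s) \<le> y i (m + n) (shift_seq (k * N) s)"
            using elim(2) by (simp add: algebra_simps)
          have "u * real q - (\<Sum>j=0..<0 + q. indicator (B L) (shift_seq (j * N) s) * (h (shift_seq (j * N) s) + \<bar>u\<bar>)
              + (if 0 + q \<le> j + L then h (shift_seq (j * N) s) + \<bar>u\<bar> else 0)) \<le> y i q (shift_seq (0 * N) s)"
            by (rule greedy_concatenation[OF h super]) (use * that in auto)
          then show ?thesis
            unfolding g_def lessThan_atLeast0 by simp
        qed
        then show ?case
          using finite_states states_nonempty by simp
      qed
    qed
    finally show ?thesis .
  qed
  then show ?thesis by blast
qed

theorem expectation_Min_ge:
  assumes "u < u'"
    and "\<And>i. i \<in> I \<Longrightarrow> 0 < measure S {s \<in> space S. \<exists>\<^sub>\<infinity>n. u' * real n \<le> y i n s}"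
  shows "\<exists>C. \<forall>q. u * real q - C \<le> (\<integral>s. (MIN i\<in>I. y i q s) \<partial>S)"
proof -
  \<comment> \<open>Half of the gap is spent on passing from infinitely often to some
    \<open>n\<close>, the other half on the rare positions.\<close>
  have "AE s in S. \<forall>i\<in>I. \<exists>n\<ge>1. (u + u') / 2 * real n \<le> y i n s"
    using assms by (intro AE_exists_ge[where u' = u']) auto
  from expectation_Min_ge_of_exists[OF this, of "(u' - u) / 2"] assms(1) show ?thesis
    by (simp add: field_simps)
qed

end

section \<open>The strong law for blocks and Kingman's lower bound\<close>

text \<open>The constant absorbs the finitely many exceptional \<open>q\<close>; window estimates
  use the bound at every time.\<close>

lemma uniform_bound_of_eventually:
  fixes a :: "nat \<Rightarrow> real"
  assumes "\<forall>\<^sub>F q in sequentially. \<bar>a q\<bar> \<le> e * real q" and "0 \<le> e"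
  shows "\<exists>C. \<forall>q. \<bar>a q\<bar> \<le> e * real q + C"
proof -
  obtain q0 where q0: "\<And>q. q \<ge> q0 \<Longrightarrow> \<bar>a q\<bar> \<le> e * real q"
    using assms(1) by (auto simp: eventually_sequentially)
  have "\<bar>a q\<bar> \<le> e * real q + (\<Sum>k<q0. \<bar>a k\<bar>)" for q
  proof (cases "q < q0")
    case True
    then have "\<bar>a q\<bar> \<le> (\<Sum>k<q0. \<bar>a k\<bar>)"
      by (intro member_le_sum) auto
    then show ?thesis
      using assms(2) by (simp add: add_increasing)
  next
    case False
    have "0 \<le> (\<Sum>k<q0. \<bar>a k\<bar>)"
      by (rule sum_nonneg) simp
    with q0[of q] False show ?thesis
      by linarith
  qed
  then show ?thesis by blast
qed

lemma sum_lessThan_add: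
  fixes a :: "nat \<Rightarrow> 'a::comm_monoid_add"
  shows "(\<Sum>k<m + n. a k) = (\<Sum>k<m. a k) + (\<Sum>k<n. a (m + k))"
  by (induction n) (simp_all add: add.assoc)

lemma linear_le_const_imp_le:
  fixes a C :: real
  assumes "\<And>q::nat. a * real q \<le> C"
  shows "a \<le> 0"
proof (rule ccontr)
  assume "\<not> a \<le> 0"
  moreover obtain q :: nat where "C / a < real q"
    using reals_Archimedean2 by blast
  ultimately show False
    using assms[of q] by (simp add: pos_divide_less_eq mult.commute)
qed

section \<open>Strong law for blocks, recurrence, and the lower half of Kingman's theorem\<close>

context sequence_space
begin

lemma AE_eventually_not:
  fixes Q :: "nat \<Rightarrow> (nat \<Rightarrow> 'a) \<Rightarrow> bool"
  assumes [measurable]: "\<And>n. {s \<in> space S. Q n s} \<in> sets S"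
    and "\<not> 0 < measure S {s \<in> space S. \<exists>\<^sub>\<infinity>n. Q n s}"
  shows "AE s in S. \<forall>\<^sub>F n in sequentially. \<not> Q n s"
proof -
  have "measure S {s \<in> space S. \<exists>\<^sub>\<infinity>n. Q n s} = 0"
    using assms(2) by (simp add: order_antisym not_less)
  moreover have "{s \<in> space S. \<exists>\<^sub>\<infinity>n. Q n s} \<in> sets S"
    unfolding INFM_nat by measurable
  ultimately have "{s \<in> space S. \<exists>\<^sub>\<infinity>n. Q n s} \<in> null_sets S"
    by (simp add: null_sets_def P.emeasure_eq_measure)
  from AE_not_in[OF this] AE_space show ?thesis
    by eventually_elim (auto simp: frequently_def cofinite_eq_sequentially)
qed

text \<open>One state, and superadditivity holds with equality. If slope \<open>c\<close> were
  reached infinitely often with positive probability, the expected sum would be at least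
  \<open>u q - C\<close> for some \<open>u\<close> above the mean of \<open>h\<close>; but it equals
  \<open>q\<close> times that mean.\<close>

lemma block_sums_eventually_less:
  assumes int: "integrable S h" and prefix: "\<And>s s'. h (comb_seq N s s') = h s"
    and less: "(\<integral>s. h s \<partial>S) < c"
  shows "AE s in S. \<forall>\<^sub>F q in sequentially. (\<Sum>k<q. h (shift_seq (k * N) s)) < c * real q"
proof -
  let ?y = "\<lambda>_ q s. \<Sum>k<q. h (shift_seq (k * N) s)"
  have int_y: "integrable S (?y () q)" for q
    by (intro Bochner_Integration.integrable_sum integrable_shift_seq int)
  then have [measurable]: "?y () q \<in> borel_measurable S" for q
    by blast
  have prefix': "h (shift_seq (k * N) (comb_seq (m * N) s s')) = h (shift_seq (k * N) s)"
    if "k < m" for k m s s'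
  proof -
    have "comb_seq N (shift_seq (k * N) (comb_seq (m * N) s s')) s = comb_seq N (shift_seq (k * N) s) s"
    proof
      fix j
      have "k * N + j < m * N" if "j < N"
      proof -
        have "k * N + j < Suc k * N"
          using that by simp
        also have "\<dots> \<le> m * N"
          using \<open>k < m\<close> by (intro mult_le_mono1) simp
        finally show ?thesis .
      qed
      then show "comb_seq N (shift_seq (k * N) (comb_seq (m * N) s s')) s j = comb_seq N (shift_seq (k * N) s) s j"
        by (auto simp: comb_seq_def shift_seq_def)
    qed
    then show ?thesis
      by (metis prefix)
  qed
  interpret superadditive_states M N "{()}" ?y "\<lambda>_ _ _. ()" "\<lambda>s. \<bar>h s\<bar>"
  proof unfold_locales
    show "AE s in S. \<forall>i\<in>{()}. \<forall>m n. ?y i m s + ?y () n (shift_seq (m * N) s) \<le> ?y i (m + n) s"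
      by (simp only: sum_lessThan_add add_mult_distrib shift_seq_shift_seq) simp
    show "AE s in S. \<forall>i\<in>{()}. - \<bar>h s\<bar> \<le> ?y i 1 s"
      by (simp add: abs_ge_minus_self)
  qed (use int int_y prefix' in auto)
  have "\<not> 0 < measure S {s \<in> space S. \<exists>\<^sub>\<infinity>q. c * real q \<le> ?y () q s}"
  proof
    assume pos: "0 < measure S {s \<in> space S. \<exists>\<^sub>\<infinity>q. c * real q \<le> ?y () q s}"
    define u where "u = (c + (\<integral>s. h s \<partial>S)) / 2"
    have "u < c"
      using less by (simp add: u_def)
    from expectation_Min_ge[OF this] pos obtain C
      where C: "\<And>q. u * real q - C \<le> (\<integral>s. ?y () q s \<partial>S)"
      by auto
    have "(\<integral>s. ?y () q s \<partial>S) = real q * (\<integral>s. h s \<partial>S)" for q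
      using int by (simp add: Bochner_Integration.integral_sum integrable_shift_seq integral_shift_seq
          borel_measurable_integrable)
    with C have "(u - (\<integral>s. h s \<partial>S)) * real q \<le> C" for q
      by (simp add: algebra_simps)
    then have "u - (\<integral>s. h s \<partial>S) \<le> 0"
      by (rule linear_le_const_imp_le)
    with less show False
      by (simp add: u_def)
  qed
  then have "AE s in S. \<forall>\<^sub>F q in sequentially. \<not> (c * real q \<le> ?y () q s)"
    by (intro AE_eventually_not) auto
  then show ?thesis by (simp add: not_le)
qed

text \<open>The one-sided estimate for \<open>h\<close> and for \<open>- h\<close>. The form with an
  additive constant valid for all \<open>q\<close> lets it be applied at both ends of an arbitrary
  window.\<close>

theorem block_strong_law:
  assumes int: "integrable S h" and prefix: "\<And>s s'. h (comb_seq N s s') = h s"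
  shows "AE s in S. \<forall>e>0. \<exists>C. \<forall>q. \<bar>(\<Sum>k<q. h (shift_seq (k * N) s)) - (\<integral>s. h s \<partial>S) * real q\<bar> \<le> e * real q + C"
proof -
  let ?E = "\<integral>s. h s \<partial>S"
  let ?y = "\<lambda>q s. \<Sum>k<q. h (shift_seq (k * N) s)"
  have "AE s in S. \<forall>m. (\<forall>\<^sub>F q in sequentially. ?y q s < (?E + 1 / real (Suc m)) * real q)
      \<and> (\<forall>\<^sub>F q in sequentially. - ?y q s < (- ?E + 1 / real (Suc m)) * real q)"
    unfolding AE_all_countable
  proof
    fix m
    have "integrable S (\<lambda>s. - h s)"
      using int by simp
    from block_sums_eventually_less[OF this, of N "- ?E + 1 / real (Suc m)"]
      block_sums_eventually_less[OF int prefix, of "?E + 1 / real (Suc m)"]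
    show "AE s in S. (\<forall>\<^sub>F q in sequentially. ?y q s < (?E + 1 / real (Suc m)) * real q)
      \<and> (\<forall>\<^sub>F q in sequentially. - ?y q s < (- ?E + 1 / real (Suc m)) * real q)"
      by (simp add: prefix sum_negf)
  qed
  then show ?thesis
  proof eventually_elim
    case (elim s)
    show ?case
    proof (intro allI impI)
      fix e :: real assume "e > 0"
      then obtain m where "1 / real (Suc m) < e"
        by (metis nat_approx_posE)
      have "\<forall>\<^sub>F q in sequentially. \<bar>?y q s - ?E * real q\<bar> \<le> e * real q"
        using elim[rule_format, of m, THEN conjunct1] elim[rule_format, of m, THEN conjunct2]
      proof eventually_elim
        case (elim q)
        have "1 / real (Suc m) * real q \<le> e * real q"
          using \<open>1 / real (Suc m) < e\<close> by (intro mult_right_mono) auto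
        with elim show ?case
          by (simp only: ring_distribs abs_le_iff minus_mult_left) linarith
      qed
      then show "\<exists>C. \<forall>q. \<bar>?y q s - ?E * real q\<bar> \<le> e * real q + C"
        using \<open>e > 0\<close> by (intro uniform_bound_of_eventually) auto
    qed
  qed
qed

text \<open>The strong law for an indicator stands in for the second Borel-Cantelli lemma: finitely
  many visits would give bounded sums, against a positive mean.\<close>

lemma AE_frequently:
  assumes [measurable]: "{t \<in> space M. R t} \<in> sets M" and "0 < measure M {t \<in> space M. R t}"
  shows "AE s in S. \<exists>\<^sub>\<infinity>k. R (s k)"
proof -
  define h where "h s = indicat_real {t \<in> space M. R t} (s 0)" for s :: "nat \<Rightarrow> 'a"
  have [measurable]: "h \<in> borel_measurable S"
    unfolding h_def by measurable
  have int: "integrable S h"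
    by (rule P.integrable_const_bound[of _ 1]) (auto simp: h_def indicator_def)
  have "distr S M (\<lambda>s. s 0) = M"
    by (rule PiM_component) auto
  then have "(\<integral>s. h s \<partial>S) = (\<integral>t. indicat_real {t \<in> space M. R t} t \<partial>M)"
    using integral_distr[of "\<lambda>s. s 0" S M "indicat_real {t \<in> space M. R t}"] by (simp add: h_def)
  also have "\<dots> = measure M {t \<in> space M. R t}"
    by (auto intro!: arg_cong[where f = "measure M"])
  finally have Eh: "(\<integral>s. h s \<partial>S) > 0"
    using assms(2) by simp
  have "AE s in S. \<forall>e>0. \<exists>C. \<forall>q. \<bar>(\<Sum>k<q. h (shift_seq (k * 1) s)) - (\<integral>s. h s \<partial>S) * real q\<bar> \<le> e * real q + C"
    by (rule block_strong_law[OF int]) (simp add: h_def comb_seq_def)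
  then show ?thesis
  proof eventually_elim
    case (elim s)
    obtain C where C: "\<And>q. \<bar>(\<Sum>k<q. h (shift_seq (k * 1) s)) - (\<integral>s. h s \<partial>S) * real q\<bar> \<le> (\<integral>s. h s \<partial>S) / 2 * real q + C"
      using elim Eh half_gt_zero by blast
    show ?case
    proof (rule ccontr)
      assume "\<not> (\<exists>\<^sub>\<infinity>k. R (s k))"
      then obtain k0 where k0: "\<And>k. k > k0 \<Longrightarrow> \<not> R (s k)"
        by (auto simp: INFM_nat)
      have "(\<Sum>k<q. h (shift_seq k s)) \<le> real (Suc k0)" for q
      proof -
        have "(\<Sum>k<q. h (shift_seq k s)) \<le> (\<Sum>k<q. if k < Suc k0 then 1 else 0)"
          using k0 by (intro sum_mono) (auto simp: h_def shift_seq_def indicator_def)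
        also have "\<dots> = real (card {k\<in>{..<q}. k < Suc k0})"
          by (simp add: sum.If_cases Int_def)
        also have "\<dots> \<le> real (card {..<Suc k0})"
          by (intro of_nat_mono card_mono) auto
        finally show ?thesis by simp
      qed
      then have le: "(\<Sum>k<q. h (shift_seq (k * 1) s)) \<le> real (Suc k0)" for q
        by (simp only: mult_1_right)
      have "(\<integral>s. h s \<partial>S) / 2 * real q \<le> real (Suc k0) + C" for q
        using C[of q] le[of q] by (simp add: abs_le_iff)
      from linear_le_const_imp_le[OF this] Eh show False
        by simp
    qed
  qed
qed

text \<open>\<open>- f\<close> is superadditive with a single state. If \<open>f\<close> fell to
  slope \<open>u\<close> infinitely often with positive probability, its expectation would be at
  most \<open>w n + C\<close> for some \<open>w\<close> below \<open>c\<close>, against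
  \<open>expect\<close>.\<close>

theorem subadditive_eventually_greater:
  fixes f :: "nat \<Rightarrow> (nat \<Rightarrow> 'a) \<Rightarrow> real"
  assumes int: "\<And>n. integrable S (f n)" and f_0: "\<And>s. f 0 s = 0"
    and prefix: "\<And>n s s'. f n (comb_seq n s s') = f n s"
    and subadd: "AE s in S. \<forall>m n. f (m + n) s \<le> f m s + f n (shift_seq m s)"
    and f_1: "AE s in S. f 1 s \<le> h s" and int_h: "integrable S h" and h: "\<And>s. 0 \<le> h s"
    and expect: "\<And>n. c * real n \<le> (\<integral>s. f n s \<partial>S)" and "u < c"
  shows "AE s in S. \<forall>\<^sub>F n in sequentially. u * real n < f n s"
proof -
  have [measurable]: "f n \<in> borel_measurable S" for n
    using int by blast
  interpret superadditive_states M 1 "{()}" "\<lambda>_ n s. - f n s" "\<lambda>_ _ _. ()" h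
  proof unfold_locales
    show "AE s in S. \<forall>i\<in>{()}. - h s \<le> - f 1 s"
      using f_1 by eventually_elim simp
    show "AE s in S. \<forall>i\<in>{()}. \<forall>m n. - f m s + - f n (shift_seq (m * 1) s) \<le> - f (m + n) s"
      using subadd
    proof eventually_elim
      case (elim s)
      show ?case
        using elim[rule_format] by (simp add: le_diff_eq algebra_simps)
    qed
  qed (simp_all add: int f_0 prefix int_h h)
  have "\<not> 0 < measure S {s \<in> space S. \<exists>\<^sub>\<infinity>n. - u * real n \<le> - f n s}"
  proof
    assume pos: "0 < measure S {s \<in> space S. \<exists>\<^sub>\<infinity>n. - u * real n \<le> - f n s}"
    define w where "w = (u + c) / 2"
    have "- w < - u"
      using \<open>u < c\<close> by (simp add: w_def)
    from expectation_Min_ge[OF this] pos obtain C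
      where C: "\<And>n. - w * real n - C \<le> (\<integral>s. - f n s \<partial>S)"
      by auto
    have "(c - w) * real n \<le> C" for n
      using C[of n] expect[of n] by (simp add: algebra_simps)
    then have "c - w \<le> 0"
      by (rule linear_le_const_imp_le)
    with \<open>u < c\<close> show False
      by (simp add: w_def)
  qed
  then have "AE s in S. \<forall>\<^sub>F n in sequentially. \<not> (- u * real n \<le> - f n s)"
    by (intro AE_eventually_not) auto
  then show ?thesis by (simp add: not_le)
qed

end

section \<open>Max-plus products applied to the zero vector\<close>

lemma SUP_finite_attained:
  fixes f :: "'i \<Rightarrow> 'b::complete_linorder"
  assumes "finite I" "I \<noteq> {}"
  obtains i where "i \<in> I" "(SUP j\<in>I. f j) = f i"
proof -
  have "(SUP j\<in>I. f j) \<in> f ` I"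
    using assms Max_in[of "f ` I"] by (simp add: Max_Sup)
  then show ?thesis
    using that by auto
qed

lemma add_SUP_finite:
  fixes f :: "'i \<Rightarrow> ereal"
  assumes "finite I" "I \<noteq> {}"
  shows "c + (SUP j\<in>I. f j) = (SUP j\<in>I. c + f j)"
proof (rule antisym)
  obtain i where "i \<in> I" "(SUP j\<in>I. f j) = f i"
    using SUP_finite_attained[OF assms] .
  then show "c + (SUP j\<in>I. f j) \<le> (SUP j\<in>I. c + f j)"
    by (auto intro: SUP_upper)
qed (intro SUP_least add_left_mono SUP_upper)

text \<open>\<open>real_of_ereal\<close> is 0 at \<open>-\<infinity>\<close>, so only finite entries
  count. The sum is within a constant factor of their largest modulus.\<close>

definition entry_bound :: "'n::finite mp_mat \<Rightarrow> real" where
  "entry_bound a = (\<Sum>i\<in>UNIV. \<Sum>j\<in>UNIV. \<bar>real_of_ereal (a i j)\<bar>)"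

lemma entry_bound_nonneg: "0 \<le> entry_bound a"
  unfolding entry_bound_def by (intro sum_nonneg abs_ge_zero)

lemma abs_entry_le: "\<bar>real_of_ereal (a i j)\<bar> \<le> entry_bound a"
proof -
  have "\<bar>real_of_ereal (a i j)\<bar> \<le> (\<Sum>j\<in>UNIV. \<bar>real_of_ereal (a i j)\<bar>)"
    by (rule member_le_sum) (simp_all only: abs_ge_zero finite UNIV_I)
  also have "\<dots> \<le> entry_bound a"
    unfolding entry_bound_def by (rule member_le_sum[of i]) (simp_all only: sum_nonneg abs_ge_zero finite UNIV_I)
  finally show ?thesis .
qed

lemma entry_le: "a i j \<noteq> \<infinity> \<Longrightarrow> a i j \<le> ereal (entry_bound a)"
  using abs_entry_le[of a i j] by (cases "a i j") auto

lemma entry_ge: "a i j \<noteq> \<infinity> \<Longrightarrow> a i j \<noteq> -\<infinity> \<Longrightarrow> - ereal (entry_bound a) \<le> a i j"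
  using abs_entry_le[of a i j] by (cases "a i j") auto

text \<open>
  \<open>xvec I n s\<close> and \<open>yvec I n s\<close> are \<open>s(n-1) \<cdots> s(0) 0\<close> and \<open>s(0) \<cdots> s(n-1) 0\<close>, with all
  matrices restricted to \<open>I \<times> I\<close>.
\<close>

primrec xvec :: "'n::finite set \<Rightarrow> nat \<Rightarrow> (nat \<Rightarrow> 'n mp_mat) \<Rightarrow> 'n mp_vec" where
  "xvec I 0 = (\<lambda>s i. 0)"
| "xvec I (Suc n) = (\<lambda>s. mp_mult_vec I (s n) (xvec I n s))"

primrec yvec :: "'n::finite set \<Rightarrow> nat \<Rightarrow> (nat \<Rightarrow> 'n mp_mat) \<Rightarrow> 'n mp_vec" where
  "yvec I 0 = (\<lambda>s i. 0)"
| "yvec I (Suc n) = (\<lambda>s. mp_mult_vec I (s 0) (yvec I n (shift_seq 1 s)))"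

definition xmax :: "'n::finite set \<Rightarrow> nat \<Rightarrow> (nat \<Rightarrow> 'n mp_mat) \<Rightarrow> ereal" where
  "xmax I n s = (SUP i\<in>I. xvec I n s i)"

text \<open>The coordinates from \<open>n\<close> on stay in place, which makes this an injective
  reindexing of the whole sequence and hence measure preserving.\<close>

definition reverse_prefix :: "nat \<Rightarrow> (nat \<Rightarrow> 'a) \<Rightarrow> nat \<Rightarrow> 'a" where
  "reverse_prefix n s = (\<lambda>k. s (if k < n then n - 1 - k else k))"

text \<open>The end node of a path of length \<open>m\<close> from \<open>i\<close> that realises \<open>yvec I m s i\<close>.\<close>

primrec yarg :: "'n::finite set \<Rightarrow> nat \<Rightarrow> (nat \<Rightarrow> 'n mp_mat) \<Rightarrow> 'n \<Rightarrow> 'n" where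
  "yarg I 0 = (\<lambda>s i. i)"
| "yarg I (Suc m) = (\<lambda>s i. yarg I m (shift_seq 1 s)
     (SOME j. j \<in> I \<and> s 0 i j + yvec I m (shift_seq 1 s) j = yvec I (Suc m) s i))"

lemma xvec_cong: "(\<And>k. k < n \<Longrightarrow> s k = s' k) \<Longrightarrow> xvec I n s = xvec I n s'"
  by (induction n) simp_all

lemma yvec_cong: "(\<And>k. k < n \<Longrightarrow> s k = s' k) \<Longrightarrow> yvec I n s = yvec I n s'"
proof (induction n arbitrary: s s')
  case (Suc n)
  have "yvec I n (shift_seq 1 s) = yvec I n (shift_seq 1 s')"
    by (rule Suc.IH) (simp add: shift_seq_def Suc.prems)
  then show ?case
    by (simp add: Suc.prems)
qed simp

lemma yarg_cong: "(\<And>k. k < n \<Longrightarrow> s k = s' k) \<Longrightarrow> yarg I n s = yarg I n s'"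
proof (induction n arbitrary: s s')
  case (Suc n)
  have "yarg I n (shift_seq 1 s) = yarg I n (shift_seq 1 s')"
    by (rule Suc.IH) (simp add: shift_seq_def Suc.prems)
  moreover have "yvec I n (shift_seq 1 s) = yvec I n (shift_seq 1 s')"
    by (rule yvec_cong) (simp add: shift_seq_def Suc.prems)
  ultimately show ?case
    by (simp add: Suc.prems)
qed simp

lemma yarg_step:
  assumes "I \<noteq> {}"
  shows "\<exists>j\<in>I. yarg I (Suc m) s i = yarg I m (shift_seq 1 s) j
    \<and> yvec I (Suc m) s i = s 0 i j + yvec I m (shift_seq 1 s) j"
proof -
  obtain j where "j \<in> I" "(SUP j\<in>I. s 0 i j + yvec I m (shift_seq 1 s) j) = s 0 i j + yvec I m (shift_seq 1 s) j"
    using SUP_finite_attained[OF finite assms] .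
  then have ex: "\<exists>j. j \<in> I \<and> s 0 i j + yvec I m (shift_seq 1 s) j = yvec I (Suc m) s i"
    by (auto simp: mp_mult_vec_def)
  define j' where "j' = (SOME j. j \<in> I \<and> s 0 i j + yvec I m (shift_seq 1 s) j = yvec I (Suc m) s i)"
  have "j' \<in> I" "s 0 i j' + yvec I m (shift_seq 1 s) j' = yvec I (Suc m) s i"
    using someI_ex[OF ex] unfolding j'_def by blast+
  moreover have "yarg I (Suc m) s i = yarg I m (shift_seq 1 s) j'"
    unfolding j'_def by (rule yarg.simps(2)[THEN fun_cong, THEN fun_cong])
  ultimately show ?thesis
    by (intro bexI[of _ j']) (simp_all only:)
qed

lemma yarg_in: "i \<in> I \<Longrightarrow> yarg I m s i \<in> I"
proof (induction m arbitrary: s i)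
  case (Suc m)
  then obtain j where "j \<in> I" "yarg I (Suc m) s i = yarg I m (shift_seq 1 s) j"
    using yarg_step[of I m s i] by blast
  then show ?case
    using Suc.IH by (simp only:)
qed simp

lemma mp_mult_vec_upper: "j \<in> I \<Longrightarrow> a i j + x j \<le> mp_mult_vec I a x i"
  unfolding mp_mult_vec_def by (rule SUP_upper)

text \<open>Continue the chosen optimal path of length \<open>m\<close> optimally from its end node.
  Only an inequality, since the best path of length \<open>m + n\<close> may stand elsewhere at time
  \<open>m\<close>.\<close>

lemma yvec_add_ge: "i \<in> I \<Longrightarrow> yvec I m s i + yvec I n (shift_seq m s) (yarg I m s i) \<le> yvec I (m + n) s i"
proof (induction m arbitrary: s i)
  case (Suc m)
  obtain j where j: "j \<in> I" "yarg I (Suc m) s i = yarg I m (shift_seq 1 s) j"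
    "yvec I (Suc m) s i = s 0 i j + yvec I m (shift_seq 1 s) j"
    using yarg_step[of I m s i] Suc.prems by blast
  have "yvec I (Suc m) s i + yvec I n (shift_seq (Suc m) s) (yarg I (Suc m) s i)
      = s 0 i j + (yvec I m (shift_seq 1 s) j + yvec I n (shift_seq m (shift_seq 1 s)) (yarg I m (shift_seq 1 s) j))"
    unfolding j(2,3) by (simp add: add.assoc)
  also have "\<dots> \<le> s 0 i j + yvec I (m + n) (shift_seq 1 s) j"
    by (intro add_left_mono Suc.IH j(1))
  also have "\<dots> \<le> yvec I (Suc m + n) s i"
    using mp_mult_vec_upper[OF j(1)] by simp
  finally show ?case .
qed simp

lemma yvec_eq_xvec: "yvec I n s = xvec I n (reverse_prefix n s)"
proof (induction n arbitrary: s)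
  case (Suc n)
  have "xvec I n (reverse_prefix n (shift_seq 1 s)) = xvec I n (reverse_prefix (Suc n) s)"
    by (rule xvec_cong) (simp add: reverse_prefix_def shift_seq_def Suc_diff_Suc)
  then show ?case
    using Suc by (simp add: reverse_prefix_def)
qed simp

lemma xvec_mono: "I \<subseteq> I' \<Longrightarrow> xvec I n s i \<le> xvec I' n s i"
proof (induction n arbitrary: i)
  case (Suc n)
  then show ?case
    unfolding xvec.simps mp_mult_vec_def by (intro SUP_mono) (meson add_left_mono subsetD)
qed simp

lemma xvec_le_xmax: "i \<in> I \<Longrightarrow> xvec I n s i \<le> xmax I n s"
  unfolding xmax_def by (rule SUP_upper)

text \<open>Max-plus maps are monotone and commute with adding a constant to all coordinates; the
  vector at time \<open>m\<close> is replaced by its maximum.\<close>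

lemma xvec_add_le: "i \<in> I \<Longrightarrow> xvec I (m + n) s i \<le> xvec I n (shift_seq m s) i + xmax I m s"
proof (induction n arbitrary: i)
  case 0
  then show ?case by (simp add: xvec_le_xmax)
next
  case (Suc n)
  have "s (m + n) i j + xvec I (m + n) s j \<le> xvec I (Suc n) (shift_seq m s) i + xmax I m s" if "j \<in> I" for j
  proof -
    have "s (m + n) i j + xvec I (m + n) s j \<le> s (m + n) i j + (xvec I n (shift_seq m s) j + xmax I m s)"
      by (intro add_left_mono Suc.IH that)
    also have "\<dots> = (shift_seq m s n i j + xvec I n (shift_seq m s) j) + xmax I m s"
      by (simp add: shift_seq_def add.assoc)
    also have "\<dots> \<le> xvec I (Suc n) (shift_seq m s) i + xmax I m s"
      unfolding xvec.simps by (intro add_right_mono mp_mult_vec_upper that)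
    finally show ?thesis .
  qed
  then show ?case
    by (simp add: mp_mult_vec_def SUP_le_iff)
qed

lemma xmax_add_le: "xmax I (m + n) s \<le> xmax I n (shift_seq m s) + xmax I m s"
  unfolding xmax_def[of I "m + n"]
  by (rule SUP_least) (meson add_right_mono order_trans xvec_add_le xvec_le_xmax)

text \<open>Mirror image of the upper estimate, with the minimum at time \<open>m\<close>. This is
  where the minimum over \<open>I\<close> enters the lower bound.\<close>

lemma xvec_add_ge:
  "i \<in> I \<Longrightarrow> xvec I n (shift_seq m s) i + (INF j\<in>I. xvec I m s j) \<le> xvec I (m + n) s i"
proof (induction n arbitrary: i)
  case 0
  then show ?case by (simp add: INF_lower)
next
  case (Suc n)
  let ?c = "INF j\<in>I. xvec I m s j"
  obtain j where j: "j \<in> I" "xvec I (Suc n) (shift_seq m s) i = s (m + n) i j + xvec I n (shift_seq m s) j"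
    using SUP_finite_attained[OF finite, of I "\<lambda>j. s (m + n) i j + xvec I n (shift_seq m s) j"] Suc.prems
    by (auto simp: mp_mult_vec_def shift_seq_def)
  have "xvec I (Suc n) (shift_seq m s) i + ?c = s (m + n) i j + (xvec I n (shift_seq m s) j + ?c)"
    by (simp only: j(2) add.assoc)
  also have "\<dots> \<le> s (m + n) i j + xvec I (m + n) s j"
    by (intro add_left_mono Suc.IH j(1))
  also have "\<dots> \<le> xvec I (m + Suc n) s i"
    using mp_mult_vec_upper[OF j(1)] by simp
  finally show ?case .
qed

lemma xmax_0: "I \<noteq> {} \<Longrightarrow> xmax I 0 s = 0"
  by (simp add: xmax_def)

lemma xvec_le:
  assumes "\<forall>k i j. s k i j \<noteq> \<infinity>"
  shows "xvec I n s i \<le> ereal (\<Sum>k<n. entry_bound (s k))"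
proof (induction n arbitrary: i)
  case (Suc n)
  have "s n i j + xvec I n s j \<le> ereal (entry_bound (s n)) + ereal (\<Sum>k<n. entry_bound (s k))" for j
    using assms by (intro add_mono entry_le Suc) auto
  then show ?case
    by (auto simp: mp_mult_vec_def add.commute intro!: SUP_least)
qed simp

lemma xmax_le:
  assumes "\<forall>k i j. s k i j \<noteq> \<infinity>"
  shows "xmax I n s \<le> ereal (\<Sum>k<n. entry_bound (s k))"
  unfolding xmax_def by (intro SUP_least xvec_le assms)

text \<open>A coordinate other than \<open>-\<infinity>\<close> is the weight of a path of finite
  entries, each at least minus its entry bound.\<close>

lemma xvec_ge:
  assumes "\<forall>k i j. s k i j \<noteq> \<infinity>"
  shows "xvec I n s i \<noteq> -\<infinity> \<Longrightarrow> - ereal (\<Sum>k<n. entry_bound (s k)) \<le> xvec I n s i"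
proof (induction n arbitrary: i)
  case (Suc n)
  have "\<exists>j\<in>I. s n i j + xvec I n s j \<noteq> -\<infinity>"
  proof (rule ccontr)
    assume "\<not> ?thesis"
    then have "xvec I (Suc n) s i \<le> -\<infinity>"
      unfolding xvec.simps mp_mult_vec_def by (intro SUP_least) (metis order_refl)
    with Suc.prems show False by simp
  qed
  then obtain j where j: "j \<in> I" "s n i j + xvec I n s j \<noteq> -\<infinity>" ..
  then have *: "s n i j \<noteq> -\<infinity>" "xvec I n s j \<noteq> -\<infinity>"
    using assms xvec_le[OF assms, of I n j] by (auto simp: ereal_plus_eq_MInfty)
  have "- ereal (\<Sum>k<Suc n. entry_bound (s k)) = - ereal (entry_bound (s n)) + - ereal (\<Sum>k<n. entry_bound (s k))"
    by simp
  also have "\<dots> \<le> s n i j + xvec I n s j"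
    using assms * by (intro add_mono entry_ge Suc.IH) auto
  also have "\<dots> \<le> xvec I (Suc n) s i"
    using mp_mult_vec_upper[OF j(1)] by simp
  finally show ?case .
qed simp

lemma xmax_ge:
  assumes "\<forall>k i j. s k i j \<noteq> \<infinity>" and "xmax I n s \<noteq> -\<infinity>"
  shows "- ereal (\<Sum>k<n. entry_bound (s k)) \<le> xmax I n s"
proof -
  have "I \<noteq> {}"
    using assms(2) by (auto simp: xmax_def bot_ereal_def)
  then obtain i where "i \<in> I" "xmax I n s = xvec I n s i"
    unfolding xmax_def using SUP_finite_attained[OF finite, of I "xvec I n s"] by blast
  then show ?thesis
    using xvec_ge[OF assms(1), of I n i] assms(2) by simp
qed

lemma xvec_no_line:
  assumes "\<forall>k i j. s k i j \<noteq> \<infinity>" and "\<forall>k. \<forall>i\<in>I. \<exists>j\<in>I. s k i j \<noteq> -\<infinity>"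
  shows "i \<in> I \<Longrightarrow> xvec I n s i \<noteq> -\<infinity>"
proof (induction n arbitrary: i)
  case (Suc n)
  obtain j where "j \<in> I" "s n i j \<noteq> -\<infinity>"
    using assms(2) Suc.prems by blast
  with Suc.IH have "s n i j + xvec I n s j \<noteq> -\<infinity>"
    by (simp add: ereal_plus_eq_MInfty)
  then show ?case
    using mp_mult_vec_upper[OF \<open>j \<in> I\<close>, of "s n" i "xvec I n s"] by auto
qed simp

lemma xvec_eq_mp_prod: "i \<in> I \<Longrightarrow> xvec I n s i = (SUP j\<in>I. mp_prod I s n i j)"
proof (induction n arbitrary: i)
  case 0
  show ?case
    using 0 by (auto simp: mp_id_def intro!: antisym SUP_least SUP_upper2[of i])
next
  case (Suc n)
  have "xvec I (Suc n) s i = (SUP j\<in>I. s n i j + (SUP k\<in>I. mp_prod I s n j k))"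
    by (simp add: mp_mult_vec_def Suc.IH cong: SUP_cong)
  also have "\<dots> = (SUP j\<in>I. SUP k\<in>I. s n i j + mp_prod I s n j k)"
    using Suc.prems by (subst add_SUP_finite) auto
  also have "\<dots> = (SUP k\<in>I. mp_prod I s (Suc n) i k)"
    by (subst SUP_commute) (simp add: mp_mult_def)
  finally show ?case .
qed

lemma xmax_eq_mp_prod: "xmax I n s = (SUP i\<in>I. SUP j\<in>I. mp_prod I s n i j)"
  unfolding xmax_def by (intro SUP_cong refl xvec_eq_mp_prod)

lemma mp_orbit_eq_xvec: "mp_orbit s n = xvec UNIV n s"
  by (rule ext) (simp add: mp_orbit_def mp_mult_vec_def xvec_eq_mp_prod)

lemma real_abs_le:
  assumes "x \<le> ereal b" "x \<noteq> -\<infinity> \<Longrightarrow> - ereal b \<le> x" "0 \<le> b"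
  shows "\<bar>real_of_ereal x\<bar> \<le> b"
  using assms by (cases x) (auto simp: abs_le_iff)

lemma xvec_abs_le:
  assumes "\<forall>k i j. s k i j \<noteq> \<infinity>"
  shows "\<bar>real_of_ereal (xvec I n s i)\<bar> \<le> (\<Sum>k<n. entry_bound (s k))"
  by (intro real_abs_le xvec_le xvec_ge assms sum_nonneg entry_bound_nonneg)

lemma xmax_abs_le:
  assumes "\<forall>k i j. s k i j \<noteq> \<infinity>"
  shows "\<bar>real_of_ereal (xmax I n s)\<bar> \<le> (\<Sum>k<n. entry_bound (s k))"
  by (intro real_abs_le xmax_le xmax_ge assms sum_nonneg entry_bound_nonneg)

lemma xvec_comb_seq [simp]: "xvec I n (comb_seq n s s') = xvec I n s"
  by (rule xvec_cong) (simp add: comb_seq_def)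

lemma xmax_comb_seq [simp]: "xmax I n (comb_seq n s s') = xmax I n s"
  by (simp add: xmax_def)

section \<open>Lyapunov exponents\<close>

lemma eventually_linear_le:
  fixes c c' C :: real
  assumes "c < c'"
  shows "\<forall>\<^sub>F n in sequentially. c * real n + C \<le> c' * real n"
proof -
  obtain n0 :: nat where n0: "C / (c' - c) < real n0"
    using reals_Archimedean2 by blast
  have "c * real n + C \<le> c' * real n" if "n \<ge> n0" for n
  proof -
    have "C < (c' - c) * real n0"
      using n0 assms by (simp add: pos_divide_less_eq mult.commute)
    also have "\<dots> \<le> (c' - c) * real n"
      using that assms by (intro mult_left_mono) auto
    finally show ?thesis
      by (simp add: algebra_simps)
  qed
  then show ?thesis
    by (auto simp: eventually_sequentially)
qed

text \<open>Rational slopes suffice to separate points, so countably many null sets are collected.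
  For \<gamma> equal to \<open>-\<infinity>\<close> the lower hypothesis is vacuous.\<close>

lemma AE_tendsto_ereal:
  fixes z :: "nat \<Rightarrow> 'w \<Rightarrow> ereal"
  assumes lower: "\<And>r. ereal r < \<gamma> \<Longrightarrow> AE s in M. \<forall>\<^sub>F n in sequentially. ereal (r * real n) \<le> z n s"
    and upper: "\<And>r. \<gamma> < ereal r \<Longrightarrow> AE s in M. \<forall>\<^sub>F n in sequentially. z n s \<le> ereal (r * real n)"
  shows "AE s in M. (\<lambda>n. z n s / ereal (real n)) \<longlonglongrightarrow> \<gamma>"
proof -
  have "AE s in M. \<forall>r::rat. ereal (of_rat r) < \<gamma> \<longrightarrow> (\<forall>\<^sub>F n in sequentially. ereal (of_rat r * real n) \<le> z n s)"
    unfolding AE_all_countable using lower by auto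
  moreover have "AE s in M. \<forall>r::rat. \<gamma> < ereal (of_rat r) \<longrightarrow> (\<forall>\<^sub>F n in sequentially. z n s \<le> ereal (of_rat r * real n))"
    unfolding AE_all_countable using upper by auto
  ultimately show ?thesis
  proof eventually_elim
    case (elim s)
    show ?case
    proof (rule order_tendstoI)
      fix x assume "x < \<gamma>"
      then obtain r where r: "x < ereal (of_rat r)" "ereal (of_rat r) < \<gamma>"
        using ereal_dense3 by blast
      have "\<forall>\<^sub>F n in sequentially. ereal (of_rat r * real n) \<le> z n s"
        using elim(1) r(2) by blast
      then show "\<forall>\<^sub>F n in sequentially. x < z n s / ereal (real n)"
        using eventually_gt_at_top[of 0]
      proof eventually_elim
        case (elim n)
        have "ereal (of_rat r) \<le> z n s / ereal (real n)"
          using elim by (subst ereal_le_divide_pos) (auto simp: mult.commute)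
        with r(1) show ?case by simp
      qed
    next
      fix x assume "\<gamma> < x"
      then obtain r where r: "\<gamma> < ereal (of_rat r)" "ereal (of_rat r) < x"
        using ereal_dense3 by blast
      have "\<forall>\<^sub>F n in sequentially. z n s \<le> ereal (of_rat r * real n)"
        using elim(2) r(1) by blast
      then show "\<forall>\<^sub>F n in sequentially. z n s / ereal (real n) < x"
        using eventually_gt_at_top[of 0]
      proof eventually_elim
        case (elim n)
        have "z n s / ereal (real n) \<le> ereal (of_rat r)"
          using elim by (subst ereal_divide_le_pos) (auto simp: mult.commute)
        with r(2) show ?case by simp
      qed
    qed
  qed
qed

text \<open>Written as a difference of prefix sums because the strong law controls sums from time
  0.\<close>

lemma xmax_shift_le:
  assumes "\<forall>k i j. s k i j \<noteq> \<infinity>"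
  shows "xmax I n (shift_seq a s) \<le> ereal ((\<Sum>k<a + n. entry_bound (s k)) - (\<Sum>k<a. entry_bound (s k)))"
  using xmax_le[of "shift_seq a s" I n] assms by (simp add: shift_seq_def sum_lessThan_add)

lemma xmax_blocks_le:
  assumes "I \<noteq> {}" and "\<forall>k. xmax I N (shift_seq (k * N) s) \<le> ereal (g (shift_seq (k * N) s))"
  shows "xmax I (q * N) (shift_seq (k * N) s)
    \<le> ereal ((\<Sum>j<k + q. g (shift_seq (j * N) s)) - (\<Sum>j<k. g (shift_seq (j * N) s)))"
proof (induction q)
  case 0
  then show ?case
    using assms(1) by (simp add: xmax_0)
next
  case (Suc q)
  have "xmax I (Suc q * N) (shift_seq (k * N) s)
      \<le> xmax I N (shift_seq ((k + q) * N) s) + xmax I (q * N) (shift_seq (k * N) s)"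
    using xmax_add_le[of I "q * N" N "shift_seq (k * N) s"] by (simp add: algebra_simps)
  also have "\<dots> \<le> ereal (g (shift_seq ((k + q) * N) s))
      + ereal ((\<Sum>j<k + q. g (shift_seq (j * N) s)) - (\<Sum>j<k. g (shift_seq (j * N) s)))"
    using assms(2) by (intro add_mono Suc) auto
  finally show ?case
    by (simp add: algebra_simps)
qed

text \<open>The window from \<open>a\<close> to \<open>a + n\<close> is cut at multiples of
  \<open>N\<close> into an initial piece, whole blocks and a remainder; the two ragged ends are
  estimated by entry bounds. Each piece is a difference of two prefix sums with error up to
  \<open>d (a + n)\<close> apiece, whence the factor 6.\<close>

lemma xmax_window_le:
  fixes b c d m C C' :: real
  assumes fin: "\<forall>k i j. s k i j \<noteq> \<infinity>" and I: "I \<noteq> {}" and N: "N > 0"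
    and g: "\<forall>k. xmax I N (shift_seq (k * N) s) \<le> ereal (g (shift_seq (k * N) s))"
    and G: "\<forall>q. \<bar>(\<Sum>k<q. g (shift_seq (k * N) s)) - m * real q\<bar> \<le> d * real q + C"
    and B: "\<forall>q. \<bar>(\<Sum>k<q. entry_bound (s k)) - b * real q\<bar> \<le> d * real q + C'"
    and m: "m \<le> c * real N" and "0 \<le> b" "0 \<le> d"
  shows "xmax I n (shift_seq a s)
    \<le> ereal (c * real n + 6 * d * real (a + n) + (2 * real N * (\<bar>c\<bar> + b) + 2 * C + 4 * C'))"
proof -
  define SB where "SB q = (\<Sum>k<q. entry_bound (s k))" for q
  define SG where "SG q = (\<Sum>k<q. g (shift_seq (k * N) s))" for q
  have C: "0 \<le> C" "0 \<le> C'"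
    using G[rule_format, of 0] B[rule_format, of 0] by simp_all
  have SB: "SB q - SB p \<le> b * real (q - p) + 2 * d * real (a + n) + 2 * C'" if "p \<le> q" "q \<le> a + n" for p q
  proof -
    have "d * real p \<le> d * real (a + n)" "d * real q \<le> d * real (a + n)"
      using that \<open>0 \<le> d\<close> by (auto intro!: mult_left_mono)
    then show ?thesis
      using B[rule_format, of p] B[rule_format, of q] that(1)
      unfolding SB_def[symmetric] by (simp add: of_nat_diff right_diff_distrib abs_le_iff)
  qed
  \<comment> \<open>\<open>k * N\<close> is the first multiple of \<open>N\<close> strictly beyond
    \<open>a\<close>; if \<open>N\<close> divides \<open>a\<close>, the initial piece has full
    length \<open>N\<close>.\<close>
  define k where "k = a div N + 1"
  define p where "p = k * N - a"
  have kN: "a + p = k * N" "p \<le> N"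
  proof -
    have "a div N * N + a mod N = a" "a mod N < N"
      using N by (simp_all only: div_mult_mod_eq mod_less_divisor)
    moreover have "k * N = a div N * N + N"
      by (simp add: k_def)
    ultimately show "a + p = k * N" "p \<le> N"
      unfolding p_def by linarith+
  qed
  show ?thesis
  proof (cases "n < p")
    case True
    have "xmax I n (shift_seq a s) \<le> ereal (SB (a + n) - SB a)"
      unfolding SB_def by (rule xmax_shift_le[OF fin])
    also have "SB (a + n) - SB a \<le> b * real n + 2 * d * real (a + n) + 2 * C'"
      using SB[of a "a + n"] by simp
    also have "\<dots> \<le> c * real n + 6 * d * real (a + n) + (2 * real N * (\<bar>c\<bar> + b) + 2 * C + 4 * C')"
    proof -
      have n: "real n \<le> real N"
        using True kN(2) by simp
      have "b * real n \<le> b * real N" "\<bar>c\<bar> * real n \<le> \<bar>c\<bar> * real N"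
        using n \<open>0 \<le> b\<close> by (auto intro!: mult_left_mono)
      moreover have "- c * real n \<le> \<bar>c\<bar> * real n"
        by (intro mult_right_mono) auto
      moreover have "0 \<le> d * real (a + n)" "0 \<le> b * real N" "0 \<le> \<bar>c\<bar> * real N"
        using \<open>0 \<le> d\<close> \<open>0 \<le> b\<close> by auto
      moreover have "2 * real N * (\<bar>c\<bar> + b) = 2 * (\<bar>c\<bar> * real N) + 2 * (b * real N)"
        "2 * d * real (a + n) = 2 * (d * real (a + n))" "6 * d * real (a + n) = 6 * (d * real (a + n))"
        by (simp_all add: algebra_simps)
      ultimately show ?thesis
        using C by linarith
    qed
    finally show ?thesis by simp
  next
    case False
    define q where "q = (n - p) div N"
    define r where "r = (n - p) mod N"
    have n: "n = p + (q * N + r)" "r < N"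
      using False N by (simp_all add: q_def r_def)
    have "xmax I n (shift_seq a s)
        \<le> (xmax I r (shift_seq (k * N + q * N) s) + xmax I (q * N) (shift_seq (k * N) s)) + xmax I p (shift_seq a s)"
    proof -
      have "xmax I n (shift_seq a s) \<le> xmax I (q * N + r) (shift_seq (k * N) s) + xmax I p (shift_seq a s)"
        using xmax_add_le[of I p "q * N + r" "shift_seq a s"] unfolding n(1)[symmetric] by (simp add: kN(1))
      also have "\<dots> \<le> (xmax I r (shift_seq (k * N + q * N) s) + xmax I (q * N) (shift_seq (k * N) s))
          + xmax I p (shift_seq a s)"
        using xmax_add_le[of I "q * N" r "shift_seq (k * N) s"] by (intro add_right_mono) simp
      finally show ?thesis .
    qed
    also have "\<dots> \<le> (ereal (SB (a + n) - SB (a + n - r)) + ereal (SG (k + q) - SG k)) + ereal (SB (a + p) - SB a)"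
    proof (intro add_mono)
      have "a + n - r = k * N + q * N"
        using n(1) kN(1) by simp
      moreover have "k * N + q * N + r = a + n"
        using n(1) kN(1) by simp
      ultimately show "xmax I r (shift_seq (k * N + q * N) s) \<le> ereal (SB (a + n) - SB (a + n - r))"
        using xmax_shift_le[OF fin, of I r "k * N + q * N"] by (simp add: SB_def)
      show "xmax I (q * N) (shift_seq (k * N) s) \<le> ereal (SG (k + q) - SG k)"
        unfolding SG_def by (rule xmax_blocks_le[OF I g])
      show "xmax I p (shift_seq a s) \<le> ereal (SB (a + p) - SB a)"
        unfolding SB_def by (rule xmax_shift_le[OF fin])
    qed
    also have "\<dots> = ereal ((SB (a + n) - SB (a + n - r)) + (SG (k + q) - SG k) + (SB (a + p) - SB a))"
      by simp
    also have "(SB (a + n) - SB (a + n - r)) + (SG (k + q) - SG k) + (SB (a + p) - SB a)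
        \<le> c * real n + 6 * d * real (a + n) + (2 * real N * (\<bar>c\<bar> + b) + 2 * C + 4 * C')"
    proof -
      have SB1: "SB (a + n) - SB (a + n - r) \<le> b * real N + 2 * d * real (a + n) + 2 * C'"
      proof -
        have "a + n - (a + n - r) = r"
          using n by simp
        moreover have "b * real r \<le> b * real N"
          using n(2) \<open>0 \<le> b\<close> by (intro mult_left_mono) auto
        ultimately show ?thesis
          using SB[of "a + n - r" "a + n"] by simp
      qed
      have SB2: "SB (a + p) - SB a \<le> b * real N + 2 * d * real (a + n) + 2 * C'"
      proof -
        have "b * real p \<le> b * real N"
          using kN(2) \<open>0 \<le> b\<close> by (intro mult_left_mono) auto
        then show ?thesis
          using SB[of a "a + p"] n by simp
      qed
      have SG: "SG (k + q) - SG k \<le> m * real q + 2 * d * real (a + n) + 2 * C"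
      proof -
        have "k + q \<le> (k + q) * N"
          using N by simp
        also have "\<dots> \<le> a + n"
          using n(1) kN(1) by (simp add: algebra_simps)
        finally have "k + q \<le> a + n" .
        then have "d * real k \<le> d * real (a + n)" "d * real (k + q) \<le> d * real (a + n)"
          using \<open>0 \<le> d\<close> by (auto intro!: mult_left_mono)
        then show ?thesis
          using G[rule_format, of k] G[rule_format, of "k + q"]
          unfolding SG_def[symmetric] by (simp add: ring_distribs abs_le_iff)
      qed
      have mq: "m * real q \<le> c * real n + 2 * real N * \<bar>c\<bar>"
      proof -
        have "m * real q \<le> (c * real N) * real q"
          using m by (intro mult_right_mono) auto
        moreover have "(c * real N) * real q = c * real n - c * real (p + r)"
          using n(1) by (simp add: algebra_simps)
        moreover have "- c * real (p + r) \<le> \<bar>c\<bar> * real (p + r)"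
          by (intro mult_right_mono) auto
        moreover have "\<bar>c\<bar> * real (p + r) \<le> \<bar>c\<bar> * real (2 * N)"
          using n(2) kN(2) by (intro mult_left_mono) auto
        moreover have "\<bar>c\<bar> * real (2 * N) = 2 * real N * \<bar>c\<bar>"
          by simp
        ultimately show ?thesis by linarith
      qed
      show ?thesis
        using SB1 SB2 SG mq by (simp add: algebra_simps)
    qed
    finally show ?thesis by simp
  qed
qed

section \<open>Coordinates, reversal and independence on the product space\<close>

context sequence_space
begin

lemma distr_component: "distr S M (\<lambda>s. s k) = M"
  by (rule PiM_component) auto

lemma AE_component_all:
  assumes "AE a in M. Q a"
  shows "AE s in S. \<forall>k. Q (s k)"
  unfolding AE_all_countable
proof
  fix k
  show "AE s in S. Q (s k)"
    using AE_distrD[of "\<lambda>s. s k" S M Q] assms unfolding distr_component by simp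
qed

lemma distr_reverse_prefix: "distr S S (reverse_prefix n) = S"
proof -
  have "inj (\<lambda>k::nat. if k < n then n - 1 - k else k)"
    by (auto simp: inj_on_def split: if_splits)
  from distr_reindex[OF this] show ?thesis
    by (simp only: reverse_prefix_def[abs_def])
qed

lemma measurable_reverse_prefix [measurable]: "reverse_prefix n \<in> measurable S S"
  unfolding reverse_prefix_def by (rule measurable_PiM_single') (auto simp: space_PiM)

text \<open>Splicing a prefix to an independent continuation turns the joint event into a
  rectangle.\<close>

lemma measure_prefix_shift:
  assumes [measurable]: "{s \<in> space S. Q s} \<in> sets S" "{s \<in> space S. T s} \<in> sets S"
    and prefix: "\<And>s s'. Q (comb_seq m s s') \<longleftrightarrow> Q s"
  shows "measure S {s \<in> space S. Q s \<and> T (shift_seq m s)}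
    = measure S {s \<in> space S. Q s} * measure S {s \<in> space S. T s}"
proof -
  let ?c = "\<lambda>(s, s'). comb_seq m s s'"
  have c [measurable]: "?c \<in> measurable (S \<Otimes>\<^sub>M S) S"
    by (rule measurable_comb_seq)
  let ?A = "{s \<in> space S. Q s \<and> T (shift_seq m s)}"
  have "shift_seq m -` {s \<in> space S. T s} \<inter> space S \<in> sets S"
    by (rule measurable_sets[OF measurable_shift_seq]) measurable
  also have "shift_seq m -` {s \<in> space S. T s} \<inter> space S = {s \<in> space S. T (shift_seq m s)}"
    using measurable_space[OF measurable_shift_seq] by blast
  finally have [measurable]: "{s \<in> space S. T (shift_seq m s)} \<in> sets S" .
  have A: "?A \<in> sets S"
    by measurable
  have "emeasure S ?A = emeasure (distr (S \<Otimes>\<^sub>M S) S ?c) ?A"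
    by (simp only: PiM_comb_seq)
  also have "\<dots> = emeasure (S \<Otimes>\<^sub>M S) (?c -` ?A \<inter> space (S \<Otimes>\<^sub>M S))"
    by (rule emeasure_distr[OF c A])
  also have "?c -` ?A \<inter> space (S \<Otimes>\<^sub>M S) = {s \<in> space S. Q s} \<times> {s \<in> space S. T s}"
    using measurable_space[OF c] by (auto simp: space_pair_measure prefix)
  also have "emeasure (S \<Otimes>\<^sub>M S) \<dots> = emeasure S {s \<in> space S. Q s} * emeasure S {s \<in> space S. T s}"
    by (rule P.emeasure_pair_measure_Times) measurable
  finally show ?thesis
    by (simp add: P.emeasure_eq_measure ennreal_mult[symmetric])
qed

end

lemma measurable_mp_entry: "(\<lambda>a. a i j) \<in> borel_measurable mp_mat_space"
proof -
  have "(\<lambda>a. a i) \<in> measurable mp_mat_space (\<Pi>\<^sub>M j\<in>UNIV. borel)"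
    unfolding mp_mat_space_def by (rule measurable_component_singleton) simp
  moreover have "(\<lambda>r. r j) \<in> borel_measurable (\<Pi>\<^sub>M j\<in>UNIV. borel)"
    by (rule measurable_component_singleton) simp
  ultimately show ?thesis
    by (rule measurable_compose)
qed

text \<open>The base measure is the law of one matrix and the sequence is the coordinate process, so
  that shifts and reversals act on the space itself. The given random matrices are transported here
  at the end.\<close>

locale mp_iid = sequence_space M for M :: "'n::finite mp_mat measure" +
  assumes sets_M: "sets M = sets mp_mat_space"
    and AE_not_infinity: "AE a in M. \<forall>i j. a i j \<noteq> \<infinity>"
    and AE_no_line: "AE a in M. \<forall>i. \<exists>j. a i j \<noteq> -\<infinity>"
    and integrable_entry_bound: "integrable M entry_bound"
begin

lemma measurable_entry [measurable]: "(\<lambda>a. a i j) \<in> borel_measurable M"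
  using measurable_mp_entry measurable_cong_sets[OF sets_M refl] by blast

lemma measurable_seq_entry [measurable]: "(\<lambda>s. s k i j) \<in> borel_measurable S"
proof -
  have "(\<lambda>s. s k) \<in> measurable S M"
    by (rule measurable_component_singleton) simp
  from measurable_compose[OF this measurable_entry] show ?thesis .
qed

lemma measurable_xvec [measurable]: "(\<lambda>s. xvec I n s i) \<in> borel_measurable S"
  by (induction n arbitrary: i) (auto simp: mp_mult_vec_def)

lemma measurable_xmax [measurable]: "xmax I n \<in> borel_measurable S"
  unfolding xmax_def by measurable

lemma measurable_yvec [measurable]: "(\<lambda>s. yvec I n s i) \<in> borel_measurable S"
  unfolding yvec_eq_xvec by measurable

lemma AE_seq_not_infinity: "AE s in S. \<forall>k i j. s k i j \<noteq> \<infinity>"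
  using AE_component_all[OF AE_not_infinity] .

lemma integrable_component_bound: "integrable S (\<lambda>s. entry_bound (s k))"
  by (rule integrable_distr[where M' = M])
     (simp_all add: distr_component integrable_entry_bound)

definition \<beta> :: real where "\<beta> = (\<integral>a. entry_bound a \<partial>M)"

lemma \<beta>_nonneg: "0 \<le> \<beta>"
  unfolding \<beta>_def by (rule Bochner_Integration.integral_nonneg) (rule entry_bound_nonneg)

lemma integral_component_bound: "(\<integral>s. entry_bound (s k) \<partial>S) = \<beta>"
proof -
  have "(\<lambda>s. s k) \<in> measurable S M"
    by simp
  from integral_distr[OF this, of entry_bound] integrable_entry_bound show ?thesis
    by (simp add: distr_component \<beta>_def)
qed

lemma AE_entry_sums:
  "AE s in S. \<forall>e>0. \<exists>C. \<forall>q. \<bar>(\<Sum>k<q. entry_bound (s k)) - \<beta> * real q\<bar> \<le> e * real q + C"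
proof -
  have "AE s in S. \<forall>e>0. \<exists>C. \<forall>q. \<bar>(\<Sum>k<q. entry_bound (shift_seq (k * 1) s 0))
      - (\<integral>s. entry_bound (s 0) \<partial>S) * real q\<bar> \<le> e * real q + C"
    by (rule block_strong_law[OF integrable_component_bound]) (simp add: comb_seq_def)
  then show ?thesis
    by (simp add: shift_seq_def integral_component_bound)
qed

text \<open>A term is the difference of two consecutive prefix sums, both close to
  \<open>\<beta> k\<close>. Hence the single arc by which a path leaves its component costs
  \<open>o(n)\<close>.\<close>

lemma AE_entry_le: "AE s in S. \<forall>e>0. \<exists>C. \<forall>k. entry_bound (s k) \<le> e * real k + C"
  using AE_entry_sums
proof eventually_elim
  case (elim s)
  show ?case
  proof (intro allI impI)
    fix e :: real assume "e > 0"
    then obtain C where C: "\<And>q. \<bar>(\<Sum>k<q. entry_bound (s k)) - \<beta> * real q\<bar> \<le> e / 2 * real q + C"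
      using elim[rule_format, of "e / 2"] by auto
    have "entry_bound (s k) \<le> e * real k + (e / 2 + \<beta> + 2 * C)" for k
      using abs_le_D2[OF C[of k]] abs_le_D1[OF C[of "Suc k"]] by (simp add: field_simps)
    then show "\<exists>C. \<forall>k. entry_bound (s k) \<le> e * real k + C"
      by blast
  qed
qed

lemma AE_xmax_window_le:
  assumes I: "I \<noteq> {}" and N: "N > 0" and int: "integrable S g"
    and prefix: "\<And>s s'. g (comb_seq N s s') = g s"
    and g: "AE s in S. xmax I N s \<le> ereal (g s)" and less: "(\<integral>s. g s \<partial>S) \<le> c * real N"
  shows "AE s in S. \<forall>e>0. \<exists>C. \<forall>a n. xmax I n (shift_seq a s) \<le> ereal (c * real n + e * real (a + n) + C)"
  using AE_shift_seq[OF g] block_strong_law[OF int prefix] AE_entry_sums AE_seq_not_infinity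
proof eventually_elim
  case (elim s)
  show ?case
  proof (intro allI impI)
    fix e :: real assume "e > 0"
    \<comment> \<open>The window estimate multiplies the error by 6.\<close>
    then obtain C where C: "\<forall>q. \<bar>(\<Sum>k<q. g (shift_seq (k * N) s)) - (\<integral>s. g s \<partial>S) * real q\<bar> \<le> e / 6 * real q + C"
      using elim(2)[rule_format, of "e / 6"] by auto
    obtain C' where C': "\<forall>q. \<bar>(\<Sum>k<q. entry_bound (s k)) - \<beta> * real q\<bar> \<le> e / 6 * real q + C'"
      using elim(3)[rule_format, of "e / 6"] \<open>e > 0\<close> by auto
    have g: "\<forall>k. xmax I N (shift_seq (k * N) s) \<le> ereal (g (shift_seq (k * N) s))"
      using elim(1) by blast
    have "xmax I n (shift_seq a s)
      \<le> ereal (c * real n + 6 * (e / 6) * real (a + n) + (2 * real N * (\<bar>c\<bar> + \<beta>) + 2 * C + 4 * C'))" for a n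
      using \<open>e > 0\<close> by (intro xmax_window_le[OF elim(4) I N g C C' less \<beta>_nonneg]) simp
    then show "\<exists>C. \<forall>a n. xmax I n (shift_seq a s) \<le> ereal (c * real n + e * real (a + n) + C)"
      by (intro exI[of _ "2 * real N * (\<bar>c\<bar> + \<beta>) + 2 * C + 4 * C'"]) simp
  qed
qed

lemma integrable_entry_sum: "integrable S (\<lambda>s. \<Sum>k<n. entry_bound (s k))"
  by (intro Bochner_Integration.integrable_sum integrable_component_bound)

lemma integral_entry_sum: "(\<integral>s. (\<Sum>k<n. entry_bound (s k)) \<partial>S) = \<beta> * real n"
  by (simp add: Bochner_Integration.integral_sum integrable_component_bound integral_component_bound)

lemma integrable_xvec: "integrable S (\<lambda>s. real_of_ereal (xvec I n s i))"
  by (rule Bochner_Integration.integrable_bound[OF integrable_entry_sum[of n]])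
     (auto intro!: eventually_mono[OF AE_seq_not_infinity] intro: order_trans[OF xvec_abs_le abs_ge_self]
        simp del: abs_real_of_ereal)

lemma integrable_xmax: "integrable S (\<lambda>s. real_of_ereal (xmax I n s))"
  by (rule Bochner_Integration.integrable_bound[OF integrable_entry_sum[of n]])
     (auto intro!: eventually_mono[OF AE_seq_not_infinity] intro: order_trans[OF xmax_abs_le abs_ge_self]
        simp del: abs_real_of_ereal)

end

lemma (in prob_space) AE_LIMSEQ_unique:
  fixes f :: "nat \<Rightarrow> 'a \<Rightarrow> 'b::t2_space"
  assumes "AE x in M. (\<lambda>n. f n x) \<longlonglongrightarrow> a" "AE x in M. (\<lambda>n. f n x) \<longlonglongrightarrow> b"
  shows "a = b"
proof -
  have "AE x in M. a = b"
    using assms by eventually_elim (rule LIMSEQ_unique)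
  then show ?thesis by simp
qed

lemma xmax_subadditive_real:
  assumes "\<forall>n a. xmax I n (shift_seq a s) \<noteq> -\<infinity>" and "\<forall>k i j. s k i j \<noteq> \<infinity>"
  shows "real_of_ereal (xmax I (m + n) s) \<le> real_of_ereal (xmax I m s) + real_of_ereal (xmax I n (shift_seq m s))"
proof -
  have fin: "\<bar>xmax I n (shift_seq a s)\<bar> \<noteq> \<infinity>" for a n
    using assms(1) xmax_shift_le[OF assms(2), of I n a] by (cases "xmax I n (shift_seq a s)") auto
  obtain x y z where "xmax I (m + n) s = ereal x" "xmax I m s = ereal y" "xmax I n (shift_seq m s) = ereal z"
    using fin[of "m + n" 0] fin[of m 0] fin[of n m] by (metis ereal_infinity_cases shift_seq_0 abs_ereal_ge0 abs_neq_infinity_cases)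
  then show ?thesis
    using xmax_add_le[of I m n s] by simp
qed

context mp_iid
begin

text \<open>The error is relative to \<open>a + n\<close> and not to \<open>n\<close>: a bound by
  \<open>e n + C\<close> uniform in the start \<open>a\<close> could not survive late runs of large
  entries. For windows inside \<open>[0, n]\<close> the error is still at most
  \<open>e n\<close>.\<close>

definition slope_le :: "'n set \<Rightarrow> real \<Rightarrow> bool" where
  "slope_le I c \<longleftrightarrow> (AE s in S. \<forall>e>0. \<exists>C. \<forall>a n.
     xmax I n (shift_seq a s) \<le> ereal (c * real n + e * real (a + n) + C))"

lemma slope_le_eventually:
  assumes "slope_le I c" "c < r"
  shows "AE s in S. \<forall>\<^sub>F n in sequentially. xmax I n s \<le> ereal (r * real n)"
  using assms(1) unfolding slope_le_def
proof eventually_elim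
  case (elim s)
  define e where "e = (r - c) / 2"
  have "e > 0"
    using assms(2) by (simp add: e_def)
  then obtain C where C: "\<And>a n. xmax I n (shift_seq a s) \<le> ereal (c * real n + e * real (a + n) + C)"
    using elim by blast
  have "c + e < r"
    using assms(2) by (simp add: e_def field_simps)
  from eventually_linear_le[OF this, of C] show ?case
  proof eventually_elim
    case (elim n)
    have "xmax I n s \<le> ereal (c * real n + e * real n + C)"
      using C[of n 0] by simp
    also have "\<dots> \<le> ereal (r * real n)"
      using elim by (simp add: algebra_simps)
    finally show ?case .
  qed
qed

text \<open>If the product over a block of length \<open>N\<close> is \<open>-\<infinity>\<close>
  with positive probability \<open>p\<close>, replacing that value by a large negative real
  \<open>- K\<close> yields an integrable upper bound with arbitrarily low mean.\<close>

lemma slope_le_of_minus_infinity: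
  assumes I: "I \<noteq> {}" and "\<not> (AE s in S. xmax I N s \<noteq> -\<infinity>)"
  shows "slope_le I c"
proof -
  define D where "D = {s \<in> space S. xmax I N s = -\<infinity>}"
  have [measurable]: "D \<in> sets S"
    unfolding D_def by measurable
  define p where "p = measure S D"
  have "p > 0"
  proof (rule ccontr)
    assume "\<not> p > 0"
    then have "D \<in> null_sets S"
      by (simp add: p_def null_sets_def P.emeasure_eq_measure order_antisym not_less)
    from AE_not_in[OF this] AE_space have "AE s in S. xmax I N s \<noteq> -\<infinity>"
      by eventually_elim (auto simp: D_def)
    with assms(2) show False by blast
  qed
  have "N > 0"
  proof (rule ccontr)
    assume "\<not> N > 0"
    then show False
      using assms(2) I by (simp add: xmax_0)
  qed
  \<comment> \<open>Chosen so that the mean of the bound, at most \<open>\<beta> N - K p\<close>,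
    does not exceed \<open>c N\<close>.\<close>
  define K where "K = max 0 ((\<beta> * real N - c * real N) / p)"
  have K: "0 \<le> K" "\<beta> * real N - K * p \<le> c * real N"
  proof -
    have "(\<beta> * real N - c * real N) / p \<le> K"
      by (simp add: K_def)
    then show "\<beta> * real N - K * p \<le> c * real N"
      using \<open>p > 0\<close> by (simp add: pos_divide_le_eq)
  qed (simp add: K_def)
  define g where "g s = real_of_ereal (max (xmax I N s) (ereal (- K)))" for s
  have [measurable]: "g \<in> borel_measurable S"
    unfolding g_def by measurable
  let ?B = "\<lambda>s. \<Sum>k<N. entry_bound (s k)"
  have B_nonneg: "0 \<le> ?B s" for s
    by (intro sum_nonneg entry_bound_nonneg)
  have g: "xmax I N s \<le> ereal (g s) \<and> \<bar>g s\<bar> \<le> ?B s + K \<and> g s \<le> ?B s - K * indicator D s"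
    if "\<forall>k i j. s k i j \<noteq> \<infinity>" "s \<in> space S" for s
    using xmax_le[OF that(1), of I N] xmax_ge[OF that(1), of I N] K(1) B_nonneg[of s] that(2)
    by (cases "xmax I N s") (auto simp: g_def D_def max_def indicator_def)
  have int_g: "integrable S g"
  proof (rule Bochner_Integration.integrable_bound)
    show "integrable S (\<lambda>s. ?B s + K)"
      using integrable_entry_sum by simp
    show "AE s in S. norm (g s) \<le> norm (?B s + K)"
      using AE_seq_not_infinity AE_space
    proof eventually_elim
      case (elim s)
      show ?case
        using g[OF elim] B_nonneg[of s] K(1) by simp
    qed
  qed simp
  have int_D: "integrable S (indicat_real D)"
    by (rule P.integrable_const_bound[of _ 1]) (auto simp: indicator_def)
  have "(\<integral>s. g s \<partial>S) \<le> (\<integral>s. ?B s - K * indicator D s \<partial>S)"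
  proof (rule integral_mono_AE)
    show "integrable S (\<lambda>s. ?B s - K * indicator D s)"
      by (intro Bochner_Integration.integrable_diff integrable_entry_sum integrable_mult_right int_D)
    show "AE s in S. g s \<le> ?B s - K * indicator D s"
      using AE_seq_not_infinity AE_space by eventually_elim (use g in blast)
  qed (rule int_g)
  also have "\<dots> = \<beta> * real N - K * p"
    using integrable_entry_sum[of N] int_D by (simp add: integral_entry_sum p_def)
  also have "\<dots> \<le> c * real N"
    by (rule K(2))
  finally have "(\<integral>s. g s \<partial>S) \<le> c * real N" .
  moreover have "AE s in S. xmax I N s \<le> ereal (g s)"
    using AE_seq_not_infinity AE_space by eventually_elim (use g in blast)
  moreover have "g (comb_seq N s s') = g s" for s s'
    by (simp add: g_def)
  ultimately show ?thesis
    unfolding slope_le_def by (intro AE_xmax_window_le[OF I \<open>N > 0\<close> int_g])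
qed

text \<open>A dichotomy. If some product is \<open>-\<infinity>\<close> with positive probability,
  every real slope is an upper bound and the limit is \<open>-\<infinity>\<close>. Otherwise all
  products are almost surely finite and Kingman's argument gives a real limit.\<close>

lemma lyapunov_limit_exists:
  assumes I: "I \<noteq> {}"
  shows "\<exists>\<gamma>. \<gamma> \<noteq> \<infinity> \<and> (AE s in S. (\<lambda>n. xmax I n s / ereal (real n)) \<longlonglongrightarrow> \<gamma>)
    \<and> (\<forall>c. \<gamma> < ereal c \<longrightarrow> slope_le I c)"
proof (cases "\<exists>N. \<not> (AE s in S. xmax I N s \<noteq> -\<infinity>)")
  case True
  then have slope: "slope_le I c" for c
    using slope_le_of_minus_infinity[OF I] by blast
  have "AE s in S. (\<lambda>n. xmax I n s / ereal (real n)) \<longlonglongrightarrow> -\<infinity>"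
  proof (rule AE_tendsto_ereal)
    fix r :: real
    show "AE s in S. \<forall>\<^sub>F n in sequentially. xmax I n s \<le> ereal (r * real n)"
      by (rule slope_le_eventually[OF slope[of "r - 1"]]) simp
  qed simp
  with slope show ?thesis
    by (intro exI[of _ "-\<infinity>"]) simp
next
  case False
  then have "AE s in S. \<forall>N. xmax I N s \<noteq> -\<infinity>"
    by (simp add: AE_all_countable)
  from AE_shift_seq[OF this] have not_bot: "AE s in S. \<forall>N k. xmax I N (shift_seq k s) \<noteq> -\<infinity>"
    by eventually_elim blast
  define F where "F n s = real_of_ereal (xmax I n s)" for n s
  have int_F: "integrable S (F n)" for n
    unfolding F_def by (rule integrable_xmax)
  have F_0: "F 0 s = 0" for s
    using I by (simp add: F_def xmax_0)
  have F_ge: "- \<beta> * real n \<le> (\<integral>s. F n s \<partial>S)" for n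
  proof -
    have "(\<integral>s. - (\<Sum>k<n. entry_bound (s k)) \<partial>S) \<le> (\<integral>s. F n s \<partial>S)"
    proof (rule integral_mono_AE)
      show "AE s in S. - (\<Sum>k<n. entry_bound (s k)) \<le> F n s"
        using AE_seq_not_infinity
      proof eventually_elim
        case (elim s)
        show ?case
          using abs_le_D2[OF xmax_abs_le[OF elim, of I n]] by (simp add: F_def)
      qed
    qed (use integrable_entry_sum[of n] int_F in auto)
    then show ?thesis
      by (simp add: integral_entry_sum)
  qed
  \<comment> \<open>Kingman's constant; it is at least \<open>- \<beta>\<close>. A block length
    whose mean slope is below \<open>c\<close> gives the upper bound, and \<open>G n\<close> below
    every mean gives the lower one.\<close>
  define G where "G = (INF n\<in>{1..}. (\<integral>s. F n s \<partial>S) / real n)"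
  have bdd: "bdd_below ((\<lambda>n. (\<integral>s. F n s \<partial>S) / real n) ` {1..})"
  proof (rule bdd_belowI2[where m = "- \<beta>"])
    fix n :: nat assume "n \<in> {1..}"
    then show "- \<beta> \<le> (\<integral>s. F n s \<partial>S) / real n"
      using F_ge[of n] by (simp add: pos_le_divide_eq)
  qed
  have G_le: "G * real n \<le> (\<integral>s. F n s \<partial>S)" for n
  proof (cases "n = 0")
    case True
    then show ?thesis by (simp add: F_0)
  next
    case False
    then have "G \<le> (\<integral>s. F n s \<partial>S) / real n"
      unfolding G_def by (intro cINF_lower bdd) auto
    then show ?thesis
      using False by (simp add: pos_le_divide_eq)
  qed
  have slope: "slope_le I c" if "G < c" for c
  proof -
    have "\<exists>N\<in>{1..}. (\<integral>s. F N s \<partial>S) / real N < c"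
      using that unfolding G_def by (subst (asm) cINF_less_iff[OF _ bdd]) auto
    then obtain N where N: "N > 0" "(\<integral>s. F N s \<partial>S) / real N < c"
      by (auto simp: Suc_le_eq)
    then have "(\<integral>s. F N s \<partial>S) \<le> c * real N"
      by (simp add: pos_divide_less_eq)
    moreover have "AE s in S. xmax I N s \<le> ereal (F N s)"
      using AE_seq_not_infinity
    proof eventually_elim
      case (elim s)
      show ?case
        using xmax_le[OF elim, of I N] by (cases "xmax I N s") (auto simp: F_def)
    qed
    moreover have "F N (comb_seq N s s') = F N s" for s s'
      by (simp add: F_def)
    ultimately show ?thesis
      unfolding slope_le_def by (intro AE_xmax_window_le[OF I N(1) int_F])
  qed
  have "AE s in S. (\<lambda>n. xmax I n s / ereal (real n)) \<longlonglongrightarrow> ereal G"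
  proof (rule AE_tendsto_ereal)
    fix r assume "ereal r < ereal G"
    then have "r < G" by simp
    have "AE s in S. \<forall>\<^sub>F n in sequentially. r * real n < F n s"
    proof (rule subadditive_eventually_greater[where h = "\<lambda>s. entry_bound (s 0)" and c = G])
      show "AE s in S. \<forall>m n. F (m + n) s \<le> F m s + F n (shift_seq m s)"
        using not_bot AE_seq_not_infinity
        by eventually_elim (auto simp: F_def intro!: xmax_subadditive_real)
      show "AE s in S. F 1 s \<le> entry_bound (s 0)"
        using AE_seq_not_infinity
      proof eventually_elim
        case (elim s)
        show ?case
          using abs_le_D1[OF xmax_abs_le[OF elim, of I 1]] by (simp add: F_def)
      qed
      show "F n (comb_seq n s s') = F n s" for n s s'
        by (simp add: F_def)
    qed (use \<open>r < G\<close> G_le F_0 int_F integrable_component_bound in \<open>auto simp: entry_bound_nonneg\<close>)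
    then show "AE s in S. \<forall>\<^sub>F n in sequentially. ereal (r * real n) \<le> xmax I n s"
      using AE_seq_not_infinity not_bot
    proof eventually_elim
      case (elim s)
      note fin = elim(2) and not_bot = elim(3)
      from elim(1) show ?case
      proof eventually_elim
        case (elim n)
        have "xmax I n s \<noteq> -\<infinity>" "xmax I n s \<noteq> \<infinity>"
          using not_bot[rule_format, of n 0] xmax_le[OF fin, of I n] by auto
        with elim show ?case
          by (cases "xmax I n s") (auto simp: F_def)
      qed
    qed
  next
    fix r assume "ereal G < ereal r"
    then have "slope_le I ((G + r) / 2)" "(G + r) / 2 < r"
      by (auto intro: slope)
    then show "AE s in S. \<forall>\<^sub>F n in sequentially. xmax I n s \<le> ereal (r * real n)"
      by (rule slope_le_eventually)
  qed
  with slope show ?thesis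
    by (intro exI[of _ "ereal G"]) auto
qed

definition exponent :: "'n set \<Rightarrow> ereal" where
  "exponent I = (THE \<gamma>. AE s in S. (\<lambda>n. xmax I n s / ereal (real n)) \<longlonglongrightarrow> \<gamma>)"

lemma exponent_properties:
  assumes "I \<noteq> {}"
  shows "exponent I \<noteq> \<infinity>"
    and "AE s in S. (\<lambda>n. xmax I n s / ereal (real n)) \<longlonglongrightarrow> exponent I"
    and "\<And>c. exponent I < ereal c \<Longrightarrow> slope_le I c"
proof -
  obtain \<gamma> where \<gamma>: "\<gamma> \<noteq> \<infinity>" "AE s in S. (\<lambda>n. xmax I n s / ereal (real n)) \<longlonglongrightarrow> \<gamma>"
    "\<And>c. \<gamma> < ereal c \<Longrightarrow> slope_le I c"
    using lyapunov_limit_exists[OF assms] by blast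
  have "exponent I = \<gamma>"
    unfolding exponent_def
  proof (rule the_equality)
    fix x assume "AE s in S. (\<lambda>n. xmax I n s / ereal (real n)) \<longlonglongrightarrow> x"
    from P.AE_LIMSEQ_unique[OF this \<gamma>(2)] show "x = \<gamma>" .
  qed (rule \<gamma>(2))
  with \<gamma> show "exponent I \<noteq> \<infinity>"
    "AE s in S. (\<lambda>n. xmax I n s / ereal (real n)) \<longlonglongrightarrow> exponent I"
    "\<And>c. exponent I < ereal c \<Longrightarrow> slope_le I c"
    by simp_all
qed

end

section \<open>Upper bound on the orbit\<close>

definition scc :: "'n rel \<Rightarrow> 'n \<Rightarrow> 'n set" where
  "scc R i = {j. (i, j) \<in> R\<^sup>* \<and> (j, i) \<in> R\<^sup>*}"

lemma scc_self: "i \<in> scc R i"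
  by (simp add: scc_def)

lemma scc_nonempty: "scc R i \<noteq> {}"
  using scc_self[of i R] by blast

lemma scc_eq: "j \<in> scc R i \<Longrightarrow> scc R j = scc R i"
  unfolding scc_def using rtrancl_trans by fast

lemma scc_classes_eq: "scc_classes R = range (scc R)"
  by (auto simp: scc_classes_def quotient_def scc_def)

text \<open>The separate case of equal components covers a node without loop, which has no path of
  positive length to itself; reflexive reachability of representatives treats both cases
  alike.\<close>

lemma leads_to_scc: "leads_to R (scc R i) (scc R j) \<longleftrightarrow> (i, j) \<in> R\<^sup>*"
proof
  assume "leads_to R (scc R i) (scc R j)"
  then consider "scc R i = scc R j" | i' j' where "i' \<in> scc R i" "j' \<in> scc R j" "(i', j') \<in> R\<^sup>+"
    by (auto simp: leads_to_def)
  then show "(i, j) \<in> R\<^sup>*"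
  proof cases
    case 1
    then have "j \<in> scc R i"
      using scc_self[of j R] by simp
    then show ?thesis
      by (simp add: scc_def)
  next
    case 2
    then have "(i, i') \<in> R\<^sup>*" "(i', j') \<in> R\<^sup>*" "(j', j) \<in> R\<^sup>*"
      by (auto simp: scc_def)
    then show ?thesis
      by (meson rtrancl_trans)
  qed
next
  assume "(i, j) \<in> R\<^sup>*"
  then have "i = j \<or> (i, j) \<in> R\<^sup>+"
    by (auto simp: rtrancl_eq_or_trancl)
  then show "leads_to R (scc R i) (scc R j)"
    unfolding leads_to_def using scc_self by metis
qed

text \<open>Follow an optimal path from \<open>i\<close>, which reads the matrices from time
  \<open>n - 1\<close> downwards. Either it stays in \<open>I\<close>, or it first leaves
  \<open>I\<close> by an arc at some time \<open>k\<close>, after a stretch in \<open>I\<close> over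
  the times \<open>k + 1\<close> to \<open>n - 1\<close>; then \<open>d k\<close> bounds what
  remains.\<close>

lemma xvec_block_decomposition:
  assumes fin: "\<forall>k i j. s k i j \<noteq> \<infinity>"
    and outside: "\<And>k i j. i \<in> I \<Longrightarrow> j \<notin> I \<Longrightarrow> s k i j \<noteq> -\<infinity> \<Longrightarrow> xvec UNIV k s j \<le> ereal (d k)"
  shows "i \<in> I \<Longrightarrow> xvec UNIV n s i \<le> xvec I n s i
    \<or> (\<exists>k<n. xvec UNIV n s i \<le> xvec I (n - Suc k) (shift_seq (Suc k) s) i + ereal (entry_bound (s k) + d k))"
proof (induction n arbitrary: i)
  case (Suc n)
  obtain j where j: "xvec UNIV (Suc n) s i = s n i j + xvec UNIV n s j"
    using SUP_finite_attained[OF finite, of UNIV "\<lambda>j. s n i j + xvec UNIV n s j"]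
    by (auto simp: mp_mult_vec_def)
  show ?case
  proof (cases "j \<in> I")
    case True
    from Suc.IH[OF True] show ?thesis
    proof (elim disjE exE conjE)
      assume "xvec UNIV n s j \<le> xvec I n s j"
      then have "xvec UNIV (Suc n) s i \<le> s n i j + xvec I n s j"
        unfolding j by (rule add_left_mono)
      also have "\<dots> \<le> xvec I (Suc n) s i"
        using mp_mult_vec_upper[OF True] by simp
      finally show ?thesis ..
    next
      fix k assume k: "k < n"
        "xvec UNIV n s j \<le> xvec I (n - Suc k) (shift_seq (Suc k) s) j + ereal (entry_bound (s k) + d k)"
      have "xvec UNIV (Suc n) s i
          \<le> (s n i j + xvec I (n - Suc k) (shift_seq (Suc k) s) j) + ereal (entry_bound (s k) + d k)"
        unfolding j using add_left_mono[OF k(2), of "s n i j"] by (simp add: add.assoc)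
      also have "s n i j = shift_seq (Suc k) s (n - Suc k) i j"
        using k(1) by (simp add: shift_seq_def)
      also have "\<dots> + xvec I (n - Suc k) (shift_seq (Suc k) s) j
          \<le> xvec I (Suc (n - Suc k)) (shift_seq (Suc k) s) i"
        using mp_mult_vec_upper[OF True] by simp
      also have "Suc (n - Suc k) = Suc n - Suc k"
        using k(1) by simp
      finally show ?thesis
        using k(1) by (intro disjI2 exI[of _ k]) (simp add: add_right_mono)
    qed
  next
    case False
    show ?thesis
    proof (cases "s n i j = -\<infinity>")
      case True
      then have "xvec UNIV (Suc n) s i = -\<infinity>"
        unfolding j using xvec_le[OF fin, of UNIV n j] by (cases "xvec UNIV n s j") auto
      then show ?thesis by simp
    next
      case notbot: False
      have "xvec UNIV (Suc n) s i \<le> ereal (entry_bound (s n)) + ereal (d n)"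
        unfolding j using fin by (intro add_mono entry_le outside[OF Suc.prems False notbot]) auto
      then show ?thesis
        by (intro disjI2 exI[of _ n]) simp
    qed
  qed
qed simp

context mp_iid
begin

definition arcs :: "'n rel" where
  "arcs = {(i, j). 0 < measure M {a \<in> space M. a i j \<noteq> -\<infinity>}}"

lemma AE_arcs: "AE s in S. \<forall>k i j. s k i j \<noteq> -\<infinity> \<longrightarrow> (i, j) \<in> arcs"
proof (rule AE_component_all)
  have "AE a in M. a i j \<noteq> -\<infinity> \<longrightarrow> (i, j) \<in> arcs" for i j
  proof (cases "(i, j) \<in> arcs")
    case False
    let ?D = "{a \<in> space M. a i j \<noteq> -\<infinity>}"
    have "?D \<in> null_sets M"
      using False by (simp add: arcs_def null_sets_def M.emeasure_eq_measure order_antisym not_less)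
    from AE_not_in[OF this] AE_space show ?thesis
      by eventually_elim auto
  qed simp
  then show "AE a in M. \<forall>i j. a i j \<noteq> -\<infinity> \<longrightarrow> (i, j) \<in> arcs"
    by (simp add: AE_all_countable)
qed

text \<open>The exponent \<gamma> of the index \<open>[m]\<close>, \<open>m\<close> being the
  component of \<open>i\<close>, expressed through reachable nodes.\<close>

definition top_exponent :: "'n \<Rightarrow> ereal" where
  "top_exponent i = Max (exponent ` scc arcs ` (arcs\<^sup>* `` {i}))"

lemma exponent_le_top: "(i, j) \<in> arcs\<^sup>* \<Longrightarrow> exponent (scc arcs j) \<le> top_exponent i"
  unfolding top_exponent_def by (rule Max_ge) auto

lemma top_exponent_attained: "\<exists>j. (i, j) \<in> arcs\<^sup>* \<and> exponent (scc arcs j) = top_exponent i"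
proof -
  have "top_exponent i \<in> exponent ` scc arcs ` (arcs\<^sup>* `` {i})"
    unfolding top_exponent_def by (rule Max_in) auto
  then show ?thesis by auto
qed

lemma top_exponent_mono: "(i, j) \<in> arcs\<^sup>* \<Longrightarrow> top_exponent j \<le> top_exponent i"
  using top_exponent_attained[of j] exponent_le_top by (metis rtrancl_trans)

lemma top_exponent_not_infinity: "top_exponent i \<noteq> \<infinity>"
proof -
  obtain j where "exponent (scc arcs j) = top_exponent i"
    using top_exponent_attained by blast
  then show ?thesis
    using exponent_properties(1)[OF scc_nonempty[of arcs j]] by simp
qed

text \<open>A path leaving the component of \<open>i\<close> can never return, so the node it enters
  has a strictly smaller reachable set and falls under the induction hypothesis. The time of leaving
  is arbitrary, which is why the slope inside the component is needed for all windows at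
  once.\<close>

lemma AE_xvec_le:
  "top_exponent i < ereal c \<Longrightarrow> AE s in S. \<exists>C. \<forall>n. xvec UNIV n s i \<le> ereal (c * real n + C)"
proof (induction "card (arcs\<^sup>* `` {i})" arbitrary: i c rule: less_induct)
  case less
  obtain c' where c': "top_exponent i < ereal c'" "c' < c"
    using less.prems ereal_dense2 by force
  \<comment> \<open>One \<open>e\<close> pays for the window inside the component, the other for the
    arc that leaves it.\<close>
  define e where "e = (c - c') / 2"
  have "e > 0"
    using c' by (simp add: e_def)
  let ?I = "scc arcs i"
  define D where "D = arcs\<^sup>* `` {i} - ?I"
  have I: "?I \<noteq> {}"
    by (rule scc_nonempty)
  have "AE s in S. \<exists>C. \<forall>n. xvec UNIV n s j \<le> ereal (c' * real n + C)" if "j \<in> D" for j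
  proof (rule less.hyps)
    have j: "(i, j) \<in> arcs\<^sup>*" "(j, i) \<notin> arcs\<^sup>*"
      using that by (auto simp: D_def scc_def)
    show "card (arcs\<^sup>* `` {j}) < card (arcs\<^sup>* `` {i})"
    proof (rule psubset_card_mono)
      have "arcs\<^sup>* `` {j} \<subseteq> arcs\<^sup>* `` {i}"
        using j(1) by (auto intro: rtrancl_trans)
      moreover have "i \<notin> arcs\<^sup>* `` {j}" "i \<in> arcs\<^sup>* `` {i}"
        using j(2) by auto
      ultimately show "arcs\<^sup>* `` {j} \<subset> arcs\<^sup>* `` {i}"
        by blast
    qed simp
    show "top_exponent j < ereal c'"
      using top_exponent_mono[OF j(1)] c'(1) by (rule le_less_trans)
  qed
  then have D: "AE s in S. \<forall>j\<in>D. \<exists>C. \<forall>n. xvec UNIV n s j \<le> ereal (c' * real n + C)"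
    by (simp add: AE_finite_all)
  have "exponent ?I < ereal c'"
    using exponent_le_top[of i i] c'(1) by auto
  then have slope: "slope_le ?I c'"
    by (rule exponent_properties(3)[OF I])
  show ?case
    using D slope[unfolded slope_le_def] AE_entry_le AE_arcs AE_seq_not_infinity
  proof eventually_elim
    case (elim s)
    obtain f where f: "\<And>j n. j \<in> D \<Longrightarrow> xvec UNIV n s j \<le> ereal (c' * real n + f j)"
      using elim(1) by metis
    define K1 where "K1 = (\<Sum>j\<in>D. \<bar>f j\<bar>)"
    have K1: "xvec UNIV n s j \<le> ereal (c' * real n + K1)" if "j \<in> D" for j n
    proof -
      have "f j \<le> \<bar>f j\<bar>"
        by simp
      also have "\<dots> \<le> K1"
        unfolding K1_def using that by (intro member_le_sum) auto
      finally have "ereal (c' * real n + f j) \<le> ereal (c' * real n + K1)"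
        by simp
      with f[OF that] show ?thesis
        by (rule order_trans)
    qed
    obtain K2 where K2: "\<And>a n. xmax ?I n (shift_seq a s) \<le> ereal (c' * real n + e * real (a + n) + K2)"
      using elim(2) \<open>e > 0\<close> by blast
    obtain K3 where K3: "\<And>k. entry_bound (s k) \<le> e * real k + K3"
      using elim(3) \<open>e > 0\<close> by blast
    have block: "xvec ?I n (shift_seq a s) i \<le> ereal (c' * real n + e * real (a + n) + K2)" for a n
      using xvec_le_xmax[OF scc_self] K2 by (rule order_trans)
    have outside: "xvec UNIV k s j \<le> ereal (c' * real k + K1)"
      if "i' \<in> ?I" "j \<notin> ?I" "s k i' j \<noteq> -\<infinity>" for k i' j
    proof (rule K1)
      have "(i, i') \<in> arcs\<^sup>*" "(i', j) \<in> arcs"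
        using that elim(4) by (auto simp: scc_def)
      then show "j \<in> D"
        using that by (auto simp: D_def)
    qed
    \<comment> \<open>The term with \<open>c'\<close> appears because the leaving arc takes up one
      time step: the two remaining stretches have total length \<open>n - 1\<close>.\<close>
    define K where "K = \<bar>K1\<bar> + \<bar>K2\<bar> + \<bar>K3\<bar> + \<bar>c'\<bar>"
    have decomp: "xvec UNIV n s i \<le> xvec ?I n s i \<or> (\<exists>k<n. xvec UNIV n s i
        \<le> xvec ?I (n - Suc k) (shift_seq (Suc k) s) i + ereal (entry_bound (s k) + (c' * real k + K1)))" for n
      by (rule xvec_block_decomposition[OF elim(5) _ scc_self]) (rule outside)
    have "xvec UNIV n s i \<le> ereal (c * real n + K)" for n
      using decomp[of n]
    proof (elim disjE exE conjE)
      assume "xvec UNIV n s i \<le> xvec ?I n s i"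
      also have "\<dots> \<le> ereal (c' * real n + e * real n + K2)"
        using block[of n 0] by simp
      also have "c' * real n + e * real n + K2 \<le> c * real n + K"
      proof -
        have "c = c' + e + e"
          by (simp add: e_def)
        then have "c * real n = c' * real n + e * real n + e * real n"
          by (simp add: ring_distribs)
        moreover have "0 \<le> e * real n"
          using \<open>e > 0\<close> by simp
        ultimately show ?thesis
          by (simp add: K_def)
      qed
      finally show ?thesis by simp
    next
      fix k assume "k < n" and
        "xvec UNIV n s i \<le> xvec ?I (n - Suc k) (shift_seq (Suc k) s) i + ereal (entry_bound (s k) + (c' * real k + K1))"
      note this(2)
      also have "\<dots> \<le> ereal (c' * real (n - Suc k) + e * real (Suc k + (n - Suc k)) + K2)
          + ereal ((e * real k + K3) + (c' * real k + K1))"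
        using K3[of k] by (intro add_mono block) simp
      also have "\<dots> = ereal ((c' * real (n - Suc k) + e * real (Suc k + (n - Suc k)) + K2)
          + ((e * real k + K3) + (c' * real k + K1)))"
        by simp
      also have "(c' * real (n - Suc k) + e * real (Suc k + (n - Suc k)) + K2)
          + ((e * real k + K3) + (c' * real k + K1)) \<le> c * real n + K"
      proof -
        have "c = c' + e + e"
          by (simp add: e_def)
        then have "c * real n = c' * real n + e * real n + e * real n"
          by (simp add: ring_distribs)
        moreover have "e * real k \<le> e * real n"
          using \<open>e > 0\<close> \<open>k < n\<close> by simp
        moreover have "c' * real (n - Suc k) + c' * real k = c' * real n - c'"
          using \<open>k < n\<close> by (simp add: of_nat_diff algebra_simps)
        moreover have "Suc k + (n - Suc k) = n"
          using \<open>k < n\<close> by simp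
        ultimately show ?thesis
          by (simp add: K_def)
      qed
      finally show ?thesis by simp
    qed
    then show ?case by blast
  qed
qed

end

section \<open>Lower bound on the orbit\<close>

context mp_iid
begin

lemma measure_yvec_eq_xvec:
  "measure S {s \<in> space S. c \<le> yvec I n s i} = measure S {s \<in> space S. c \<le> xvec I n s i}"
proof -
  have "measure S {s \<in> space S. c \<le> xvec I n s i}
      = measure (distr S S (reverse_prefix n)) {s \<in> space S. c \<le> xvec I n s i}"
    by (simp only: distr_reverse_prefix)
  also have "\<dots> = measure S (reverse_prefix n -` {s \<in> space S. c \<le> xvec I n s i} \<inter> space S)"
    by (rule measure_distr) measurable
  also have "reverse_prefix n -` {s \<in> space S. c \<le> xvec I n s i} \<inter> space S = {s \<in> space S. c \<le> yvec I n s i}"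
    using measurable_space[OF measurable_reverse_prefix] by (auto simp: yvec_eq_xvec)
  finally show ?thesis ..
qed

text \<open>Probabilities at single times are used since these survive reversal;
  \<open>prob_limsup_ge\<close> then gives an infinitely-often event for \<open>yvec\<close> and for
  \<open>xvec\<close> alike.\<close>

definition slope_possible :: "'n set \<Rightarrow> 'n \<Rightarrow> real \<Rightarrow> bool" where
  "slope_possible I i u \<longleftrightarrow>
    (\<exists>d>0. \<exists>\<^sub>\<infinity>n. d \<le> measure S {s \<in> space S. ereal (u * real n) \<le> yvec I n s i})"

lemma slope_possible_frequently:
  assumes "slope_possible I i u"
  shows "0 < measure S {s \<in> space S. \<exists>\<^sub>\<infinity>n. ereal (u * real n) \<le> yvec I n s i}"
    and "0 < measure S {s \<in> space S. \<exists>\<^sub>\<infinity>n. ereal (u * real n) \<le> xvec I n s i}"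
proof -
  obtain d where d: "d > 0"
    "\<exists>\<^sub>\<infinity>n. d \<le> measure S {s \<in> space S. ereal (u * real n) \<le> yvec I n s i}"
    using assms by (auto simp: slope_possible_def)
  have "d \<le> measure S {s \<in> space S. \<exists>\<^sub>\<infinity>n. ereal (u * real n) \<le> yvec I n s i}"
    by (rule prob_limsup_ge[OF _ d(2)]) measurable
  moreover have "d \<le> measure S {s \<in> space S. \<exists>\<^sub>\<infinity>n. ereal (u * real n) \<le> xvec I n s i}"
    by (rule prob_limsup_ge[OF _ d(2)[unfolded measure_yvec_eq_xvec]]) measurable
  ultimately show "0 < measure S {s \<in> space S. \<exists>\<^sub>\<infinity>n. ereal (u * real n) \<le> yvec I n s i}"
    "0 < measure S {s \<in> space S. \<exists>\<^sub>\<infinity>n. ereal (u * real n) \<le> xvec I n s i}"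
    using d(1) by linarith+
qed

lemma slope_possible_mono:
  assumes "slope_possible I i u" "I \<subseteq> I'"
  shows "slope_possible I' i u"
proof -
  obtain d where d: "d > 0"
    "\<exists>\<^sub>\<infinity>n. d \<le> measure S {s \<in> space S. ereal (u * real n) \<le> xvec I n s i}"
    using assms(1) by (auto simp: slope_possible_def measure_yvec_eq_xvec)
  have "measure S {s \<in> space S. ereal (u * real n) \<le> xvec I n s i}
      \<le> measure S {s \<in> space S. ereal (u * real n) \<le> xvec I' n s i}" for n
    by (rule P.finite_measure_mono) (auto intro: order_trans xvec_mono[OF assms(2)])
  with d show ?thesis
    unfolding slope_possible_def measure_yvec_eq_xvec
    by (auto elim!: INFM_mono intro: order_trans intro!: exI[of _ d])
qed

text \<open>A union bound: were every node of \<open>I\<close> eventually above slope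
  \<open>u\<close> with probability below \<open>1 / (2 card I)\<close>, the maximum over
  \<open>I\<close> would stay below it with probability at least 1/2 at all large times, against
  almost sure convergence to a larger exponent.\<close>

lemma slope_possible_of_exponent:
  assumes I: "I \<noteq> {}" and less: "ereal u < exponent I"
  shows "\<exists>i\<in>I. slope_possible I i u"
proof (rule ccontr)
  define d where "d = 1 / (2 * real (card I))"
  have card: "card I > 0"
    using I by (simp add: card_gt_0_iff)
  then have "d > 0"
    by (simp add: d_def)
  assume "\<not> ?thesis"
  then have "\<forall>i\<in>I. \<forall>\<^sub>F n in sequentially. measure S {s \<in> space S. ereal (u * real n) \<le> xvec I n s i} < d"
    using \<open>d > 0\<close>
    by (auto simp: slope_possible_def measure_yvec_eq_xvec frequently_def cofinite_eq_sequentially not_le)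
  then have "\<forall>\<^sub>F n in sequentially. \<forall>i\<in>I. measure S {s \<in> space S. ereal (u * real n) \<le> xvec I n s i} < d"
    by (simp add: eventually_ball_finite)
  then have "\<forall>\<^sub>F n in sequentially. 1 / 2 \<le> measure S {s \<in> space S. \<not> ereal (u * real n) \<le> xmax I n s}"
  proof eventually_elim
    case (elim n)
    let ?A = "{s \<in> space S. ereal (u * real n) \<le> xmax I n s}"
    have "?A \<subseteq> (\<Union>i\<in>I. {s \<in> space S. ereal (u * real n) \<le> xvec I n s i})"
    proof
      fix s assume s: "s \<in> ?A"
      obtain i where "i \<in> I" "xmax I n s = xvec I n s i"
        unfolding xmax_def using SUP_finite_attained[OF finite I, of "xvec I n s"] by blast
      with s show "s \<in> (\<Union>i\<in>I. {s \<in> space S. ereal (u * real n) \<le> xvec I n s i})"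
        by auto
    qed
    then have "measure S ?A \<le> measure S (\<Union>i\<in>I. {s \<in> space S. ereal (u * real n) \<le> xvec I n s i})"
      by (intro P.finite_measure_mono) auto
    also have "\<dots> \<le> (\<Sum>i\<in>I. measure S {s \<in> space S. ereal (u * real n) \<le> xvec I n s i})"
      by (intro P.finite_measure_subadditive_finite) auto
    also have "\<dots> \<le> (\<Sum>i\<in>I. d)"
      using elim by (intro sum_mono) auto
    also have "\<dots> = 1 / 2"
      using card I by (simp add: d_def)
    finally have "measure S ?A \<le> 1 / 2" .
    moreover have "measure S {s \<in> space S. \<not> ereal (u * real n) \<le> xmax I n s} = 1 - measure S ?A"
      by (rule P.prob_neg) measurable
    ultimately show ?case by simp
  qed
  then have "\<exists>\<^sub>\<infinity>n. 1 / 2 \<le> measure S {s \<in> space S. \<not> ereal (u * real n) \<le> xmax I n s}"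
    by (simp add: cofinite_eq_sequentially eventually_frequently)
  from prob_limsup_ge[OF _ this]
  have half: "1 / 2 \<le> measure S {s \<in> space S. \<exists>\<^sub>\<infinity>n. \<not> ereal (u * real n) \<le> xmax I n s}"
    by measurable
  have "AE s in S. \<not> (\<exists>\<^sub>\<infinity>n. \<not> ereal (u * real n) \<le> xmax I n s)"
    using exponent_properties(2)[OF I]
  proof eventually_elim
    case (elim s)
    have "\<forall>\<^sub>F n in sequentially. ereal u < xmax I n s / ereal (real n)"
      using elim less by (rule order_tendstoD)
    then have "\<forall>\<^sub>F n in sequentially. ereal (u * real n) \<le> xmax I n s"
      using eventually_gt_at_top[of 0]
    proof eventually_elim
      case (elim n)
      then have "ereal u \<le> xmax I n s / ereal (real n)"
        by simp
      then show ?case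
        using elim(2) by (subst (asm) ereal_le_divide_pos) (auto simp: mult.commute)
    qed
    then show ?case
      by (simp add: frequently_def cofinite_eq_sequentially)
  qed
  moreover have "{s \<in> space S. \<exists>\<^sub>\<infinity>n. \<not> ereal (u * real n) \<le> xmax I n s} \<in> sets S"
    unfolding INFM_nat by measurable
  ultimately have "measure S {s \<in> space S. \<exists>\<^sub>\<infinity>n. \<not> ereal (u * real n) \<le> xmax I n s} = 0"
    by (subst P.prob_eq_0) (auto elim!: eventually_mono)
  with half show False by simp
qed

text \<open>Prepend the arc. For some \<open>k\<close> its weight is at least \<open>- k\<close>
  with positive probability, independently of the later matrices, and the slack
  \<open>u - u'\<close> pays for \<open>k\<close> when \<open>n\<close> is large.\<close>

lemma slope_possible_step:
  assumes arc: "(i, j) \<in> arcs" and "j \<in> I" and poss: "slope_possible I j u" and "u' < u"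
  shows "slope_possible I i u'"
proof -
  obtain d where d: "d > 0"
    "\<exists>\<^sub>\<infinity>n. d \<le> measure S {s \<in> space S. ereal (u * real n) \<le> yvec I n s j}"
    using poss by (auto simp: slope_possible_def)
  define A where "A k = {a \<in> space M. ereal (- real k) \<le> a i j}" for k :: nat
  have [measurable]: "A k \<in> sets M" for k
    unfolding A_def by measurable
  have "incseq A"
    unfolding incseq_def A_def
  proof (intro allI impI subsetI)
    fix m n :: nat and a assume "m \<le> n" and a: "a \<in> {a \<in> space M. ereal (- real m) \<le> a i j}"
    then have le: "ereal (- real n) \<le> ereal (- real m)"
      by simp
    from a show "a \<in> {a \<in> space M. ereal (- real n) \<le> a i j}"
      by (auto intro: order_trans[OF le])
  qed
  then have "(\<lambda>k. measure M (A k)) \<longlonglongrightarrow> measure M (\<Union>k. A k)"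
    by (intro M.finite_Lim_measure_incseq) auto
  also have "(\<Union>k. A k) = {a \<in> space M. a i j \<noteq> -\<infinity>}"
  proof -
    have "\<exists>k. ereal (- real k) \<le> x" if "x \<noteq> -\<infinity>" for x
    proof (cases x)
      case (real r)
      obtain k :: nat where "- r \<le> real k"
        using real_arch_simple by blast
      with real show ?thesis by (intro exI[of _ k]) simp
    qed (use that in auto)
    then show ?thesis by (auto simp: A_def)
  qed
  finally have "\<forall>\<^sub>F k in sequentially. 0 < measure M (A k)"
    using arc by (intro order_tendstoD(1)) (auto simp: arcs_def)
  then obtain k where k: "0 < measure M (A k)"
    by (auto simp: eventually_sequentially)
  have "measure S {s \<in> space S. s 0 \<in> A k} = measure M (A k)"
  proof -
    have "measure M (A k) = measure (distr S M (\<lambda>s. s 0)) (A k)"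
      by (simp only: distr_component)
    also have "\<dots> = measure S ((\<lambda>s. s 0) -` A k \<inter> space S)"
      by (rule measure_distr) auto
    also have "(\<lambda>s. s 0) -` A k \<inter> space S = {s \<in> space S. s 0 \<in> A k}"
      by auto
    finally show ?thesis ..
  qed
  then have prod: "measure S {s \<in> space S. s 0 \<in> A k \<and> ereal (u * real n) \<le> yvec I n (shift_seq 1 s) j}
      = measure M (A k) * measure S {s \<in> space S. ereal (u * real n) \<le> yvec I n s j}" for n
    by (subst measure_prefix_shift) (auto simp: comb_seq_def)
  \<comment> \<open>The extra \<open>u'\<close> accounts for the path of length
    \<open>n + 1\<close>.\<close>
  have ev: "\<forall>\<^sub>F n in sequentially. u' * real n + (u' + real k) \<le> u * real n"
    by (rule eventually_linear_le[OF \<open>u' < u\<close>])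
  have "\<exists>\<^sub>\<infinity>n. d \<le> measure S {s \<in> space S. ereal (u * real n) \<le> yvec I n s j} \<and> u' * real n + (u' + real k) \<le> u * real n"
    using INFM_conjI[OF d(2) ev[folded cofinite_eq_sequentially]] by simp
  then have "\<exists>\<^sub>\<infinity>n. measure M (A k) * d \<le> measure S {s \<in> space S. ereal (u' * real (Suc n)) \<le> yvec I (Suc n) s i}"
  proof (rule INFM_mono)
    fix n assume n: "d \<le> measure S {s \<in> space S. ereal (u * real n) \<le> yvec I n s j} \<and> u' * real n + (u' + real k) \<le> u * real n"
    have "measure M (A k) * d \<le> measure S {s \<in> space S. s 0 \<in> A k \<and> ereal (u * real n) \<le> yvec I n (shift_seq 1 s) j}"
      unfolding prod using n k by (intro mult_left_mono) auto
    also have "\<dots> \<le> measure S {s \<in> space S. ereal (u' * real (Suc n)) \<le> yvec I (Suc n) s i}"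
    proof (rule P.finite_measure_mono)
      show "{s \<in> space S. s 0 \<in> A k \<and> ereal (u * real n) \<le> yvec I n (shift_seq 1 s) j}
          \<subseteq> {s \<in> space S. ereal (u' * real (Suc n)) \<le> yvec I (Suc n) s i}"
      proof safe
        fix s assume s: "s 0 \<in> A k" "ereal (u * real n) \<le> yvec I n (shift_seq 1 s) j"
        have "ereal (u' * real (Suc n)) \<le> ereal (- real k) + ereal (u * real n)"
          using n by (simp add: algebra_simps)
        also have "\<dots> \<le> s 0 i j + yvec I n (shift_seq 1 s) j"
          using s by (intro add_mono) (auto simp: A_def)
        also have "\<dots> \<le> yvec I (Suc n) s i"
          using mp_mult_vec_upper[OF \<open>j \<in> I\<close>] by simp
        finally show "ereal (u' * real (Suc n)) \<le> yvec I (Suc n) s i" .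
      qed
    qed measurable
    finally show "measure M (A k) * d \<le> measure S {s \<in> space S. ereal (u' * real (Suc n)) \<le> yvec I (Suc n) s i}" .
  qed
  then have "\<exists>\<^sub>\<infinity>n. measure M (A k) * d \<le> measure S {s \<in> space S. ereal (u' * real n) \<le> yvec I n s i}"
    unfolding INFM_nat
  proof (intro allI)
    fix m
    assume "\<forall>m. \<exists>n>m. measure M (A k) * d \<le> measure S {s \<in> space S. ereal (u' * real (Suc n)) \<le> yvec I (Suc n) s i}"
    then obtain n where "n > m"
      "measure M (A k) * d \<le> measure S {s \<in> space S. ereal (u' * real (Suc n)) \<le> yvec I (Suc n) s i}"
      by blast
    then show "\<exists>n>m. measure M (A k) * d \<le> measure S {s \<in> space S. ereal (u' * real n) \<le> yvec I n s i}"
      by (intro exI[of _ "Suc n"]) simp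
  qed
  then show ?thesis
    unfolding slope_possible_def using k d(1) by (intro exI[of _ "measure M (A k) * d"]) auto
qed

definition top_nodes :: "'n \<Rightarrow> 'n set" where
  "top_nodes i = {j. (i, j) \<in> arcs\<^sup>* \<and> (\<exists>k. (j, k) \<in> arcs\<^sup>* \<and> exponent (scc arcs k) = top_exponent i)}"

text \<open>Slope is available at some node \<open>j\<close> of a component attaining the top
  exponent; it is carried back along a path from \<open>i\<close> to \<open>j\<close>. Every node of
  that path is again in \<open>top_nodes\<close>, so the restriction to this set costs
  nothing.\<close>

lemma slope_possible_top_nodes:
  assumes "i \<in> top_nodes i0" "ereal u < top_exponent i0"
  shows "slope_possible (top_nodes i0) i u"
proof -
  let ?H = "top_nodes i0"
  obtain k where ik: "(i0, i) \<in> arcs\<^sup>*" "(i, k) \<in> arcs\<^sup>*" and k: "exponent (scc arcs k) = top_exponent i0"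
    using assms(1) by (auto simp: top_nodes_def)
  have scc_sub: "scc arcs k \<subseteq> ?H"
  proof
    fix j assume j: "j \<in> scc arcs k"
    then have "(i0, j) \<in> arcs\<^sup>*"
      using ik unfolding scc_def by (auto intro: rtrancl_trans)
    then show "j \<in> ?H"
      using scc_eq[OF j] k by (auto simp: top_nodes_def)
  qed
  obtain u1 where u1: "u < u1" "ereal u1 < top_exponent i0"
    using assms(2) ereal_dense2 by force
  obtain j where j: "j \<in> scc arcs k" "slope_possible (scc arcs k) j u1"
    using slope_possible_of_exponent[OF scc_nonempty] u1(2) k by metis
  have poss: "slope_possible ?H j u1"
    by (rule slope_possible_mono[OF j(2) scc_sub])
  have "exponent (scc arcs j) = top_exponent i0"
    using scc_eq[OF j(1)] k by simp
  then have H: "b \<in> ?H" if "(i0, b) \<in> arcs\<^sup>*" "(b, j) \<in> arcs\<^sup>*" for b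
    using that by (auto simp: top_nodes_def)
  have "(i, j) \<in> arcs\<^sup>*"
    using ik(2) j(1) by (auto simp: scc_def)
  \<comment> \<open>Each arc costs some slope, hence the claim for all slopes below
    \<open>u1\<close>. The end \<open>j\<close> is a separate disjunct, settled afterwards by
    monotonicity in the slope.\<close>
  then have "(i0, i) \<in> arcs\<^sup>* \<longrightarrow> (\<forall>u<u1. slope_possible ?H i u) \<or> i = j"
  proof (induction rule: converse_rtrancl_induct)
    case (step a b)
    show ?case
    proof (intro impI disjI1 allI)
      fix u assume a: "(i0, a) \<in> arcs\<^sup>*" and "u < u1"
      then obtain u2 where u2: "u < u2" "u2 < u1"
        using dense by blast
      have b: "(i0, b) \<in> arcs\<^sup>*"
        using a step.hyps(1) by simp
      show "slope_possible ?H a u"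
      proof (cases "b = j")
        case True
        then show ?thesis
          using slope_possible_step[OF step.hyps(1) H[OF b step.hyps(2)] _ \<open>u < u1\<close>] poss by simp
      next
        case False
        then show ?thesis
          using slope_possible_step[OF step.hyps(1) H[OF b step.hyps(2)] _ u2(1)] step.IH b u2(2) by simp
      qed
    qed
  qed simp
  moreover have "slope_possible ?H j u"
  proof -
    obtain d where "d > 0" "\<exists>\<^sub>\<infinity>n. d \<le> measure S {s \<in> space S. ereal (u1 * real n) \<le> yvec ?H n s j}"
      using poss by (auto simp: slope_possible_def)
    moreover have "measure S {s \<in> space S. ereal (u1 * real n) \<le> yvec ?H n s j}
        \<le> measure S {s \<in> space S. ereal (u * real n) \<le> yvec ?H n s j}" for n
    proof (rule P.finite_measure_mono)
      have le: "ereal (u * real n) \<le> ereal (u1 * real n)"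
        using u1(1) by (simp add: mult_right_mono)
      show "{s \<in> space S. ereal (u1 * real n) \<le> yvec ?H n s j} \<subseteq> {s \<in> space S. ereal (u * real n) \<le> yvec ?H n s j}"
        by (auto intro: order_trans[OF le])
    qed measurable
    ultimately show ?thesis
      unfolding slope_possible_def
      by (auto elim!: INFM_mono intro: order_trans intro!: exI[of _ d])
  qed
  ultimately show ?thesis
    using ik(1) u1(1) by auto
qed

end

text \<open>Without lines of \<open>-\<infinity>\<close> inside \<open>I\<close> all coordinates are
  finite, so the default value of \<open>real_of_ereal\<close> never enters and the real block
  minima are true lower bounds.\<close>

lemma xvec_ge_block_sum:
  assumes fin: "\<forall>k i j. s k i j \<noteq> \<infinity>" and live: "\<forall>k. \<forall>i\<in>I. \<exists>j\<in>I. s k i j \<noteq> -\<infinity>"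
  shows "i \<in> I \<Longrightarrow> ereal (\<Sum>k<q. MIN i\<in>I. real_of_ereal (xvec I N (shift_seq (k * N) s) i)) \<le> xvec I (q * N) s i"
proof (induction q arbitrary: i)
  case (Suc q)
  let ?g = "\<lambda>s. MIN i\<in>I. real_of_ereal (xvec I N s i)"
  let ?t = "shift_seq (q * N) s"
  have t: "\<forall>k i j. ?t k i j \<noteq> \<infinity>" "\<forall>k. \<forall>i\<in>I. \<exists>j\<in>I. ?t k i j \<noteq> -\<infinity>"
    using fin live by (simp_all add: shift_seq_def)
  have "\<bar>xvec I N ?t i\<bar> \<noteq> \<infinity>"
    using xvec_no_line[OF t Suc.prems, of N] xvec_le[OF t(1), of I N i] by auto
  then have "ereal (?g ?t) \<le> xvec I N ?t i"
    using Suc.prems by (cases "xvec I N ?t i") (auto intro!: Min_le image_eqI[of _ _ i])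
  moreover have "ereal (\<Sum>k<q. ?g (shift_seq (k * N) s)) \<le> (INF j\<in>I. xvec I (q * N) s j)"
    by (intro INF_greatest Suc.IH)
  ultimately have "ereal (?g ?t) + ereal (\<Sum>k<q. ?g (shift_seq (k * N) s))
      \<le> xvec I N ?t i + (INF j\<in>I. xvec I (q * N) s j)"
    by (rule add_mono)
  also have "\<dots> \<le> xvec I (q * N + N) s i"
    by (rule xvec_add_ge[OF Suc.prems])
  finally show ?case
    by (simp add: add.commute)
qed simp

text \<open>Whole blocks from time 0, then a remainder shorter than \<open>N\<close>. The block law
  contributes one error \<open>d n\<close>, the two prefix sums bounding the remainder two
  more.\<close>

lemma xvec_lower_bound:
  fixes c d m :: real
  assumes fin: "\<forall>k i j. s k i j \<noteq> \<infinity>" and live: "\<forall>k. \<forall>i\<in>I. \<exists>j\<in>I. s k i j \<noteq> -\<infinity>"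
    and i: "i \<in> I" and N: "N > 0"
    and G: "\<forall>q. \<bar>(\<Sum>k<q. MIN i\<in>I. real_of_ereal (xvec I N (shift_seq (k * N) s) i)) - m * real q\<bar> \<le> d * real q + C"
    and B: "\<forall>q. \<bar>(\<Sum>k<q. entry_bound (s k)) - b * real q\<bar> \<le> d * real q + C'"
    and m: "c * real N \<le> m" and "0 \<le> b" "0 \<le> d"
  shows "ereal ((c - 3 * d) * real n - (real N * (\<bar>c\<bar> + b) + C + 2 * C')) \<le> xvec I n s i"
proof -
  define SB where "SB q = (\<Sum>k<q. entry_bound (s k))" for q
  define SG where "SG q = (\<Sum>k<q. MIN i\<in>I. real_of_ereal (xvec I N (shift_seq (k * N) s) i))" for q
  define q where "q = n div N"
  define r where "r = n mod N"
  have n: "n = q * N + r" "r < N"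
    using N by (simp_all add: q_def r_def)
  let ?t = "shift_seq (q * N) s"
  have t: "\<forall>k i j. ?t k i j \<noteq> \<infinity>" "\<forall>k. \<forall>i\<in>I. \<exists>j\<in>I. ?t k i j \<noteq> -\<infinity>"
    using fin live by (simp_all add: shift_seq_def)
  have "- ereal (\<Sum>k<r. entry_bound (?t k)) \<le> xvec I r ?t i"
    by (rule xvec_ge[OF t(1) xvec_no_line[OF t i]])
  moreover have "(\<Sum>k<r. entry_bound (?t k)) = SB n - SB (q * N)"
    unfolding n(1) SB_def by (simp add: shift_seq_def sum_lessThan_add)
  moreover have "ereal (SG q) \<le> (INF j\<in>I. xvec I (q * N) s j)"
    unfolding SG_def by (intro INF_greatest xvec_ge_block_sum fin live)
  ultimately have "ereal (- (SB n - SB (q * N))) + ereal (SG q) \<le> xvec I r ?t i + (INF j\<in>I. xvec I (q * N) s j)"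
    by (intro add_mono) simp_all
  also have "\<dots> \<le> xvec I n s i"
    unfolding n(1) by (rule xvec_add_ge[OF i])
  finally have x: "ereal (SG q - (SB n - SB (q * N))) \<le> xvec I n s i"
    by (simp add: algebra_simps)
  have dn: "d * real (q * N) \<le> d * real n" "d * real q \<le> d * real n"
  proof -
    have "q \<le> q * N"
      using N by simp
    then have "q \<le> n" "q * N \<le> n"
      using n(1) by linarith+
    then show "d * real (q * N) \<le> d * real n" "d * real q \<le> d * real n"
      using \<open>0 \<le> d\<close> by (auto intro!: mult_left_mono simp del: of_nat_mult)
  qed
  have "SB n - SB (q * N) \<le> b * real N + 2 * (d * real n) + 2 * C'"
  proof -
    have "b * real n - b * real (q * N) = b * real r"
      using n(1) by (simp add: algebra_simps)
    moreover have "b * real r \<le> b * real N"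
      using n(2) \<open>0 \<le> b\<close> by (intro mult_left_mono) auto
    ultimately show ?thesis
      using abs_le_D1[OF B[rule_format, of n]] abs_le_D2[OF B[rule_format, of "q * N"]] dn(1)
      unfolding SB_def[symmetric] by linarith
  qed
  moreover have "c * real n - \<bar>c\<bar> * real N - d * real n - C \<le> SG q"
  proof -
    have "(c * real N) * real q \<le> m * real q"
      using m by (intro mult_right_mono) auto
    moreover have "(c * real N) * real q = c * real n - c * real r"
      using n(1) by (simp add: algebra_simps)
    moreover have "c * real r \<le> \<bar>c\<bar> * real r"
      by (intro mult_right_mono) auto
    moreover have "\<bar>c\<bar> * real r \<le> \<bar>c\<bar> * real N"
      using n(2) by (intro mult_left_mono) auto
    ultimately show ?thesis
      using abs_le_D2[OF G[rule_format, of q]] dn(2) unfolding SG_def[symmetric] by linarith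
  qed
  moreover have "(c - 3 * d) * real n = c * real n - 3 * (d * real n)"
    "real N * (\<bar>c\<bar> + b) = \<bar>c\<bar> * real N + b * real N"
    by (simp_all add: algebra_simps)
  ultimately have "(c - 3 * d) * real n - (real N * (\<bar>c\<bar> + b) + C + 2 * C') \<le> SG q - (SB n - SB (q * N))"
    by linarith
  with x show ?thesis
    by (meson ereal_less_eq(3) order_trans)
qed

context mp_iid
begin

lemma integrable_yvec: "integrable S (\<lambda>s. real_of_ereal (yvec I n s i))"
  unfolding yvec_eq_xvec
  by (rule integrable_distr[where M' = S]) (simp_all only: distr_reverse_prefix integrable_xvec measurable_reverse_prefix)

text \<open>The bridge from the reversed vector, where growth is proved, to the orbit: an
  expectation at a single time depends only on the law.\<close>

lemma integral_Min_yvec: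
  assumes "I \<noteq> {}"
  shows "(\<integral>s. (MIN i\<in>I. real_of_ereal (yvec I n s i)) \<partial>S) = (\<integral>s. (MIN i\<in>I. real_of_ereal (xvec I n s i)) \<partial>S)"
proof -
  have "integrable S (\<lambda>s. MIN i\<in>I. real_of_ereal (xvec I n s i))"
    by (intro integrable_MIN finite assms integrable_xvec)
  then have "(\<lambda>s. MIN i\<in>I. real_of_ereal (xvec I n s i)) \<in> borel_measurable S"
    by blast
  from integral_distr[OF measurable_reverse_prefix[of n] this] show ?thesis
    by (simp only: distr_reverse_prefix yvec_eq_xvec)
qed

lemma AE_xvec_ge:
  assumes I: "I \<noteq> {}" and no_line: "AE a in M. \<forall>i\<in>I. \<exists>j\<in>I. a i j \<noteq> -\<infinity>"
    and poss: "\<And>i u. i \<in> I \<Longrightarrow> ereal u < \<gamma> \<Longrightarrow> slope_possible I i u" and r: "ereal r < \<gamma>"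
  shows "AE s in S. \<forall>i\<in>I. \<forall>\<^sub>F n in sequentially. ereal (r * real n) \<le> xvec I n s i"
proof -
  \<comment> \<open>\<open>u3\<close> is exceeded infinitely often by \<open>yvec\<close>,
    \<open>u2\<close> is the slope of its expected minimum, \<open>u1\<close> the mean slope over
    one long block, and the gap from \<open>r\<close> to \<open>u1\<close> absorbs the three errors
    of \<open>xvec_lower_bound\<close>.\<close>
  obtain u3 where u3: "r < u3" "ereal u3 < \<gamma>"
    using r ereal_dense2 by force
  obtain u2 where u2: "r < u2" "u2 < u3"
    using dense[OF u3(1)] by blast
  obtain u1 where u1: "r < u1" "u1 < u2"
    using dense[OF u2(1)] by blast
  have live: "AE s in S. \<forall>k. \<forall>i\<in>I. \<exists>j\<in>I. s k i j \<noteq> -\<infinity>"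
    by (rule AE_component_all[OF no_line])
  have finite_yvec: "\<bar>yvec I n s i\<bar> \<noteq> \<infinity>"
    if "\<forall>k i j. s k i j \<noteq> \<infinity>" "\<forall>k. \<forall>i\<in>I. \<exists>j\<in>I. s k i j \<noteq> -\<infinity>" "i \<in> I" for n s i
  proof -
    have s: "\<forall>k i j. reverse_prefix n s k i j \<noteq> \<infinity>" "\<forall>k. \<forall>i\<in>I. \<exists>j\<in>I. reverse_prefix n s k i j \<noteq> -\<infinity>"
      using that by (simp_all add: reverse_prefix_def)
    show ?thesis
      using xvec_no_line[OF s that(3), of n] xvec_le[OF s(1), of I n i] by (auto simp: yvec_eq_xvec)
  qed
  interpret superadditive_states M 1 I "\<lambda>i n s. real_of_ereal (yvec I n s i)" "\<lambda>i m s. yarg I m s i"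
    "\<lambda>s. entry_bound (s 0)"
  proof unfold_locales
    show "AE s in S. \<forall>i\<in>I. - entry_bound (s 0) \<le> real_of_ereal (yvec I 1 s i)"
      using AE_seq_not_infinity
    proof eventually_elim
      case (elim s)
      have "reverse_prefix 1 s = s"
        by (auto simp: reverse_prefix_def)
      moreover have "- (\<Sum>k<1. entry_bound (s k)) \<le> real_of_ereal (xvec I 1 s i)" for i
        using abs_le_D2[OF xvec_abs_le[OF elim, of I 1 i]] by linarith
      ultimately show ?case
        by (simp add: yvec_eq_xvec)
    qed
    show "AE s in S. \<forall>i\<in>I. \<forall>m n. real_of_ereal (yvec I m s i)
        + real_of_ereal (yvec I n (shift_seq (m * 1) s) (yarg I m s i)) \<le> real_of_ereal (yvec I (m + n) s i)"
      using AE_seq_not_infinity live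
    proof eventually_elim
      case (elim s)
      show ?case
      proof (intro ballI allI)
        fix i m n assume i: "i \<in> I"
        let ?j = "yarg I m s i"
        have t: "\<forall>k i j. shift_seq m s k i j \<noteq> \<infinity>" "\<forall>k. \<forall>i\<in>I. \<exists>j\<in>I. shift_seq m s k i j \<noteq> -\<infinity>"
          using elim by (simp_all add: shift_seq_def)
        obtain a b c where "yvec I m s i = ereal a" "yvec I n (shift_seq m s) ?j = ereal b" "yvec I (m + n) s i = ereal c"
          using finite_yvec[OF elim i] finite_yvec[OF t yarg_in[OF i]] by (metis ereal_real)
        then show "real_of_ereal (yvec I m s i) + real_of_ereal (yvec I n (shift_seq (m * 1) s) ?j)
            \<le> real_of_ereal (yvec I (m + n) s i)"
          using yvec_add_ge[OF i, of m s n] by simp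
      qed
    qed
  qed (use I in \<open>auto simp: integrable_yvec integrable_component_bound entry_bound_nonneg yarg_in comb_seq_def
        intro!: arg_cong[where f = real_of_ereal] fun_cong[OF yvec_cong] fun_cong[OF yarg_cong]\<close>)
  have "0 < measure S {s \<in> space S. \<exists>\<^sub>\<infinity>n. u3 * real n \<le> real_of_ereal (yvec I n s i)}" if i: "i \<in> I" for i
  proof -
    have [measurable]: "(\<lambda>s. real_of_ereal (yvec I n s i)) \<in> borel_measurable S" for n
      by measurable
    have "0 < measure S {s \<in> space S. \<exists>\<^sub>\<infinity>n. ereal (u3 * real n) \<le> yvec I n s i}"
      by (rule slope_possible_frequently(1)[OF poss[OF i u3(2)]])
    also have "\<dots> \<le> measure S {s \<in> space S. \<exists>\<^sub>\<infinity>n. u3 * real n \<le> real_of_ereal (yvec I n s i)}"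
    proof (rule P.finite_measure_mono_AE)
      show "AE s in S. s \<in> {s \<in> space S. \<exists>\<^sub>\<infinity>n. ereal (u3 * real n) \<le> yvec I n s i}
          \<longrightarrow> s \<in> {s \<in> space S. \<exists>\<^sub>\<infinity>n. u3 * real n \<le> real_of_ereal (yvec I n s i)}"
        using AE_seq_not_infinity live
      proof eventually_elim
        case (elim s)
        have "u3 * real n \<le> real_of_ereal (yvec I n s i)" if "ereal (u3 * real n) \<le> yvec I n s i" for n
          using finite_yvec[OF elim i, of n] that by (cases "yvec I n s i") auto
        then show ?case
          by (auto elim!: INFM_mono)
      qed
      show "{s \<in> space S. \<exists>\<^sub>\<infinity>n. u3 * real n \<le> real_of_ereal (yvec I n s i)} \<in> sets S"
        unfolding INFM_nat by measurable
    qed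
    finally show ?thesis .
  qed
  from expectation_Min_ge[OF u2(2) this] obtain C
    where C: "\<And>q. u2 * real q - C \<le> (\<integral>s. (MIN i\<in>I. real_of_ereal (xvec I q s i)) \<partial>S)"
    by (auto simp: integral_Min_yvec[OF I])
  have "\<forall>\<^sub>F N in sequentially. N > 0 \<and> u1 * real N + C \<le> u2 * real N"
    using eventually_gt_at_top[of 0] eventually_linear_le[OF u1(2), of C] by (rule eventually_conj)
  \<comment> \<open>One block long enough for the constant \<open>C\<close> to be paid by
    \<open>u2 - u1\<close>.\<close>
  then obtain N where N: "N > 0" "u1 * real N + C \<le> u2 * real N"
    by (auto simp: eventually_sequentially)
  let ?g = "\<lambda>s. MIN i\<in>I. real_of_ereal (xvec I N s i)"
  have Eg: "u1 * real N \<le> (\<integral>s. ?g s \<partial>S)"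
    using N(2) C[of N] by linarith
  have int_g: "integrable S ?g"
    by (intro integrable_MIN finite I integrable_xvec)
  have prefix: "?g (comb_seq N s s') = ?g s" for s s'
    by simp
  show ?thesis
    using block_strong_law[OF int_g prefix] AE_entry_sums AE_seq_not_infinity live
  proof eventually_elim
    case (elim s)
    define e where "e = (u1 - r) / 4"
    have e: "e > 0" "r < u1 - 3 * e"
      using u1(1) by (auto simp: e_def field_simps)
    obtain C1 where C1: "\<forall>q. \<bar>(\<Sum>k<q. ?g (shift_seq (k * N) s)) - (\<integral>s. ?g s \<partial>S) * real q\<bar> \<le> e * real q + C1"
      using elim(1) e(1) by blast
    obtain C2 where C2: "\<forall>q. \<bar>(\<Sum>k<q. entry_bound (s k)) - \<beta> * real q\<bar> \<le> e * real q + C2"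
      using elim(2) e(1) by blast
    show ?case
    proof
      fix i assume i: "i \<in> I"
      have lower: "ereal ((u1 - 3 * e) * real n - (real N * (\<bar>u1\<bar> + \<beta>) + C1 + 2 * C2)) \<le> xvec I n s i" for n
        using e(1) by (intro xvec_lower_bound[OF elim(3,4) i N(1) C1 C2 Eg \<beta>_nonneg]) simp
      from eventually_linear_le[OF e(2), of "real N * (\<bar>u1\<bar> + \<beta>) + C1 + 2 * C2"]
      show "\<forall>\<^sub>F n in sequentially. ereal (r * real n) \<le> xvec I n s i"
      proof eventually_elim
        case (elim n)
        then have "ereal (r * real n) \<le> ereal ((u1 - 3 * e) * real n - (real N * (\<bar>u1\<bar> + \<beta>) + C1 + 2 * C2))"
          by simp
        from this lower show ?case
          by (rule order_trans)
      qed
    qed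
  qed
qed

text \<open>Full rows keep the orbit above minus the entry sums, hence above slope
  \<open>- \<beta> - 1\<close> up to a constant, so the slope \<open>- \<beta> - 2\<close> cannot be
  an upper bound.\<close>

lemma top_exponent_not_minus_infinity: "top_exponent i \<noteq> -\<infinity>"
proof
  assume "top_exponent i = -\<infinity>"
  then have "AE s in S. \<exists>C. \<forall>n. xvec UNIV n s i \<le> ereal ((- \<beta> - 2) * real n + C)"
    by (intro AE_xvec_le) simp
  then have "AE s in S. False"
    using AE_entry_sums AE_seq_not_infinity AE_component_all[OF AE_no_line]
  proof eventually_elim
    case (elim s)
    obtain C where C: "\<And>n. xvec UNIV n s i \<le> ereal ((- \<beta> - 2) * real n + C)"
      using elim(1) by blast
    obtain C' where C': "\<And>n. \<bar>(\<Sum>k<n. entry_bound (s k)) - \<beta> * real n\<bar> \<le> 1 * real n + C'"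
      using elim(2) zero_less_one by blast
    have live: "\<forall>k. \<forall>i\<in>UNIV. \<exists>j\<in>UNIV. s k i j \<noteq> -\<infinity>"
      using elim(4) by simp
    have "1 * real n \<le> C + C'" for n
    proof -
      have "- ereal (\<Sum>k<n. entry_bound (s k)) \<le> xvec UNIV n s i"
        by (rule xvec_ge[OF elim(3) xvec_no_line[OF elim(3) live]]) simp
      also note C[of n]
      finally show ?thesis
        using abs_le_D1[OF C'[of n]] by (simp add: algebra_simps)
    qed
    from linear_le_const_imp_le[OF this] show False by simp
  qed
  then show False by simp
qed

lemma self_in_top_nodes: "i \<in> top_nodes i"
  using top_exponent_attained by (simp add: top_nodes_def)

lemma top_exponent_scc: "i \<in> scc arcs i0 \<Longrightarrow> top_exponent i = top_exponent i0"
  by (rule antisym) (auto simp: scc_def intro: top_exponent_mono)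

lemma AE_xvec_tendsto:
  assumes no_line: "AE a in M. \<forall>i\<in>top_nodes i0. \<exists>j\<in>top_nodes i0. a i j \<noteq> -\<infinity>"
    and i: "i \<in> scc arcs i0"
  shows "AE s in S. (\<lambda>n. xvec UNIV n s i / ereal (real n)) \<longlonglongrightarrow> top_exponent i0"
proof (rule AE_tendsto_ereal)
  let ?H = "top_nodes i0"
  have H: "?H \<noteq> {}"
    using self_in_top_nodes by blast
  \<comment> \<open>\<open>i\<close> and \<open>i0\<close> reach each other and share the same top
    exponent, so membership of \<open>i\<close> in its own set transfers.\<close>
  have iH: "i \<in> ?H"
    using self_in_top_nodes[of i] i top_exponent_scc[OF i] unfolding top_nodes_def scc_def
    by (auto intro: rtrancl_trans)
  fix r assume r: "ereal r < top_exponent i0"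
  have "AE s in S. \<forall>i\<in>?H. \<forall>\<^sub>F n in sequentially. ereal (r * real n) \<le> xvec ?H n s i"
  proof (rule AE_xvec_ge[OF H no_line _ r])
    fix j u assume "j \<in> ?H" "ereal u < top_exponent i0"
    then show "slope_possible ?H j u"
      by (rule slope_possible_top_nodes)
  qed
  then show "AE s in S. \<forall>\<^sub>F n in sequentially. ereal (r * real n) \<le> xvec UNIV n s i"
  proof eventually_elim
    case (elim s)
    then have "\<forall>\<^sub>F n in sequentially. ereal (r * real n) \<le> xvec ?H n s i"
      using iH by blast
    then show ?case
      by eventually_elim (auto intro: order_trans xvec_mono)
  qed
next
  fix r assume "top_exponent i0 < ereal r"
  then obtain c where c: "top_exponent i < ereal c" "c < r"
    using ereal_dense2 top_exponent_scc[OF i] by force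
  from AE_xvec_le[OF c(1)]
  show "AE s in S. \<forall>\<^sub>F n in sequentially. xvec UNIV n s i \<le> ereal (r * real n)"
  proof eventually_elim
    case (elim s)
    then obtain C where C: "\<And>n. xvec UNIV n s i \<le> ereal (c * real n + C)"
      by blast
    from eventually_linear_le[OF c(2), of C] show ?case
    proof eventually_elim
      case (elim n)
      then have "ereal (c * real n + C) \<le> ereal (r * real n)"
        by simp
      with C[of n] show ?case
        by (rule order_trans)
    qed
  qed
qed

text \<open>
  When row \<open>i\<close> has no arc into \<open>top_nodes i0\<close>, the path from \<open>i\<close> is forced to leave for nodes
  of smaller exponent. This happens infinitely often and pulls \<open>xvec\<close> below a slope which is
  nevertheless exceeded with positive probability.
\<close>

lemma oscillation:
  assumes "\<not> (AE a in M. \<forall>i\<in>top_nodes i0. \<exists>j\<in>top_nodes i0. a i j \<noteq> -\<infinity>)"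
  shows "\<exists>i c u. c < u \<and> (AE s in S. \<exists>\<^sub>\<infinity>n. xvec UNIV n s i \<le> ereal (c * real n))
    \<and> 0 < measure S {s \<in> space S. \<exists>\<^sub>\<infinity>n. ereal (u * real n) \<le> xvec UNIV n s i}"
proof -
  let ?H = "top_nodes i0"
  obtain i where i: "i \<in> ?H" "\<not> (AE a in M. \<exists>j\<in>?H. a i j \<noteq> -\<infinity>)"
    using assms by (auto simp: AE_finite_all)
  let ?D = "{a \<in> space M. \<forall>j\<in>?H. a i j = -\<infinity>}"
  have D: "?D \<in> sets M"
    by measurable
  have "0 < measure M ?D"
  proof (rule ccontr)
    assume "\<not> 0 < measure M ?D"
    then have "?D \<in> null_sets M"
      using D by (simp add: null_sets_def M.emeasure_eq_measure order_antisym not_less)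
    from AE_not_in[OF this] AE_space have "AE a in M. \<exists>j\<in>?H. a i j \<noteq> -\<infinity>"
      by eventually_elim auto
    with i(2) show False by blast
  qed
  with D have freq: "AE s in S. \<exists>\<^sub>\<infinity>k. \<forall>j\<in>?H. s k i j = -\<infinity>"
    by (rule AE_frequently)
  define E where "E = {j. (i, j) \<in> arcs \<and> j \<notin> ?H}"
  have ii: "(i0, i) \<in> arcs\<^sup>*"
    using i(1) by (simp add: top_nodes_def)
  \<comment> \<open>Equality would make \<open>j\<close> lead to a component attaining the top
    exponent, and so put it into \<open>top_nodes i0\<close>.\<close>
  have less: "top_exponent j < top_exponent i0" if "j \<in> E" for j
  proof -
    have j: "(i0, j) \<in> arcs\<^sup>*" "j \<notin> ?H"
      using that ii by (auto simp: E_def)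
    obtain k where "(j, k) \<in> arcs\<^sup>*" "exponent (scc arcs k) = top_exponent j"
      using top_exponent_attained by blast
    with j have "top_exponent j \<noteq> top_exponent i0"
      by (auto simp: top_nodes_def)
    with top_exponent_mono[OF j(1)] show ?thesis
      by simp
  qed
  \<comment> \<open>The inserted element makes \<open>Max\<close> meaningful without inspecting
    \<open>E\<close>; that it lies strictly below is the finiteness of the top exponent.\<close>
  have "Max (insert (-\<infinity>) (top_exponent ` E)) < top_exponent i0"
    using less top_exponent_not_minus_infinity[of i0] by (subst Max_less_iff) auto
  then obtain c where c: "Max (insert (-\<infinity>) (top_exponent ` E)) < ereal c" "ereal c < top_exponent i0"
    using ereal_dense2 by blast
  then obtain u where u: "c < u" "ereal u < top_exponent i0"
    using ereal_dense2 by force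
  \<comment> \<open>\<open>c\<close> bounds the nodes of \<open>E\<close>, \<open>c1 - c\<close>
    pays for the arc into \<open>E\<close>, \<open>c2 - c1\<close> for the constants, and the gap
    from \<open>c2\<close> to \<open>u\<close> is the oscillation.\<close>
  obtain c2 where c2: "c < c2" "c2 < u"
    using dense[OF u(1)] by blast
  obtain c1 where c1: "c < c1" "c1 < c2"
    using dense[OF c2(1)] by blast
  have "AE s in S. \<exists>C. \<forall>n. xvec UNIV n s j \<le> ereal (c * real n + C)" if "j \<in> E" for j
    using that c(1) by (intro AE_xvec_le) auto
  then have "AE s in S. \<forall>j\<in>E. \<exists>C. \<forall>n. xvec UNIV n s j \<le> ereal (c * real n + C)"
    by (simp add: AE_finite_all)
  then have "AE s in S. \<exists>\<^sub>\<infinity>n. xvec UNIV n s i \<le> ereal (c2 * real n)"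
    using freq AE_entry_le AE_arcs AE_seq_not_infinity
  proof eventually_elim
    case (elim s)
    obtain f where f: "\<And>j n. j \<in> E \<Longrightarrow> xvec UNIV n s j \<le> ereal (c * real n + f j)"
      using elim(1) by metis
    define K where "K = (\<Sum>j\<in>E. \<bar>f j\<bar>)"
    have "c1 - c > 0"
      using c1 by simp
    then obtain K' where K': "\<And>k. entry_bound (s k) \<le> (c1 - c) * real k + K'"
      using elim(3) by blast
    have bound: "xvec UNIV (Suc k) s i \<le> ereal (c1 * real k + K + K')" if bot: "\<forall>j\<in>?H. s k i j = -\<infinity>" for k
    proof -
      have "s k i j + xvec UNIV k s j \<le> ereal (c1 * real k + K + K')" for j
      proof (cases "s k i j = -\<infinity>")
        case True
        then show ?thesis
          using xvec_le[OF elim(5), of UNIV k j] by (cases "xvec UNIV k s j") auto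
      next
        case False
        then have j: "j \<in> E"
          using bot elim(4) by (auto simp: E_def)
        have "s k i j + xvec UNIV k s j \<le> ereal (entry_bound (s k)) + ereal (c * real k + f j)"
          using elim(5) by (intro add_mono entry_le f[OF j]) auto
        also have "\<dots> = ereal (entry_bound (s k) + (c * real k + f j))"
          by simp
        also have "entry_bound (s k) + (c * real k + f j) \<le> c1 * real k + K + K'"
        proof -
          have "f j \<le> \<bar>f j\<bar>"
            by simp
          also have "\<dots> \<le> K"
            unfolding K_def using j by (intro member_le_sum) auto
          finally show ?thesis
            using K'[of k] by (simp add: algebra_simps)
        qed
        finally show ?thesis by simp
      qed
      then show ?thesis
        by (auto simp: mp_mult_vec_def intro!: SUP_least)
    qed
    have "\<forall>\<^sub>F k in cofinite. c1 * real k + (K + K' - c2) \<le> c2 * real k"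
      unfolding cofinite_eq_sequentially by (rule eventually_linear_le[OF c1(2)])
    \<comment> \<open>The matrix at time \<open>k\<close> acts last in the product of length
      \<open>k + 1\<close>; the \<open>c2\<close> among the constants reflects this index
      shift.\<close>
    from INFM_conjI[OF elim(2) this]
    have "\<exists>\<^sub>\<infinity>k. xvec UNIV (Suc k) s i \<le> ereal (c2 * real (Suc k))"
    proof (rule INFM_mono)
      fix k assume k: "(\<forall>j\<in>?H. s k i j = -\<infinity>) \<and> c1 * real k + (K + K' - c2) \<le> c2 * real k"
      then have "ereal (c1 * real k + K + K') \<le> ereal (c2 * real (Suc k))"
        by (simp add: algebra_simps)
      with bound k show "xvec UNIV (Suc k) s i \<le> ereal (c2 * real (Suc k))"
        by (blast intro: order_trans)
    qed
    then show "\<exists>\<^sub>\<infinity>n. xvec UNIV n s i \<le> ereal (c2 * real n)"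
      unfolding INFM_nat by (meson less_Suc_eq less_trans)
  qed
  moreover have "slope_possible UNIV i u"
    by (rule slope_possible_mono[OF slope_possible_top_nodes[OF i(1) u(2)]]) simp
  ultimately show ?thesis
    using c2(2) slope_possible_frequently(2) by blast
qed

end

section \<open>Convergence of the orbit\<close>

lemma E_comps_scc:
  "E_comps M A (scc (arcs_of M A) i) = scc (arcs_of M A) ` ((arcs_of M A)\<^sup>* `` {i})"
  by (auto simp: E_comps_def scc_classes_eq leads_to_scc)

lemma H_nodes_scc:
  assumes "gamma_max M A (scc (arcs_of M A) i) = g"
  shows "H_nodes M A (scc (arcs_of M A) i) = {j. (i, j) \<in> (arcs_of M A)\<^sup>*
    \<and> (\<exists>k. (j, k) \<in> (arcs_of M A)\<^sup>* \<and> lyapunov M A (scc (arcs_of M A) k) = g)}"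
    (is "?L = ?R")
proof
  let ?A = "arcs_of M A"
  show "?L \<subseteq> ?R"
  proof
    fix j assume "j \<in> ?L"
    then obtain l k where l: "(i, l) \<in> ?A\<^sup>*" "j \<in> scc ?A l" and k: "(l, k) \<in> ?A\<^sup>*" "lyapunov M A (scc ?A k) = g"
      by (auto simp: H_nodes_def G_comps_def E_comps_scc scc_classes_eq leads_to_scc assms)
    have "(l, j) \<in> ?A\<^sup>*" "(j, l) \<in> ?A\<^sup>*"
      using l(2) by (auto simp: scc_def)
    then show "j \<in> ?R"
      using l(1) k by (auto intro: rtrancl_trans)
  qed
  show "?R \<subseteq> ?L"
  proof
    fix j assume "j \<in> ?R"
    then obtain k where k: "(i, j) \<in> ?A\<^sup>*" "(j, k) \<in> ?A\<^sup>*" "lyapunov M A (scc ?A k) = g"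
      by auto
    then have "scc ?A j \<in> G_comps M A (scc ?A i)"
      by (auto simp: G_comps_def E_comps_scc scc_classes_eq leads_to_scc assms)
    then show "j \<in> ?L"
      unfolding H_nodes_def using scc_self[of j ?A] by blast
  qed
qed

text \<open>The row condition makes the set under \<open>Max\<close> nonempty, so its maximum is
  nonnegative and dominates also the entries \<open>-\<infinity>\<close>, whose real value is
  0.\<close>

lemma integrable_entry_bound_of_Max:
  fixes B :: "'w \<Rightarrow> 'n::finite mp_mat"
  assumes [measurable]: "B \<in> measurable M mp_mat_space" and no_line: "no_bot_line M UNIV B"
    and int: "integrable M (\<lambda>\<omega>. Max {\<bar>real_of_ereal (B \<omega> i j)\<bar> | i j. B \<omega> i j \<noteq> -\<infinity>})"
  shows "integrable M (\<lambda>\<omega>. entry_bound (B \<omega>))"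
  unfolding entry_bound_def
proof (intro Bochner_Integration.integrable_sum)
  fix i j :: 'n
  note measurable_mp_entry [measurable]
  have "(\<lambda>\<omega>. B \<omega> i j) \<in> borel_measurable M"
    by measurable
  then have [measurable]: "(\<lambda>\<omega>. \<bar>real_of_ereal (B \<omega> i j)\<bar>) \<in> borel_measurable M"
    by measurable
  show "integrable M (\<lambda>\<omega>. \<bar>real_of_ereal (B \<omega> i j)\<bar>)"
  proof (rule Bochner_Integration.integrable_bound[OF int])
    show "AE \<omega> in M. norm \<bar>real_of_ereal (B \<omega> i j)\<bar>
        \<le> norm (Max {\<bar>real_of_ereal (B \<omega> i j)\<bar> | i j. B \<omega> i j \<noteq> -\<infinity>})"
      using no_line unfolding no_bot_line_def
    proof eventually_elim
      case (elim \<omega>)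
      let ?X = "{\<bar>real_of_ereal (B \<omega> i j)\<bar> | i j. B \<omega> i j \<noteq> -\<infinity>}"
      have "?X \<subseteq> (\<lambda>(i, j). \<bar>real_of_ereal (B \<omega> i j)\<bar>) ` UNIV"
        by auto
      then have fin: "finite ?X"
        by (rule finite_subset) simp
      obtain j' where j': "B \<omega> i j' \<noteq> -\<infinity>"
        using elim by auto
      have "\<bar>real_of_ereal (B \<omega> i j)\<bar> \<le> Max ?X"
      proof (cases "B \<omega> i j = -\<infinity>")
        case True
        have "0 \<le> \<bar>real_of_ereal (B \<omega> i j')\<bar>"
          by (rule abs_ge_zero)
        also have "\<dots> \<le> Max ?X"
          by (rule Max_ge[OF fin]) (use j' in blast)
        finally show ?thesis
          using True by simp
      next
        case False
        then show ?thesis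
          by (intro Max_ge[OF fin]) blast
      qed
      then show ?case
        by (simp only: real_norm_def abs_idempotent order_trans[OF _ abs_ge_self])
    qed
  qed measurable
qed

theorem theorem2p5:
  fixes M :: "'w measure" and A :: "nat \<Rightarrow> 'w \<Rightarrow> 'n::finite \<Rightarrow> 'n \<Rightarrow> ereal"
  assumes "prob_space M"
    and values_Rmax: "\<And>n \<omega> i j. \<omega> \<in> space M \<Longrightarrow> A n \<omega> i j \<noteq> \<infinity>"
    and indep: "prob_space.indep_vars M (\<lambda>_. mp_mat_space) A UNIV"
    and ident: "\<And>n. distr M mp_mat_space (A n) = distr M mp_mat_space (A 0)"
    and no_line: "no_bot_line M UNIV (A 0)"
    and integ: "integrable M
      (\<lambda>\<omega>. Max {\<bar>real_of_ereal (A 0 \<omega> i j)\<bar> | i j. A 0 \<omega> i j \<noteq> -\<infinity>})"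
  shows
    "((AE \<omega> in M. \<exists>l :: 'n \<Rightarrow> real. \<forall>i.
          (\<lambda>n. mp_orbit (\<lambda>k. A k \<omega>) n i / ereal (real n)) \<longlonglongrightarrow> ereal (l i))
        \<longleftrightarrow> (\<forall>c \<in> scc_classes (arcs_of M A). no_bot_line M (H_nodes M A c) (A 0)))
     \<and> ((\<forall>c \<in> scc_classes (arcs_of M A). no_bot_line M (H_nodes M A c) (A 0))
        \<longrightarrow> (\<forall>c \<in> scc_classes (arcs_of M A). AE \<omega> in M. \<forall>i\<in>c.
              (\<lambda>n. mp_orbit (\<lambda>k. A k \<omega>) n i / ereal (real n)) \<longlonglongrightarrow> gamma_max M A c))"
proof -
  interpret M: prob_space M by fact
  have rv: "A n \<in> measurable M mp_mat_space" for n
    using indep by (auto simp: M.indep_vars_def2)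
  note rv [measurable] and measurable_mp_entry [measurable]
  define M0 where "M0 = distr M mp_mat_space (A 0)"
  have sets_M0: "sets M0 = sets mp_mat_space"
    by (simp add: M0_def)
  interpret M0: prob_space M0
    unfolding M0_def by (rule M.prob_space_distr) (rule rv)
  have AE_M0: "(AE a in M0. Q a) \<longleftrightarrow> (AE \<omega> in M. Q (A 0 \<omega>))"
    if "{a \<in> space mp_mat_space. Q a} \<in> sets mp_mat_space" for Q :: "'n mp_mat \<Rightarrow> bool"
    unfolding M0_def by (rule AE_distr_iff[OF rv that])
  have no_bot_line_iff: "no_bot_line M I (A 0) \<longleftrightarrow> (AE a in M0. \<forall>i\<in>I. \<exists>j\<in>I. a i j \<noteq> -\<infinity>)" for I
    unfolding no_bot_line_def by (rule AE_M0[symmetric]) measurable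
  have bound: "entry_bound \<in> borel_measurable mp_mat_space"
    unfolding entry_bound_def by measurable
  have integrable_M0: "integrable M0 entry_bound"
    unfolding M0_def integrable_distr_eq[OF rv bound]
    by (rule integrable_entry_bound_of_Max[OF rv no_line integ])
  interpret D: mp_iid M0
  proof unfold_locales
    show "AE a in M0. \<forall>i j. a i j \<noteq> \<infinity>"
      by (subst AE_M0) (auto intro!: AE_I2 values_Rmax)
    show "AE a in M0. \<forall>i. \<exists>j. a i j \<noteq> -\<infinity>"
      using no_line by (simp add: no_bot_line_iff)
  qed (fact sets_M0 integrable_M0)+
  let ?S = "\<Pi>\<^sub>M n\<in>(UNIV :: nat set). M0"
  define X where "X \<omega> = (\<lambda>n. A n \<omega>)" for \<omega>
  have sets_S: "sets ?S = sets (\<Pi>\<^sub>M n\<in>(UNIV :: nat set). mp_mat_space)"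
    by (intro sets_PiM_cong refl sets_M0)
  have X: "X \<in> measurable M ?S"
    unfolding X_def measurable_cong_sets[OF refl sets_S]
    by (rule measurable_PiM_single') (auto simp: rv space_PiM intro: measurable_space[OF rv])
  \<comment> \<open>Independence as a statement on joint laws: the sequence of matrices is
    distributed as the product of the marginals, all equal to \<open>M0\<close>.\<close>
  have "distr M (\<Pi>\<^sub>M n\<in>UNIV. mp_mat_space) (\<lambda>\<omega>. \<lambda>n\<in>UNIV. A n \<omega>) = (\<Pi>\<^sub>M n\<in>UNIV. distr M mp_mat_space (A n))"
    using M.indep_vars_iff_distr_eq_PiM[of UNIV A "\<lambda>_. mp_mat_space"] indep rv by simp
  moreover have "(\<lambda>n. distr M mp_mat_space (A n)) = (\<lambda>_. M0)"
    unfolding M0_def by (rule ext) (rule ident)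
  moreover have "distr M ?S X = distr M (\<Pi>\<^sub>M n\<in>UNIV. mp_mat_space) X"
    by (rule distr_cong[OF refl sets_S refl])
  ultimately have distr_X: "distr M ?S X = ?S"
    by (simp add: X_def[abs_def] restrict_def)
  have AE_X: "AE \<omega> in M. Q (X \<omega>)" if "AE s in ?S. Q s" for Q
    by (rule AE_distrD[OF X]) (simp only: distr_X that)
  have arcs: "arcs_of M A = D.arcs"
  proof -
    have "measure M {\<omega> \<in> space M. A 0 \<omega> i j \<noteq> -\<infinity>} = measure M0 {a \<in> space M0. a i j \<noteq> -\<infinity>}" for i j
      unfolding M0_def
      by (subst measure_distr[OF rv]) (auto intro!: arg_cong[where f = "measure M"] measurable_space[OF rv])
    then show ?thesis
      by (simp add: arcs_of_def D.arcs_def)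
  qed
  have lyapunov: "lyapunov M A I = D.exponent I" if "I \<noteq> {}" for I
    unfolding lyapunov_def
  proof (rule the_equality)
    show *: "AE \<omega> in M. (\<lambda>n. (SUP i\<in>I. SUP j\<in>I. mp_prod I (\<lambda>k. A k \<omega>) n i j) / ereal (real n))
        \<longlonglongrightarrow> D.exponent I"
      using AE_X[OF D.exponent_properties(2)[OF that]] by (simp add: X_def xmax_eq_mp_prod)
    fix \<gamma> assume "AE \<omega> in M. (\<lambda>n. (SUP i\<in>I. SUP j\<in>I. mp_prod I (\<lambda>k. A k \<omega>) n i j) / ereal (real n)) \<longlonglongrightarrow> \<gamma>"
    from M.AE_LIMSEQ_unique[OF this *] show "\<gamma> = D.exponent I" .
  qed
  have gamma_max: "gamma_max M A (scc D.arcs i) = D.top_exponent i" for i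
    unfolding gamma_max_def D.top_exponent_def using E_comps_scc[of M A i]
    by (simp add: arcs image_image lyapunov scc_nonempty)
  have H_nodes: "H_nodes M A (scc D.arcs i) = D.top_nodes i" for i
    using H_nodes_scc[OF gamma_max[folded arcs], of i]
    by (simp add: arcs D.top_nodes_def lyapunov scc_nonempty)
  have orbit: "mp_orbit (\<lambda>k. A k \<omega>) n = xvec UNIV n (X \<omega>)" for n \<omega>
    by (simp add: mp_orbit_eq_xvec X_def)
  have limit: "AE \<omega> in M. (\<lambda>n. xvec UNIV n (X \<omega>) i / ereal (real n)) \<longlonglongrightarrow> D.top_exponent i0"
    if "\<forall>c \<in> scc_classes D.arcs. no_bot_line M (H_nodes M A c) (A 0)" "i \<in> scc D.arcs i0" for i i0
  proof (rule AE_X[OF D.AE_xvec_tendsto[OF _ that(2)]])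
    have "no_bot_line M (H_nodes M A (scc D.arcs i0)) (A 0)"
      using that(1) by (auto simp: scc_classes_eq)
    then show "AE a in M0. \<forall>i\<in>D.top_nodes i0. \<exists>j\<in>D.top_nodes i0. a i j \<noteq> -\<infinity>"
      by (simp add: H_nodes no_bot_line_iff)
  qed
  show ?thesis
    unfolding orbit arcs
  proof (intro conjI iffI impI ballI)
    assume conv: "AE \<omega> in M. \<exists>l :: 'n \<Rightarrow> real. \<forall>i. (\<lambda>n. xvec UNIV n (X \<omega>) i / ereal (real n)) \<longlonglongrightarrow> ereal (l i)"
    fix c assume "c \<in> scc_classes D.arcs"
    then obtain i0 where c: "c = scc D.arcs i0"
      by (auto simp: scc_classes_eq)
    show "no_bot_line M (H_nodes M A c) (A 0)"
    proof (rule ccontr)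
      assume "\<not> ?thesis"
      then have "\<not> (AE a in M0. \<forall>i\<in>D.top_nodes i0. \<exists>j\<in>D.top_nodes i0. a i j \<noteq> -\<infinity>)"
        by (simp add: c H_nodes no_bot_line_iff)
      from D.oscillation[OF this] obtain i b u where "b < u"
        and le: "AE s in ?S. \<exists>\<^sub>\<infinity>n. xvec UNIV n s i \<le> ereal (b * real n)"
        and pos: "0 < measure ?S {s \<in> space ?S. \<exists>\<^sub>\<infinity>n. ereal (u * real n) \<le> xvec UNIV n s i}"
        by blast
      let ?U = "{s \<in> space ?S. \<exists>\<^sub>\<infinity>n. ereal (u * real n) \<le> xvec UNIV n s i}"
      have U: "?U \<in> sets ?S"
        unfolding INFM_nat by measurable
      have "AE \<omega> in M. X \<omega> \<notin> ?U"
        using conv AE_X[OF le]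
      proof eventually_elim
        case (elim \<omega>)
        then obtain l :: real where l: "(\<lambda>n. xvec UNIV n (X \<omega>) i / ereal (real n)) \<longlonglongrightarrow> ereal l"
          by blast
        \<comment> \<open>Infinitely many values at slope \<open>b\<close> keep the limit at most
          \<open>v\<close>, hence below \<open>u\<close>; convergence thus excludes reaching slope
          \<open>u\<close> infinitely often.\<close>
        define v where "v = (b + u) / 2"
        have v: "b < v" "v < u"
          using \<open>b < u\<close> by (auto simp: v_def)
        have "\<not> ereal v < ereal l"
        proof
          assume "ereal v < ereal l"
          then have "\<forall>\<^sub>F n in cofinite. ereal v < xvec UNIV n (X \<omega>) i / ereal (real n)"
            unfolding cofinite_eq_sequentially by (rule order_tendstoD[OF l])
          then have "\<forall>\<^sub>F n in cofinite. ereal v < xvec UNIV n (X \<omega>) i / ereal (real n) \<and> n > 0"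
            using eventually_gt_at_top[of "0::nat"] unfolding cofinite_eq_sequentially by (rule eventually_conj)
          with elim(2) obtain n where n: "xvec UNIV n (X \<omega>) i \<le> ereal (b * real n)"
            "ereal v < xvec UNIV n (X \<omega>) i / ereal (real n)" "n > 0"
            using frequently_ex[OF INFM_conjI] by blast
          have "xvec UNIV n (X \<omega>) i / ereal (real n) \<le> ereal b"
            using n(1,3) by (subst ereal_divide_le_pos) (auto simp: mult.commute)
          with n(2) v(1) show False
            by (auto dest: less_le_trans)
        qed
        then have "ereal l < ereal u"
          using v(2) by (auto simp: not_less intro: le_less_trans)
        then have "\<forall>\<^sub>F n in sequentially. xvec UNIV n (X \<omega>) i / ereal (real n) < ereal u"
          by (rule order_tendstoD[OF l])
        then have "\<forall>\<^sub>F n in sequentially. \<not> ereal (u * real n) \<le> xvec UNIV n (X \<omega>) i"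
          using eventually_gt_at_top[of 0]
        proof eventually_elim
          case (elim n)
          show ?case
          proof
            assume "ereal (u * real n) \<le> xvec UNIV n (X \<omega>) i"
            then have "ereal u \<le> xvec UNIV n (X \<omega>) i / ereal (real n)"
              using elim(2) by (subst ereal_le_divide_pos) (auto simp: mult.commute)
            with elim(1) show False by simp
          qed
        qed
        then show ?case
          by (simp add: frequently_def cofinite_eq_sequentially)
      qed
      then have "measure M (X -` ?U \<inter> space M) = 0"
        by (subst M.prob_eq_0[OF measurable_sets[OF X U]]) (auto elim!: eventually_mono)
      also have "measure M (X -` ?U \<inter> space M) = measure (distr M ?S X) ?U"
        by (rule measure_distr[OF X U, symmetric])
      finally show False
        using pos by (simp only: distr_X less_irrefl)
    qed
  next
    assume no_bot: "\<forall>c \<in> scc_classes D.arcs. no_bot_line M (H_nodes M A c) (A 0)"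
    have "AE \<omega> in M. \<forall>i. (\<lambda>n. xvec UNIV n (X \<omega>) i / ereal (real n)) \<longlonglongrightarrow> D.top_exponent i"
      using limit[OF no_bot scc_self] by (simp add: AE_all_countable)
    then show "AE \<omega> in M. \<exists>l :: 'n \<Rightarrow> real. \<forall>i. (\<lambda>n. xvec UNIV n (X \<omega>) i / ereal (real n)) \<longlonglongrightarrow> ereal (l i)"
    proof eventually_elim
      case (elim \<omega>)
      have "D.top_exponent i = ereal (real_of_ereal (D.top_exponent i))" for i
        using D.top_exponent_not_infinity[of i] D.top_exponent_not_minus_infinity[of i]
        by (cases "D.top_exponent i") auto
      with elim show ?case
        by (intro exI[of _ "\<lambda>i. real_of_ereal (D.top_exponent i)"]) metis
    qed
  next
    fix c assume no_bot: "\<forall>c \<in> scc_classes D.arcs. no_bot_line M (H_nodes M A c) (A 0)"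
      and "c \<in> scc_classes D.arcs"
    then obtain i0 where "c = scc D.arcs i0"
      by (auto simp: scc_classes_eq)
    then show "AE \<omega> in M. \<forall>i\<in>c. (\<lambda>n. xvec UNIV n (X \<omega>) i / ereal (real n)) \<longlonglongrightarrow> gamma_max M A c"
      using limit[OF no_bot] by (simp add: gamma_max AE_finite_all)
  qed
qed

end
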